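(* Let $n\ge 4$ be an even integer and let $u\in C^\infty(\mathbb{R}^n)$ be such that the conformal metric $g=e^{2u}|dx|^2$ on $\mathbb{R}^n$ is complete and has finite total Q-curvature. If there are constants $C>0$ and $p\ge0$ such that the scalar curvature satisfies $R_g(x)\ge C|x|^{-p}$ near infinity, then the volume entropy $\tau(g)$ satisfies $$\tau(g)\le\min\left\{1,\frac p2\right\}.$$
   Context: For a smooth function $u$ on $\mathbb{R}^n$ ($n\ge4$ even) and $g=e^{2u}|dx|^2$ (with $|dx|^2$ the Euclidean metric), the Q-curvature $Q$ of $g$ is the function defined by $(-\Delta)^{n/2}u=Qe^{nu}$, where $\Delta$ is the Euclidean Laplacian. The metric has finite total Q-curvature if $Qe^{nu}\in L^1(\mathbb{R}^n)$. The scalar curvature of $g$ is $R_g=2(n-1)e^{-2u}\left(-\Delta u-\frac{n-2}{2}|\nabla u|^2\right)$. "Near infinity" means outside some compact set. The volume entropy of $g$ is $$\tau(g):=\limsup_{r\to\infty}\frac{\log V_g(B_r(0))}{\log|B_r(0)|},$$ where $B_r(0)$ is the Euclidean ball of radius $r$ centered at the origin, $V_g(B_r(0))=\int_{B_r(0)}e^{nu}dx$ is its volume with respect to $g$, and $|B_r(0)|$ is its Euclidean volume. *)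

theory Defs
  imports "HOL-Analysis.Analysis"
begin

section \<open>Smooth functions, the Euclidean Laplacian and gradient\<close>

definition partial_deriv :: "'a::euclidean_space \<Rightarrow> ('a \<Rightarrow> real) \<Rightarrow> 'a \<Rightarrow> real" where
  "partial_deriv b f x = frechet_derivative f (at x) b"

primrec C_k :: "nat \<Rightarrow> ('a::euclidean_space \<Rightarrow> real) \<Rightarrow> bool" where
  "C_k 0 f \<longleftrightarrow> continuous_on UNIV f"
| "C_k (Suc k) f \<longleftrightarrow>
     (\<forall>x. f differentiable (at x)) \<and> (\<forall>b\<in>Basis. C_k k (partial_deriv b f))"

definition smooth :: "('a::euclidean_space \<Rightarrow> real) \<Rightarrow> bool" where
  "smooth f \<longleftrightarrow> (\<forall>k. C_k k f)"

definition laplacian :: "('a::euclidean_space \<Rightarrow> real) \<Rightarrow> 'a \<Rightarrow> real" where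
  "laplacian f x = (\<Sum>b\<in>Basis. partial_deriv b (partial_deriv b f) x)"

definition gradient :: "('a::euclidean_space \<Rightarrow> real) \<Rightarrow> 'a \<Rightarrow> 'a" where
  "gradient f x = (\<Sum>b\<in>Basis. partial_deriv b f x *\<^sub>R b)"


section \<open>The conformal metric \<open>g = e\<^sup>2\<^sup>u |dx|\<^sup>2\<close>\<close>

text \<open>
  The metric is represented by its conformal exponent \<open>u\<close>; the dimension \<open>n\<close> is that of the type \<open>'a\<close>.
\<close>

text \<open>
  \<^const>\<open>valid_path\<close> allows the derivative to be unbounded near the finitely many exceptional
  parameters, so a path may have infinite length. The length is therefore taken in
  \<^typ>\<open>ennreal\<close>; a Bochner or gauge integral would assign such paths the length \<open>0\<close>.
\<close>

definition conf_speed :: "('a::euclidean_space \<Rightarrow> real) \<Rightarrow> (real \<Rightarrow> 'a) \<Rightarrow> real \<Rightarrow> real" where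
  "conf_speed u \<gamma> t = exp (u (\<gamma> t)) * norm (vector_derivative \<gamma> (at t))"

definition conf_length :: "('a::euclidean_space \<Rightarrow> real) \<Rightarrow> (real \<Rightarrow> 'a) \<Rightarrow> ennreal" where
  "conf_length u \<gamma> = (\<integral>\<^sup>+t\<in>{0..1}. ennreal (conf_speed u \<gamma> t) \<partial>lborel)"

definition conf_edist :: "('a::euclidean_space \<Rightarrow> real) \<Rightarrow> 'a \<Rightarrow> 'a \<Rightarrow> ennreal" where
  "conf_edist u x y =
     (INF \<gamma> \<in> {\<gamma>. valid_path \<gamma> \<and> pathstart \<gamma> = x \<and> pathfinish \<gamma> = y}. conf_length u \<gamma>)"

definition conf_dist :: "('a::euclidean_space \<Rightarrow> real) \<Rightarrow> 'a \<Rightarrow> 'a \<Rightarrow> real" where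
  "conf_dist u x y = enn2real (conf_edist u x y)"

text \<open>
  Completeness refers to the metric space given by the Riemannian distance of \<open>g\<close>; that
  \<^const>\<open>conf_dist\<close> satisfies \<^locale>\<open>Metric_space\<close> is proved at the end, in
  \<open>Metric_space_conf_dist\<close>.
\<close>

definition conf_complete :: "('a::euclidean_space \<Rightarrow> real) \<Rightarrow> bool" where
  "conf_complete u \<longleftrightarrow> Metric_space.mcomplete UNIV (conf_dist u)"

text \<open>The Q-curvature is the function \<open>Q\<close> determined by \<open>(-\<Delta>)\<^sup>n\<^sup>/\<^sup>2 u = Q e\<^sup>n\<^sup>u\<close>.\<close>

definition Q_curvature :: "('a::euclidean_space \<Rightarrow> real) \<Rightarrow> 'a \<Rightarrow> real" where
  "Q_curvature u x =
     (((\<lambda>f y. - laplacian f y) ^^ (DIM('a) div 2)) u) x / exp (real DIM('a) * u x)"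

definition finite_total_Q_curvature :: "('a::euclidean_space \<Rightarrow> real) \<Rightarrow> bool" where
  "finite_total_Q_curvature u \<longleftrightarrow>
     integrable lborel (\<lambda>x. Q_curvature u x * exp (real DIM('a) * u x))"

definition scalar_curvature :: "('a::euclidean_space \<Rightarrow> real) \<Rightarrow> 'a \<Rightarrow> real" where
  "scalar_curvature u x =
     2 * (real DIM('a) - 1) * exp (- 2 * u x) *
       (- laplacian u x - (real DIM('a) - 2) / 2 * (norm (gradient u x))\<^sup>2)"

definition conf_volume :: "('a::euclidean_space \<Rightarrow> real) \<Rightarrow> 'a set \<Rightarrow> real" where
  "conf_volume u A = (LINT x:A|lborel. exp (real DIM('a) * u x))"

definition volume_entropy :: "('a::euclidean_space \<Rightarrow> real) \<Rightarrow> ereal" where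
  "volume_entropy u =
     Limsup at_top (\<lambda>r::real.
       ereal (ln (conf_volume u (ball 0 r)) / ln (measure lborel (ball (0::'a) r))))"


section \<open>The Riemannian distance is a metric\<close>

lemma conf_length_AE:
  assumes "finite S" "\<And>t. t \<in> {0..1} - S \<Longrightarrow> ennreal (conf_speed u \<gamma> t) = h t"
    "\<And>t. t \<notin> {0..1} \<Longrightarrow> t \<notin> S \<Longrightarrow> h t = 0"
  shows "conf_length u \<gamma> = (\<integral>\<^sup>+t. h t \<partial>lborel)"
  unfolding conf_length_def
proof (rule nn_integral_cong_AE)
  have "AE t in lborel. t \<notin> S"
    using assms(1) by (intro AE_not_in) (simp add: finite_imp_null_set_lborel)
  then show "AE t in lborel. ennreal (conf_speed u \<gamma> t) * indicator {0..1} t = h t"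
    by eventually_elim (use assms in \<open>auto simp: indicator_def\<close>)
qed

text \<open>A Borel measurable representative of the integrand defining the length.\<close>

definition conf_h ::
  "('a::euclidean_space \<Rightarrow> real) \<Rightarrow> (real \<Rightarrow> 'a) \<Rightarrow> real set \<Rightarrow> real \<Rightarrow> ennreal" where
  "conf_h u \<gamma> S t = ennreal (indicator ({0..1} - S) t *\<^sub>R conf_speed u \<gamma> t)"

lemma conf_speed_continuous:
  assumes u: "continuous_on UNIV u" and "path \<gamma>" "\<gamma> C1_differentiable_on ({0..1} - S)"
  shows "continuous_on ({0..1} - S) (conf_speed u \<gamma>)"
proof -
  have "continuous_on ({0..1} - S) \<gamma>"
    using assms(2) continuous_on_subset unfolding path_def by blast
  then have "continuous_on ({0..1} - S) (\<lambda>t. u (\<gamma> t))"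
    using continuous_on_compose2[OF u] by blast
  then show ?thesis using assms(3)
    unfolding conf_speed_def C1_differentiable_on_eq by (intro continuous_intros) auto
qed

lemma conf_h_meas:
  assumes "finite S" "continuous_on UNIV u" "path \<gamma>" "\<gamma> C1_differentiable_on ({0..1} - S)"
  shows "conf_h u \<gamma> S \<in> borel_measurable borel"
proof -
  have [measurable]: "(\<lambda>t. indicator ({0..1} - S) t *\<^sub>R conf_speed u \<gamma> t) \<in> borel_measurable borel"
    by (rule borel_measurable_continuous_on_indicator)
       (use conf_speed_continuous assms in \<open>auto intro: borel_closed finite_imp_closed\<close>)
  have "(\<lambda>t. ennreal (indicator ({0..1} - S) t *\<^sub>R conf_speed u \<gamma> t)) \<in> borel_measurable borel"
    by measurable
  then show ?thesis unfolding conf_h_def .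
qed

lemma conf_length_h:
  assumes "finite S"
  shows "conf_length u \<gamma> = (\<integral>\<^sup>+t. conf_h u \<gamma> S t \<partial>lborel)"
  by (rule conf_length_AE[OF assms]) (auto simp: conf_h_def)

lemma valid_path_C1:
  assumes "valid_path \<gamma>"
  obtains S where "finite S" "path \<gamma>" "\<gamma> C1_differentiable_on ({0..1} - S)"
  using assms unfolding valid_path_def piecewise_C1_differentiable_on_def path_def by blast

lemma conf_length_affine_piece:
  assumes "continuous_on UNIV u" "finite S" "path \<gamma>" "\<gamma> C1_differentiable_on ({0..1} - S)" "c \<noteq> 0"
  shows "conf_length u \<gamma> = (\<integral>\<^sup>+t. ennreal \<bar>c\<bar> * conf_h u \<gamma> S (a + c * t) \<partial>lborel)"
proof -
  note [measurable] = conf_h_meas[OF assms(2,1,3,4)]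
  have "conf_length u \<gamma> = ennreal \<bar>c\<bar> * (\<integral>\<^sup>+t. conf_h u \<gamma> S (a + c * t) \<partial>lborel)"
    unfolding conf_length_h[OF assms(2)] by (rule nn_integral_real_affine) (use assms in auto)
  also have "\<dots> = (\<integral>\<^sup>+t. ennreal \<bar>c\<bar> * conf_h u \<gamma> S (a + c * t) \<partial>lborel)"
    by (rule nn_integral_cmult[symmetric]) measurable
  finally show ?thesis .
qed

lemma conf_speed_affine:
  assumes "\<gamma> differentiable (at (a + c * t))" "e > 0"
    "\<And>s. dist s t < e \<Longrightarrow> \<gamma>' s = \<gamma> (a + c * s)"
  shows "conf_speed u \<gamma>' t = \<bar>c\<bar> * conf_speed u \<gamma> (a + c * t)"
proof -
  have "((\<lambda>s. a + c * s) has_vector_derivative c) (at t)"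
    by (auto intro!: derivative_eq_intros simp: has_vector_derivative_def)
  then have "((\<gamma> \<circ> (\<lambda>s. a + c * s)) has_vector_derivative
      c *\<^sub>R vector_derivative \<gamma> (at (a + c * t))) (at t)"
    by (rule vector_diff_chain_at) (use assms(1) vector_derivative_works in blast)
  then have "(\<gamma>' has_vector_derivative c *\<^sub>R vector_derivative \<gamma> (at (a + c * t))) (at t)"
    by (rule has_vector_derivative_transform_within[OF _ assms(2)]) (use assms(3) in auto)
  then show ?thesis
    using assms(3)[of t] assms(2) by (simp add: conf_speed_def vector_derivative_at)
qed

lemma C1_diffD: "\<gamma> C1_differentiable_on T \<Longrightarrow> t \<in> T \<Longrightarrow> \<gamma> differentiable (at t)"
  by (auto simp: C1_differentiable_on_eq)

lemma conf_length_reversepath: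
  assumes "continuous_on UNIV u" "valid_path \<gamma>"
  shows "conf_length u (reversepath \<gamma>) = conf_length u \<gamma>"
proof -
  obtain S where S: "finite S" "path \<gamma>" "\<gamma> C1_differentiable_on ({0..1} - S)"
    using valid_path_C1[OF assms(2)] .
  have "conf_length u (reversepath \<gamma>) = (\<integral>\<^sup>+t. ennreal \<bar>-1\<bar> * conf_h u \<gamma> S (1 + (-1) * t) \<partial>lborel)"
  proof (rule conf_length_AE[of "(\<lambda>t. 1 - t) ` S"])
    show "finite ((\<lambda>t. 1 - t) ` S)" using S by simp
    fix t :: real assume t: "t \<in> {0..1} - (\<lambda>t. 1 - t) ` S"
    have ns: "1 - t \<notin> S" using t by (metis DiffD2 diff_diff_eq2 add_diff_cancel_left' image_eqI)
    have "conf_speed u (reversepath \<gamma>) t = \<bar>-1\<bar> * conf_speed u \<gamma> (1 + (-1) * t)"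
      by (rule conf_speed_affine[of _ _ _ _ 1])
         (use C1_diffD[OF S(3)] t ns in \<open>auto simp: reversepath_def\<close>)
    then show "ennreal (conf_speed u (reversepath \<gamma>) t) = ennreal \<bar>-1\<bar> * conf_h u \<gamma> S (1 + (-1) * t)"
      using t ns by (auto simp: conf_h_def)
  qed (auto simp: conf_h_def)
  then show ?thesis using conf_length_affine_piece[OF assms(1) S, of "-1" 1] by simp
qed

lemma conf_length_join:
  assumes "continuous_on UNIV u" "valid_path \<gamma>1" "valid_path \<gamma>2"
  shows "conf_length u (\<gamma>1 +++ \<gamma>2) = conf_length u \<gamma>1 + conf_length u \<gamma>2"
proof -
  obtain S where S: "finite S" "path \<gamma>1" "\<gamma>1 C1_differentiable_on ({0..1} - S)"
    using valid_path_C1[OF assms(2)] .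
  obtain T where T: "finite T" "path \<gamma>2" "\<gamma>2 C1_differentiable_on ({0..1} - T)"
    using valid_path_C1[OF assms(3)] .
  note [measurable] = conf_h_meas[OF S(1) assms(1) S(2,3)] conf_h_meas[OF T(1) assms(1) T(2,3)]
  define X where "X = {1/2} \<union> (\<lambda>t. t / 2) ` S \<union> (\<lambda>t. (t + 1) / 2) ` T"
  have XS: "2 * t \<notin> S" if "t \<notin> X" for t
    using that unfolding X_def by (auto simp: image_iff mult.commute)
  have XT: "2 * t - 1 \<notin> T" if "t \<notin> X" for t
    using that unfolding X_def by (auto simp: image_iff)
  have "conf_length u (\<gamma>1 +++ \<gamma>2) =
     (\<integral>\<^sup>+t. ennreal \<bar>2\<bar> * conf_h u \<gamma>1 S (0 + 2 * t) + ennreal \<bar>2\<bar> * conf_h u \<gamma>2 T (-1 + 2 * t) \<partial>lborel)"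
  proof (rule conf_length_AE[of X])
    show "finite X" using S T by (simp add: X_def)
    fix t :: real assume t: "t \<in> {0..1} - X"
    then have t12: "t \<noteq> 1/2" by (auto simp: X_def)
    show "ennreal (conf_speed u (\<gamma>1 +++ \<gamma>2) t) =
      ennreal \<bar>2\<bar> * conf_h u \<gamma>1 S (0 + 2 * t) + ennreal \<bar>2\<bar> * conf_h u \<gamma>2 T (-1 + 2 * t)"
    proof (cases "t < 1/2")
      case True
      have "conf_speed u (\<gamma>1 +++ \<gamma>2) t = \<bar>2\<bar> * conf_speed u \<gamma>1 (0 + 2 * t)"
        by (rule conf_speed_affine[of _ _ _ _ "1/2 - t"])
           (use True t XS C1_diffD[OF S(3)] in \<open>auto simp: joinpaths_def dist_real_def\<close>)
      then show ?thesis using True t XS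
        by (auto simp: conf_h_def indicator_def ennreal_mult')
    next
      case False
      have "conf_speed u (\<gamma>1 +++ \<gamma>2) t = \<bar>2\<bar> * conf_speed u \<gamma>2 (-1 + 2 * t)"
        by (rule conf_speed_affine[of _ _ _ _ "t - 1/2"])
           (use False t t12 XT C1_diffD[OF T(3)] in \<open>auto simp: joinpaths_def dist_real_def\<close>)
      then show ?thesis using False t t12 XT
        by (auto simp: conf_h_def indicator_def ennreal_mult')
    qed
  qed (auto simp: conf_h_def)
  also have "\<dots> = conf_length u \<gamma>1 + conf_length u \<gamma>2"
  proof -
    have "conf_length u \<gamma>1 = (\<integral>\<^sup>+t. ennreal \<bar>2\<bar> * conf_h u \<gamma>1 S (0 + 2 * t) \<partial>lborel)"
      by (rule conf_length_affine_piece[OF assms(1) S]) simp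
    moreover have "conf_length u \<gamma>2 = (\<integral>\<^sup>+t. ennreal \<bar>2\<bar> * conf_h u \<gamma>2 T (-1 + 2 * t) \<partial>lborel)"
      by (rule conf_length_affine_piece[OF assms(1) T]) simp
    ultimately show ?thesis
      by (simp only:) (rule nn_integral_add; measurable)
  qed
  finally show ?thesis .
qed

lemma conf_length_linepath_finite:
  assumes u: "continuous_on UNIV u"
  shows "conf_length u (linepath x y) < \<infinity>"
proof -
  have "continuous_on {0..1} (conf_speed u (linepath x y))"
    using conf_speed_continuous[OF u, of "linepath x y" "{}"]
    by (auto simp: C1_differentiable_on_eq)
  then have "compact (conf_speed u (linepath x y) ` {0..1})"
    by (intro compact_continuous_image) auto
  then obtain B where B: "\<And>t. t \<in> {0..1} \<Longrightarrow> conf_speed u (linepath x y) t \<le> B"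
    using compact_imp_bounded bounded_real by (metis abs_le_D1 image_eqI)
  have "conf_length u (linepath x y) \<le> (\<integral>\<^sup>+t\<in>{0..1::real}. ennreal B \<partial>lborel)"
    unfolding conf_length_def
    by (intro nn_integral_mono) (auto simp: indicator_def B ennreal_leI)
  also have "\<dots> < \<infinity>"
    by (subst nn_integral_cmult_indicator) (auto simp: ennreal_mult_less_top)
  finally show ?thesis .
qed

lemma conf_length_lower:
  assumes u: "continuous_on UNIV u" and g: "valid_path \<gamma>" "pathstart \<gamma> = x" "pathfinish \<gamma> = y"
    and m: "m \<ge> 0" "\<And>z. z \<in> cball x (dist x y) \<Longrightarrow> m \<le> exp (u z)"
  shows "ennreal (m * dist x y) \<le> conf_length u \<gamma>"
proof -
  obtain S where S: "finite S" "path \<gamma>" "\<gamma> C1_differentiable_on ({0..1} - S)"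
    using valid_path_C1[OF g(1)] .
  define r where "r = dist x y"
  have cont: "continuous_on {0..1} \<gamma>" using S by (simp add: path_def)
  have g01: "\<gamma> 0 = x" "\<gamma> 1 = y" using g by (auto simp: pathstart_def pathfinish_def)
  define E where "E = {t \<in> {0..1}. dist x (\<gamma> t) \<in> {r..}}"
  have "E = {0..1} \<inter> (\<lambda>t. dist x (\<gamma> t)) -` {r..}" by (auto simp: E_def)
  moreover have "continuous_on {0..1} (\<lambda>t. dist x (\<gamma> t))" using cont by (intro continuous_intros)
  ultimately have "closed E" by (simp add: continuous_closed_preimage)
  moreover have "bounded E" unfolding E_def by (rule bounded_subset[of "{0..1}"]) auto
  ultimately have "compact E" by (simp add: compact_eq_bounded_closed)
  moreover have "1 \<in> E" by (auto simp: E_def g01 r_def)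
  ultimately obtain s where s: "s \<in> E" "\<And>t. t \<in> E \<Longrightarrow> s \<le> t"
    using compact_attains_inf by (metis empty_iff)
  have s01: "0 \<le> s" "s \<le> 1" and rs: "r \<le> dist x (\<gamma> s)" using s by (auto simp: E_def)
  have inside: "\<gamma> t \<in> cball x r" if "0 \<le> t" "t < s" for t
  proof (rule ccontr)
    assume "\<gamma> t \<notin> cball x r"
    then have "t \<in> E" using that s01 by (auto simp: E_def)
    then show False using s(2) that by force
  qed
  define f where "f t = indicator ({0..s} - S) t *\<^sub>R vector_derivative \<gamma> (at t)" for t
  have "f \<in> borel_measurable borel" unfolding f_def
  proof (rule borel_measurable_continuous_on_indicator)
    show "{0..s} - S \<in> sets borel" using S by (auto intro: borel_closed finite_imp_closed)
    show "continuous_on ({0..s} - S) (\<lambda>t. vector_derivative \<gamma> (at t))"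
      using S(3) s01 unfolding C1_differentiable_on_eq
      by (auto elim!: continuous_on_subset)
  qed
  then have [measurable]: "f \<in> borel_measurable lborel" by simp
  have "((\<lambda>t. vector_derivative \<gamma> (at t)) has_integral (\<gamma> s - \<gamma> 0)) {0..s}"
  proof (rule fundamental_theorem_of_calculus_interior_strong[OF S(1) s01(1)])
    fix t assume "t \<in> {0<..<s} - S"
    then show "(\<gamma> has_vector_derivative vector_derivative \<gamma> (at t)) (at t)"
      using C1_diffD[OF S(3)] s01 vector_derivative_works by force
  qed (use cont s01 in \<open>auto intro: continuous_on_subset\<close>)
  then have "(f has_integral (\<gamma> s - \<gamma> 0)) {0..s}"
    by (rule has_integral_spike_finite[OF S(1), rotated]) (auto simp: f_def)
  then have fi: "(f has_integral (\<gamma> s - \<gamma> 0)) UNIV"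
    by (rule has_integral_on_superset) (auto simp: f_def)
  have "ennreal (norm (\<gamma> s - \<gamma> 0)) \<le> (\<integral>\<^sup>+t. ennreal (norm (f t)) \<partial>lborel)"
  proof (cases "(\<integral>\<^sup>+t. ennreal (norm (f t)) \<partial>lborel) < \<infinity>")
    case True
    then have int: "integrable lborel f" by (intro integrableI_bounded) auto
    then have "integral\<^sup>L lborel f = \<gamma> s - \<gamma> 0"
      using has_integral_integral_lborel fi has_integral_unique by blast
    then show ?thesis using integral_norm_bound_ennreal[OF int] by simp
  next
    case False
    then show ?thesis by (simp add: less_top[symmetric])
  qed
  moreover have "norm (\<gamma> s - \<gamma> 0) \<ge> r" using rs g01 by (simp add: dist_norm norm_minus_commute)
  ultimately have lb: "ennreal r \<le> (\<integral>\<^sup>+t. ennreal (norm (f t)) \<partial>lborel)"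
    by (meson ennreal_leI order_trans)
  have "ennreal (m * r) = ennreal m * ennreal r" using m by (simp add: ennreal_mult r_def)
  also have "\<dots> \<le> ennreal m * (\<integral>\<^sup>+t. ennreal (norm (f t)) \<partial>lborel)"
    using lb by (intro mult_left_mono) auto
  also have "\<dots> = (\<integral>\<^sup>+t. ennreal m * ennreal (norm (f t)) \<partial>lborel)"
    by (rule nn_integral_cmult[symmetric]) measurable
  also have "\<dots> \<le> (\<integral>\<^sup>+t. ennreal (conf_speed u \<gamma> t) * indicator {0..1} t \<partial>lborel)"
  proof (rule nn_integral_mono_AE)
    have "AE t in lborel. t \<notin> {s}"
      by (intro AE_not_in) (simp add: finite_imp_null_set_lborel)
    then show "AE t in lborel. ennreal m * ennreal (norm (f t))
        \<le> ennreal (conf_speed u \<gamma> t) * indicator {0..1} t"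
    proof eventually_elim
      case (elim t)
      show ?case
      proof (cases "t \<in> {0..s} - S")
        case True
        then have "m \<le> exp (u (\<gamma> t))" using elim inside m(2) by (auto simp: r_def)
        then have "m * norm (vector_derivative \<gamma> (at t)) \<le> conf_speed u \<gamma> t"
          unfolding conf_speed_def by (intro mult_right_mono) auto
        then show ?thesis using True s01 m
          by (auto simp: f_def indicator_def ennreal_mult[symmetric] intro!: ennreal_leI)
      qed (auto simp: f_def)
    qed
  qed
  finally show ?thesis unfolding conf_length_def r_def .
qed

lemma Metric_space_conf_dist:
  assumes u: "continuous_on UNIV u"
  shows "Metric_space UNIV (conf_dist u)"
proof -
  have d: "conf_dist u x y = enn2real (conf_edist u x y)" for x y
    by (simp add: conf_dist_def)
  have fin: "conf_edist u x y < \<infinity>" for x y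
  proof -
    have "conf_edist u x y \<le> conf_length u (linepath x y)"
      unfolding conf_edist_def by (intro INF_lower) auto
    then show ?thesis using conf_length_linepath_finite[OF u] le_less_trans by blast
  qed
  have sym: "conf_edist u x y \<le> conf_edist u y x" for x y
    unfolding conf_edist_def
  proof (rule INF_mono)
    fix \<gamma> assume g: "\<gamma> \<in> {\<gamma>. valid_path \<gamma> \<and> pathstart \<gamma> = y \<and> pathfinish \<gamma> = x}"
    then show "\<exists>\<gamma>'\<in>{\<gamma>. valid_path \<gamma> \<and> pathstart \<gamma> = x \<and> pathfinish \<gamma> = y}.
        conf_length u \<gamma>' \<le> conf_length u \<gamma>"
      using conf_length_reversepath[OF u, of \<gamma>] by (intro bexI[of _ "reversepath \<gamma>"]) auto
  qed
  have tri: "conf_edist u x z \<le> conf_edist u x y + conf_edist u y z" for x y z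
  proof (rule ennreal_le_epsilon)
    fix e :: real assume e: "e > 0"
    have "\<exists>\<gamma>. valid_path \<gamma> \<and> pathstart \<gamma> = a \<and> pathfinish \<gamma> = b
         \<and> conf_length u \<gamma> < conf_edist u a b + ennreal (e/2)" for a b
    proof -
      have "conf_edist u a b < conf_edist u a b + ennreal (e/2)"
        using fin[of a b] e by (cases "conf_edist u a b") (auto simp: ennreal_plus[symmetric] ennreal_less_iff simp del: ennreal_plus)
      then show ?thesis
        unfolding conf_edist_def[of u a b] INF_less_iff by auto
    qed note ex = this
    obtain g1 where g1: "valid_path g1" "pathstart g1 = x" "pathfinish g1 = y"
      "conf_length u g1 < conf_edist u x y + ennreal (e/2)" using ex by blast
    obtain g2 where g2: "valid_path g2" "pathstart g2 = y" "pathfinish g2 = z"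
      "conf_length u g2 < conf_edist u y z + ennreal (e/2)" using ex by blast
    have "conf_edist u x z \<le> conf_length u (g1 +++ g2)"
      unfolding conf_edist_def using g1 g2 by (intro INF_lower) (auto intro: valid_path_join)
    also have "\<dots> = conf_length u g1 + conf_length u g2"
      by (rule conf_length_join[OF u g1(1) g2(1)])
    also have "\<dots> \<le> (conf_edist u x y + ennreal (e/2)) + (conf_edist u y z + ennreal (e/2))"
      using g1(4) g2(4) by (intro add_mono) auto
    also have "\<dots> = conf_edist u x y + conf_edist u y z + (ennreal (e/2) + ennreal (e/2))"
      by (simp only: ac_simps)
    also have "ennreal (e/2) + ennreal (e/2) = ennreal e"
      using e by (subst ennreal_plus[symmetric]) auto
    finally show "conf_edist u x z \<le> conf_edist u x y + conf_edist u y z + ennreal e" .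
  qed
  have pos: "conf_edist u x y > 0" if "x \<noteq> y" for x y
  proof -
    have "continuous_on (cball x (dist x y)) (\<lambda>z. exp (u z))"
      using u by (intro continuous_intros) (auto intro: continuous_on_subset)
    then obtain z0 where z0: "\<And>z. z \<in> cball x (dist x y) \<Longrightarrow> exp (u z0) \<le> exp (u z)"
      using continuous_attains_inf[of "cball x (dist x y)" "\<lambda>z. exp (u z)"]
      by (metis cball_eq_empty compact_cball not_less zero_le_dist)
    have "ennreal (exp (u z0) * dist x y) \<le> conf_edist u x y"
      unfolding conf_edist_def by (intro INF_greatest conf_length_lower[OF u]) (use z0 in auto)
    moreover have "ennreal (exp (u z0) * dist x y) > 0" using that by simp
    ultimately show ?thesis by (rule less_le_trans[rotated])
  qed
  have refl: "conf_edist u x x = 0" for x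
  proof -
    have "conf_edist u x x \<le> conf_length u (linepath x x)"
      unfolding conf_edist_def by (intro INF_lower) auto
    also have "\<dots> = 0" by (simp add: conf_length_def conf_speed_def)
    finally show ?thesis by simp
  qed
  show ?thesis
  proof
    show "conf_dist u x y = conf_dist u y x" for x y
      unfolding d using sym by (metis order_antisym)
    show "conf_dist u x y = 0 \<longleftrightarrow> x = y" for x y
      unfolding d enn2real_eq_0_iff
      using pos[of x y] refl fin[of x y] by (cases "x = y") auto
    show "conf_dist u x z \<le> conf_dist u x y + conf_dist u y z" for x y z
      unfolding d using tri fin by (subst enn2real_plus[symmetric]) (auto intro!: enn2real_mono simp: less_top[symmetric])
  qed (auto simp: d)
qed

end

theory Submission
  imports Defs "HOL-Real_Asymp.Real_Asymp"
begin

text \<open>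
  Write \<open>n = 2 (M + 1)\<close> and \<open>f = (-\<Delta>)\<^sup>n\<^sup>/\<^sup>2 u \<in> L\<^sup>1\<close>. The curvature hypothesis says that near infinity
  \<open>-\<Delta> u \<ge> M |\<nabla> u|\<^sup>2 + c |x|\<^sup>-\<^sup>p e\<^sup>2\<^sup>u\<close>. Rescale to a unit ball around a point \<open>x\<close> with \<open>|x|\<close> comparable to a large \<open>R\<close>,
  putting \<open>v z = u (x + R z / 4)\<close>. Testing the inequality against a cutoff bounds the integral of \<open>-\<Delta> v\<close>
  by a constant independent of \<open>R\<close>, and the integral of \<open>e\<^sup>2\<^sup>v\<close> by a constant times \<open>R powr (p - 2)\<close>. Moreover
  \<open>e\<^sup>M\<^sup>u\<close> is superharmonic near infinity, so its means over such balls are bounded.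

  Since \<open>(-\<Delta>)\<^sup>M\<close> of the logarithm is, up to constants, the Newton kernel, and \<open>-\<Delta> v \<ge> 0\<close>, the value \<open>v 0\<close> exceeds
  an average of \<open>v\<close> by at most a constant plus the local logarithmic potential of the rescaled \<open>|f|\<close>, whose mass tends
  to \<open>0\<close> as \<open>R\<close> grows. By Jensen's inequality the exponential of a large multiple of that potential is then
  integrable, uniformly in the scale. So \<open>e\<^sup>n\<^sup>u\<close> integrates over the annulus \<open>R \<le> |x| < 2 R\<close> to at most a constant times
  \<open>R\<^sup>n\<close>, and also times \<open>R powr (n p / 2)\<close>; summing over dyadic annuli gives the entropy bound.
  No representation of \<open>u\<close> on the whole space is needed.
\<close>

section \<open>Integration by parts on Euclidean space\<close>

text \<open>Each unit ball is tested with radial profiles that vanish to high order on the sphere,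
  so no boundary terms arise and the intermediate functions (-\<Delta>)^k v need no bound: only
  -\<Delta> v and (-\<Delta>)^(M+1) v enter. Such profiles are made by subtracting from the
  logarithm or the Newton kernel its Taylor polynomial at s = 1 and truncating, which keeps all
  formulas explicit. A parameter e removes the singularity at the origin; the constants are uniform
  in e. Both exponents come from one annulus estimate. It takes a bound D R^(a (\<sigma> - 1)) for
  the means of e^(a u) and returns the growth R^(n \<sigma>). The pair a = M, \<sigma> = 1 is
  supplied by superharmonicity, the pair a = 2, \<sigma> = p/2 by the energy estimate. Subtracting a
  constant l with e^(a l) equal to the mean bound normalises v. The operator (-\<Delta>)^(n/2)
  scales like the Jacobian, so the local mass of f is scale invariant. The smallness required is b
  times mass at most 1, where b is n times the constant of the pointwise bound; Jensen's inequality
  then only needs 1/|z| to be locally integrable.\<close>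

lemma integrable_continuous_compact_support:
  fixes f :: "'a::euclidean_space \<Rightarrow> real"
  assumes "continuous_on UNIV f" "\<And>z. norm z \<ge> r \<Longrightarrow> f z = 0"
  shows "integrable lborel f"
proof -
  have "integrable lborel (\<lambda>x. indicator (cball 0 r) x *\<^sub>R f x)"
    by (rule borel_integrable_compact) (use assms(1) continuous_on_subset in auto)
  moreover have "(\<lambda>x. indicator (cball 0 r) x *\<^sub>R f x) = f"
    by (rule ext) (use assms(2) in \<open>auto simp: indicator_def not_le\<close>)
  ultimately show ?thesis by simp
qed

lemma set_integrable_continuous_ball:
  fixes f :: "'a::euclidean_space \<Rightarrow> real"
  assumes "continuous_on (cball a r) f"
  shows "set_integrable lborel (ball a r) f"
proof (rule set_integrable_subset)
  show "set_integrable lborel (cball a r) f"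
    unfolding set_integrable_def by (rule borel_integrable_compact) (use assms in auto)
qed auto

lemma bounded_continuous_compact_support:
  fixes f :: "'a::euclidean_space \<Rightarrow> real"
  assumes "continuous_on UNIV f" "\<And>z. norm z \<ge> r \<Longrightarrow> f z = 0"
  obtains B where "B \<ge> 0" "\<And>z. \<bar>f z\<bar> \<le> B"
proof -
  have "compact (f ` cball 0 r)"
    using assms(1) by (intro compact_continuous_image) (auto intro: continuous_on_subset)
  then obtain B where B: "\<And>z. z \<in> cball 0 r \<Longrightarrow> \<bar>f z\<bar> \<le> B"
    using compact_imp_bounded bounded_real by (metis image_eqI)
  have "\<bar>f z\<bar> \<le> \<bar>B\<bar>" for z
    using B[of z] assms(2)[of z] by (cases "norm z \<ge> r") auto
  then show ?thesis using that[of "\<bar>B\<bar>"] by auto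
qed

lemma integral_translation:
  fixes f :: "'a::euclidean_space \<Rightarrow> real"
  assumes [measurable]: "f \<in> borel_measurable borel"
  shows "(LINT x|lborel. f (c + x)) = (LINT x|lborel. f x)"
proof -
  have "(LINT x|lborel. f x) = (LINT x|distr lborel borel ((+) c). f x)"
    by (simp add: lborel_distr_plus)
  also have "\<dots> = (LINT x|lborel. f (c + x))"
    by (rule integral_distr) auto
  finally show ?thesis by simp
qed

text \<open>Translation invariance makes the integral of every difference quotient in direction
  \<open>b\<close> vanish, and dominated convergence passes this on to the derivative.\<close>

lemma integral_derivative_eq_0:
  fixes f :: "'a::euclidean_space \<Rightarrow> real"
  assumes d: "\<And>x. (f has_derivative f' x) (at x)"
    and c: "continuous_on UNIV (\<lambda>x. f' x b)"
    and s: "\<And>x. norm x \<ge> r \<Longrightarrow> f x = 0" "\<And>x. norm x \<ge> r \<Longrightarrow> f' x b = 0"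
  shows "(LINT x|lborel. f' x b) = 0"
proof -
  have cf: "continuous_on UNIV f"
    using d has_derivative_continuous_on by (metis has_derivative_at_withinI)
  then have mf[measurable]: "f \<in> borel_measurable borel" by (rule borel_measurable_continuous_onI)
  have intf: "integrable lborel f"
    by (rule integrable_continuous_compact_support[OF cf s(1)])
  obtain B where B: "B \<ge> 0" "\<And>z. \<bar>f' z b\<bar> \<le> B"
    using bounded_continuous_compact_support[OF c s(2)] by blast
  have line: "((\<lambda>t. f (x + t *\<^sub>R b)) has_real_derivative f' (x + t *\<^sub>R b) b) (at t)" for x t
  proof -
    have "((\<lambda>t. x + t *\<^sub>R b) has_derivative (\<lambda>h. h *\<^sub>R b)) (at t)"
      by (auto intro!: derivative_eq_intros)
    then have "((\<lambda>t. f (x + t *\<^sub>R b)) has_derivative (\<lambda>h. f' (x + t *\<^sub>R b) (h *\<^sub>R b))) (at t)"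
      using has_derivative_compose[OF _ d] by blast
    moreover have "f' (x + t *\<^sub>R b) (h *\<^sub>R b) = f' (x + t *\<^sub>R b) b * h" for h
      using linear_simps(5)[OF has_derivative_bounded_linear[OF d]] by simp
    ultimately show ?thesis by (simp add: has_field_derivative_def)
  qed
  define h :: "nat \<Rightarrow> real" where "h i = inverse (real (Suc i))" for i
  have h: "h i > 0" "h i \<le> 1" for i by (auto simp: h_def field_simps)
  define s' where "s' i x = (f (x + h i *\<^sub>R b) - f x) / h i" for i x
  \<comment> \<open>The mean value theorem bounds the quotient by B. Since \<open>h i\<close> is at
    most 1, enlarging the support radius by \<open>norm b\<close> covers all quotients at
    once.\<close>
  have lip: "\<bar>s' i x\<bar> \<le> B * indicator (cball 0 (r + norm b)) x" for i x
  proof (cases "norm x \<le> r + norm b")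
    case True
    obtain z where "0 < z" "z < h i"
      "f (x + h i *\<^sub>R b) - f (x + 0 *\<^sub>R b) = (h i - 0) * f' (x + z *\<^sub>R b) b"
      using MVT2[OF h(1), where f="\<lambda>t. f (x + t *\<^sub>R b)" and f'="\<lambda>t. f' (x + t *\<^sub>R b) b"] line by blast
    then have "s' i x = f' (x + z *\<^sub>R b) b" using h(1)[of i] by (simp add: s'_def field_simps)
    then show ?thesis using B True by (simp add: indicator_def)
  next
    case False
    have "norm (h i *\<^sub>R b) \<le> norm b" using h[of i] by (simp add: mult_left_le_one_le)
    moreover have "norm x \<le> norm (x + h i *\<^sub>R b) + norm (h i *\<^sub>R b)"
      by (metis add_diff_cancel norm_triangle_ineq4)
    ultimately have "norm (x + h i *\<^sub>R b) \<ge> r" using False by linarith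
    moreover have "norm x \<ge> r" using False norm_ge_zero[of b] by linarith
    ultimately show ?thesis using s(1) B by (simp add: s'_def indicator_def)
  qed
  have lim: "(\<lambda>i. s' i x) \<longlonglongrightarrow> f' x b" for x
  proof -
    have "((\<lambda>t. (f (x + (0 + t) *\<^sub>R b) - f (x + 0 *\<^sub>R b)) / t) \<longlongrightarrow> f' (x + 0 *\<^sub>R b) b) (at 0)"
      using line[of x 0] unfolding DERIV_def .
    then have l: "((\<lambda>t. (f (x + t *\<^sub>R b) - f x) / t) \<longlongrightarrow> f' x b) (at 0)" by simp
    have "filterlim h (at 0) sequentially"
      unfolding h_def using LIMSEQ_inverse_real_of_nat
      by (auto simp: filterlim_at)
    from filterlim_compose[OF l this] show ?thesis unfolding s'_def .
  qed
  have "(\<lambda>i. LINT x|lborel. s' i x) \<longlonglongrightarrow> (LINT x|lborel. f' x b)"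
  proof (rule integral_dominated_convergence)
    show "(\<lambda>x. f' x b) \<in> borel_measurable lborel"
      using borel_measurable_continuous_onI[OF c] by simp
    show "s' i \<in> borel_measurable lborel" for i unfolding s'_def by measurable
    show "integrable lborel (\<lambda>x. B * indicator (cball 0 (r + norm b)) (x::'a))"
      using borel_integrable_compact[of "cball 0 (r + norm b)" "\<lambda>_. B"] by (simp add: mult.commute)
  qed (use lim lip in auto)
  moreover have "(LINT x|lborel. s' i x) = 0" for i
  proof -
    have [measurable]: "(\<lambda>x. f (x + h i *\<^sub>R b)) \<in> borel_measurable borel" by measurable
    have t: "(LINT x|lborel. f (x + h i *\<^sub>R b)) = (LINT x|lborel. f x)"
      using integral_translation[OF mf, of "h i *\<^sub>R b"] by (simp add: add.commute)
    have i2: "integrable lborel (\<lambda>x. f (x + h i *\<^sub>R b))"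
    proof (rule integrable_continuous_compact_support)
      show "continuous_on UNIV (\<lambda>x. f (x + h i *\<^sub>R b))"
        by (rule continuous_on_compose2[OF cf]) (auto intro!: continuous_intros)
      fix z :: 'a assume z: "norm z \<ge> r + norm (h i *\<^sub>R b)"
      have "norm z \<le> norm (z + h i *\<^sub>R b) + norm (h i *\<^sub>R b)"
        by (metis add_diff_cancel norm_triangle_ineq4)
      then show "f (z + h i *\<^sub>R b) = 0" using z by (intro s(1)) linarith
    qed
    have "(LINT x|lborel. s' i x) = (LINT x|lborel. f (x + h i *\<^sub>R b) - f x) / h i"
      unfolding s'_def by (rule integral_divide_zero)
    also have "\<dots> = 0" using Bochner_Integration.integral_diff[OF i2 intf] t by simp
    finally show ?thesis .
  qed
  ultimately have "(\<lambda>i. 0) \<longlonglongrightarrow> (LINT x|lborel. f' x b)" by simp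
  then show ?thesis using LIMSEQ_unique[OF tendsto_const] by metis
qed

lemma partial_deriv_eq:
  "(f has_derivative f') (at x) \<Longrightarrow> partial_deriv b f x = f' b"
  by (simp add: partial_deriv_def frechet_derivative_at[symmetric])

lemma inner_gradient: "z \<bullet> gradient f x = (\<Sum>b\<in>Basis. (z \<bullet> b) * partial_deriv b f x)"
  by (simp add: gradient_def inner_sum_right mult.commute)

lemma C_k_continuous: "C_k k f \<Longrightarrow> continuous_on UNIV f"
  by (cases k) (auto intro!: differentiable_imp_continuous_on simp: differentiable_on_def differentiable_at_withinI)

lemma C_k_2D:
  assumes "C_k (Suc (Suc 0)) f"
  shows "f differentiable (at x)" "b \<in> Basis \<Longrightarrow> partial_deriv b f differentiable (at x)"
    "continuous_on UNIV f" "b \<in> Basis \<Longrightarrow> continuous_on UNIV (partial_deriv b f)"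
    "b \<in> Basis \<Longrightarrow> c \<in> Basis \<Longrightarrow> continuous_on UNIV (partial_deriv c (partial_deriv b f))"
    "continuous_on UNIV (laplacian f)" "continuous_on UNIV (gradient f)"
proof -
  show "f differentiable (at x)" "b \<in> Basis \<Longrightarrow> partial_deriv b f differentiable (at x)"
    "continuous_on UNIV f"
    using assms C_k_continuous[OF assms] by auto
  show 1: "continuous_on UNIV (partial_deriv b f)" if "b \<in> Basis" for b
    by (rule C_k_continuous[of "Suc 0"]) (use assms that in auto)
  show 2: "continuous_on UNIV (partial_deriv c (partial_deriv b f))" if "b \<in> Basis" "c \<in> Basis" for b c
    using assms that by auto
  show "continuous_on UNIV (laplacian f)" unfolding laplacian_def[abs_def]
    using 2 by (intro continuous_intros) auto
  show "continuous_on UNIV (gradient f)" unfolding gradient_def[abs_def]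
    using 1 by (intro continuous_intros) auto
qed

section \<open>Radial functions of s = |z|^2 and Green's identities for them\<close>

lemma has_derivative_radial:
  fixes z :: "'a::euclidean_space"
  assumes "(F has_real_derivative F' (z \<bullet> z)) (at (z \<bullet> z))"
  shows "((\<lambda>z. F (z \<bullet> z)) has_derivative (\<lambda>h. 2 * (z \<bullet> h) * F' (z \<bullet> z))) (at z)"
proof -
  have "((\<lambda>z. z \<bullet> z) has_derivative (\<lambda>h. 2 * (z \<bullet> h))) (at z)"
    by (auto intro!: derivative_eq_intros simp: inner_commute)
  moreover have "(F has_derivative (\<lambda>h. F' (z \<bullet> z) * h)) (at (z \<bullet> z))"
    using assms by (simp add: has_field_derivative_def)
  ultimately show ?thesis
    using has_derivative_compose[of "\<lambda>z. z \<bullet> z"] by (fastforce simp: mult.commute)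
qed

lemma continuous_on_radial:
  assumes "continuous_on {0..} F"
  shows "continuous_on UNIV (\<lambda>z::'a::euclidean_space. F (z \<bullet> z))"
  by (rule continuous_on_compose2[OF assms]) (auto intro!: continuous_intros)

lemma inner_self_ge_of_norm: "r \<ge> 0 \<Longrightarrow> norm z \<ge> r \<Longrightarrow> z \<bullet> z \<ge> r\<^sup>2"
  unfolding dot_square_norm by (rule power_mono) auto

lemma radial_eq_0:
  assumes "S \<ge> 0" "\<And>s. s \<ge> S \<Longrightarrow> F s = 0" "norm z \<ge> sqrt S"
  shows "F (z \<bullet> z) = (0::real)"
  using inner_self_ge_of_norm[of "sqrt S" z] assms by simp

lemma DERIV_continuous_on_atLeast:
  assumes "\<And>s. s \<ge> 0 \<Longrightarrow> (F has_real_derivative F' s) (at s)"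
  shows "continuous_on {0..} F"
  using assms by (intro continuous_at_imp_continuous_on) (auto intro: DERIV_isCont)

text \<open>Beyond S the function is locally zero; the endpoint S itself is reached by continuity of
  \<open>F'\<close> from the right.\<close>

lemma DERIV_eq_0_atLeast:
  assumes "\<And>s. s \<ge> 0 \<Longrightarrow> (F has_real_derivative F' s) (at s)"
    and "continuous_on {0..} F'" "S \<ge> 0" "\<And>s. s \<ge> S \<Longrightarrow> F s = 0" "s \<ge> S"
  shows "F' s = 0"
proof -
  have gt: "F' t = 0" if "t > S" for t
  proof -
    have "eventually (\<lambda>x. x \<in> {S<..}) (nhds t)"
      using that by (intro eventually_nhds_in_open) auto
    then have "eventually (\<lambda>x. F x = 0) (nhds t)" by eventually_elim (use assms(4) in auto)
    then have "(F has_real_derivative 0) (at t)"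
      by (subst DERIV_cong_ev[of t t F "\<lambda>_. 0"]) auto
    then show ?thesis using assms(1)[of t] that assms(3) DERIV_unique by fastforce
  qed
  show ?thesis
  proof (cases "s > S")
    case False
    then have "s = S" using assms(5) by simp
    have "(F' \<longlongrightarrow> F' S) (at S within {0..})" using assms(2,3) by (auto simp: continuous_on_def)
    then have "(F' \<longlongrightarrow> F' S) (at S within {S<..})"
      by (rule tendsto_within_subset) (use assms(3) in auto)
    moreover have "(F' \<longlongrightarrow> 0) (at S within {S<..})"
      by (rule tendsto_eventually) (use gt in \<open>auto simp: eventually_at_filter\<close>)
    moreover have "at S within {S<..} \<noteq> bot" by simp
    ultimately show ?thesis using tendsto_unique \<open>s = S\<close> by blast
  qed (use gt in auto)
qed

context
  fixes F F' :: "real \<Rightarrow> real" and S :: real and v :: "'a::euclidean_space \<Rightarrow> real"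
  assumes F: "\<And>s. s \<ge> 0 \<Longrightarrow> (F has_real_derivative F' s) (at s)"
    and cF': "continuous_on {0..} F'"
    and S: "S \<ge> 0" "\<And>s. s \<ge> S \<Longrightarrow> F s = 0"
    and v: "C_k 2 v"
begin

text \<open>Divergence theorem for the field F(|z|^2) grad v, one coordinate at a time. Only one
  derivative of \<open>F\<close> is involved, so C^1 cutoffs are admissible.\<close>

lemma green_radial_gradient:
  "(LINT z|lborel. F (z \<bullet> z) * laplacian v z) = - (LINT z|lborel. 2 * F' (z \<bullet> z) * (z \<bullet> gradient v z))"
  "integrable lborel (\<lambda>z. F (z \<bullet> z) * laplacian v z)"
  "integrable lborel (\<lambda>z. 2 * F' (z \<bullet> z) * (z \<bullet> gradient v z))"
proof -
  note v2 = C_k_2D[OF v[unfolded numeral_2_eq_2]]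
  note cF = continuous_on_radial[OF DERIV_continuous_on_atLeast[OF F]]
  note cF'r = continuous_on_radial[OF cF']
  have F0: "F (z \<bullet> z) = 0" if "norm z \<ge> sqrt S" for z :: 'a
    by (rule radial_eq_0[OF S that])
  have F'0: "F' (z \<bullet> z) = 0" if "norm z \<ge> sqrt S" for z :: 'a
    by (rule radial_eq_0[OF S(1) DERIV_eq_0_atLeast[OF F cF' S] that]) auto
  let ?d = "\<lambda>b z. F (z \<bullet> z) * partial_deriv b (partial_deriv b v) z + 2 * (z \<bullet> b) * F' (z \<bullet> z) * partial_deriv b v z"
  have i: "integrable lborel (\<lambda>z. ?d b z)" and z: "(LINT z|lborel. ?d b z) = 0" if b: "b \<in> Basis" for b :: 'a
  proof -
    have cont: "continuous_on UNIV (?d b)"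
      by (intro continuous_intros cF cF'r v2 b)
    show "integrable lborel (\<lambda>z. ?d b z)"
      by (rule integrable_continuous_compact_support[OF cont, of "sqrt S"]) (use F0 F'0 in auto)
    have d: "((\<lambda>z. F (z \<bullet> z) * partial_deriv b v z) has_derivative
       (\<lambda>h. F (z \<bullet> z) * frechet_derivative (partial_deriv b v) (at z) h + 2 * (z \<bullet> h) * F' (z \<bullet> z) * partial_deriv b v z)) (at z)" for z
      by (rule has_derivative_mult[OF has_derivative_radial[of F F'] frechet_derivative_works[THEN iffD1]])
         (use F v2(2) b in auto)
    show "(LINT z|lborel. ?d b z) = 0"
    proof -
      have "(LINT z|lborel. F (z \<bullet> z) * frechet_derivative (partial_deriv b v) (at z) b
          + 2 * (z \<bullet> b) * F' (z \<bullet> z) * partial_deriv b v z) = 0"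
        by (rule integral_derivative_eq_0[OF d, where r="sqrt S"])
           (unfold partial_deriv_def[of b "partial_deriv b v", symmetric], rule cont, use F0 F'0 in simp_all)
      then show ?thesis by (simp add: partial_deriv_def)
    qed
  qed
  show I1: "integrable lborel (\<lambda>z. F (z \<bullet> z) * laplacian v z)"
    by (rule integrable_continuous_compact_support[of _ "sqrt S"])
       (use F0 in \<open>auto intro!: continuous_intros cF v2\<close>)
  show I2: "integrable lborel (\<lambda>z. 2 * F' (z \<bullet> z) * (z \<bullet> gradient v z))"
    by (rule integrable_continuous_compact_support[of _ "sqrt S"])
       (use F'0 in \<open>auto intro!: continuous_intros cF'r v2\<close>)
  have "(LINT z|lborel. F (z \<bullet> z) * laplacian v z + 2 * F' (z \<bullet> z) * (z \<bullet> gradient v z))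
      = (LINT z|lborel. (\<Sum>b\<in>Basis. ?d b z))"
    by (intro arg_cong[where f="integral\<^sup>L lborel"] ext)
       (simp add: laplacian_def inner_gradient sum.distrib sum_distrib_left algebra_simps)
  also have "\<dots> = (\<Sum>b\<in>Basis. (LINT z|lborel. ?d b z))" by (rule Bochner_Integration.integral_sum) (use i in auto)
  also have "\<dots> = 0" using z by simp
  finally show "(LINT z|lborel. F (z \<bullet> z) * laplacian v z) = - (LINT z|lborel. 2 * F' (z \<bullet> z) * (z \<bullet> gradient v z))"
    using I1 I2 by simp
qed

text \<open>A second integration by parts, with the field 2 F'(|z|^2) v z. The factor in front of
  \<open>v\<close> is the Laplacian of F(|z|^2).\<close>

lemma green_radial:
  assumes F': "\<And>s. s \<ge> 0 \<Longrightarrow> (F' has_real_derivative F'' s) (at s)" and cF'': "continuous_on {0..} F''"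
  shows "(LINT z|lborel. F (z \<bullet> z) * laplacian v z) =
    (LINT z|lborel. (4 * (z \<bullet> z) * F'' (z \<bullet> z) + 2 * real DIM('a) * F' (z \<bullet> z)) * v z)"
  and "integrable lborel (\<lambda>z. (4 * (z \<bullet> z) * F'' (z \<bullet> z) + 2 * real DIM('a) * F' (z \<bullet> z)) * v z)"
proof -
  note v2 = C_k_2D[OF v[unfolded numeral_2_eq_2]]
  note cF'r = continuous_on_radial[OF cF']
  note cF''r = continuous_on_radial[OF cF'']
  have F'0s: "F' s = 0" if "s \<ge> S" for s by (rule DERIV_eq_0_atLeast[OF F cF' S that]) auto
  have F'0: "F' (z \<bullet> z) = 0" if "norm z \<ge> sqrt S" for z :: 'a
    by (rule radial_eq_0[OF S(1) F'0s that]) auto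
  have F''0: "F'' (z \<bullet> z) = 0" if "norm z \<ge> sqrt S" for z :: 'a
    by (rule radial_eq_0[OF S(1) DERIV_eq_0_atLeast[OF F' cF'' S(1) F'0s] that]) auto
  let ?d = "\<lambda>b z. 2 * (z \<bullet> b) * F' (z \<bullet> z) * partial_deriv b v z + (2 * F' (z \<bullet> z) + 4 * (z \<bullet> b)\<^sup>2 * F'' (z \<bullet> z)) * v z"
  have i: "integrable lborel (\<lambda>z. ?d b z)" and z: "(LINT z|lborel. ?d b z) = 0" if b: "b \<in> Basis" for b :: 'a
  proof -
    have cont: "continuous_on UNIV (?d b)"
      by (intro continuous_intros cF''r cF'r v2 b)
    show "integrable lborel (\<lambda>z. ?d b z)"
      by (rule integrable_continuous_compact_support[OF cont, of "sqrt S"]) (use F''0 F'0 in auto)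
    have d: "((\<lambda>z. (2 * (z \<bullet> b) * F' (z \<bullet> z)) * v z) has_derivative
       (\<lambda>h. (2 * (z \<bullet> b) * F' (z \<bullet> z)) * frechet_derivative v (at z) h
          + (2 * (z \<bullet> b) * (2 * (z \<bullet> h) * F'' (z \<bullet> z)) + 2 * (h \<bullet> b) * F' (z \<bullet> z)) * v z)) (at z)" for z
      by (intro has_derivative_mult has_derivative_radial[of F' F''] frechet_derivative_works[THEN iffD1])
         (use F' v2(1) b in \<open>auto intro!: derivative_eq_intros\<close>)
    have e: "(2 * (z \<bullet> b) * F' (z \<bullet> z)) * frechet_derivative v (at z) b
          + (2 * (z \<bullet> b) * (2 * (z \<bullet> b) * F'' (z \<bullet> z)) + 2 * (b \<bullet> b) * F' (z \<bullet> z)) * v z = ?d b z" for z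
      using b by (simp add: partial_deriv_def power2_eq_square algebra_simps)
    show "(LINT z|lborel. ?d b z) = 0"
      using integral_derivative_eq_0[OF d, of b "sqrt S"] cont F''0 F'0
      unfolding e by (simp add: partial_deriv_def)
  qed
  note I1 = green_radial_gradient(3)
  show I2: "integrable lborel (\<lambda>z. (4 * (z \<bullet> z) * F'' (z \<bullet> z) + 2 * real DIM('a) * F' (z \<bullet> z)) * v z)"
    by (rule integrable_continuous_compact_support[of _ "sqrt S"])
       (use F'0 F''0 in \<open>auto intro!: continuous_intros cF'r cF''r v2\<close>)
  have sq: "(\<Sum>b\<in>Basis. (z \<bullet> b)\<^sup>2) = z \<bullet> z" for z :: 'a
    by (subst euclidean_inner) (simp add: power2_eq_square)
  have "(LINT z|lborel. 2 * F' (z \<bullet> z) * (z \<bullet> gradient v z)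
       + (4 * (z \<bullet> z) * F'' (z \<bullet> z) + 2 * real DIM('a) * F' (z \<bullet> z)) * v z)
      = (LINT z|lborel. (\<Sum>b\<in>Basis. ?d b z))"
  proof (intro arg_cong[where f="integral\<^sup>L lborel"] ext)
    fix z :: 'a
    have "(\<Sum>b\<in>Basis. ?d b z) = 2 * F' (z \<bullet> z) * (\<Sum>b\<in>Basis. (z \<bullet> b) * partial_deriv b v z)
       + 2 * real DIM('a) * F' (z \<bullet> z) * v z + 4 * F'' (z \<bullet> z) * v z * (\<Sum>b\<in>Basis. (z \<bullet> b)\<^sup>2)"
      by (simp add: sum.distrib sum_distrib_left algebra_simps)
    then show "2 * F' (z \<bullet> z) * (z \<bullet> gradient v z)
       + (4 * (z \<bullet> z) * F'' (z \<bullet> z) + 2 * real DIM('a) * F' (z \<bullet> z)) * v z = (\<Sum>b\<in>Basis. ?d b z)"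
      unfolding sq inner_gradient by (simp add: algebra_simps)
  qed
  also have "\<dots> = (\<Sum>b\<in>Basis. (LINT z|lborel. ?d b z))" by (rule Bochner_Integration.integral_sum) (use i in auto)
  also have "\<dots> = 0" using z by simp
  finally show "(LINT z|lborel. F (z \<bullet> z) * laplacian v z) =
    (LINT z|lborel. (4 * (z \<bullet> z) * F'' (z \<bullet> z) + 2 * real DIM('a) * F' (z \<bullet> z)) * v z)"
    using I1 I2 green_radial_gradient(1) by simp
qed

end

section \<open>Smooth functions\<close>

lemma partial_deriv_add:
  assumes "f differentiable (at x)" "g differentiable (at x)"
  shows "partial_deriv b (\<lambda>x. f x + g x) x = partial_deriv b f x + partial_deriv b g x"
  using partial_deriv_eq[OF has_derivative_add[OF assms[THEN frechet_derivative_works[THEN iffD1]]], of b]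
  by (simp add: partial_deriv_def)

lemma C_k_add: "C_k k f \<Longrightarrow> C_k k g \<Longrightarrow> C_k k (\<lambda>x. f x + g x)"
proof (induction k arbitrary: f g)
  case (Suc k)
  have "partial_deriv b (\<lambda>x. f x + g x) = (\<lambda>x. partial_deriv b f x + partial_deriv b g x)" for b
    using Suc.prems by (intro ext partial_deriv_add) auto
  then show ?case using Suc by auto
qed (auto intro: continuous_intros)

lemma has_derivative_affine:
  fixes f :: "'a::euclidean_space \<Rightarrow> real"
  assumes "f differentiable (at (a + r *\<^sub>R z))"
  shows "((\<lambda>z. c * f (a + r *\<^sub>R z)) has_derivative
      (\<lambda>h. c * frechet_derivative f (at (a + r *\<^sub>R z)) (r *\<^sub>R h))) (at z)"
proof -
  have "((\<lambda>z. a + r *\<^sub>R z) has_derivative (\<lambda>h. r *\<^sub>R h)) (at z)"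
    by (auto intro!: derivative_eq_intros)
  from has_derivative_compose[OF this] assms[THEN frechet_derivative_works[THEN iffD1]]
  show ?thesis by (intro has_derivative_mult_right) blast
qed

lemma partial_deriv_affine:
  fixes f :: "'a::euclidean_space \<Rightarrow> real"
  assumes "f differentiable (at (a + r *\<^sub>R z))"
  shows "partial_deriv b (\<lambda>z. c * f (a + r *\<^sub>R z)) z = (c * r) * partial_deriv b f (a + r *\<^sub>R z)"
proof -
  have "bounded_linear (frechet_derivative f (at (a + r *\<^sub>R z)))"
    using assms frechet_derivative_works has_derivative_bounded_linear by blast
  then show ?thesis
    using partial_deriv_eq[OF has_derivative_affine[OF assms], of b c]
    by (simp add: partial_deriv_def linear_simps)
qed

lemma C_k_affine:
  fixes f :: "'a::euclidean_space \<Rightarrow> real"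
  shows "C_k k f \<Longrightarrow> C_k k (\<lambda>z. c * f (a + r *\<^sub>R z))"
proof (induction k arbitrary: f c)
  case 0
  then have "continuous_on UNIV f" by simp
  then show ?case
    by (auto intro!: continuous_intros continuous_on_compose2[of UNIV f])
next
  case (Suc k)
  have "partial_deriv b (\<lambda>z. c * f (a + r *\<^sub>R z)) = (\<lambda>z. (c * r) * partial_deriv b f (a + r *\<^sub>R z))" for b
    using Suc.prems by (intro ext partial_deriv_affine) auto
  moreover have "(\<lambda>z. c * f (a + r *\<^sub>R z)) differentiable (at z)" for z
    using has_derivative_affine[of f a r z c] Suc.prems by (auto simp: differentiable_def)
  ultimately show ?case using Suc by auto
qed

lemma C_k_scale: "C_k k f \<Longrightarrow> C_k k (\<lambda>z. c * f z)"
  using C_k_affine[of k f c 0 1] by simp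

lemma partial_deriv_const: "partial_deriv b (\<lambda>_. c) = (\<lambda>_. 0)"
  by (simp add: partial_deriv_def fun_eq_iff)

lemma C_k_const: "C_k k (\<lambda>_. c)"
  by (induction k arbitrary: c) (auto simp: partial_deriv_const)

lemma C_k_sum: "finite A \<Longrightarrow> (\<And>b. b \<in> A \<Longrightarrow> C_k k (f b)) \<Longrightarrow> C_k k (\<lambda>x. \<Sum>b\<in>A. f b x)"
  by (induction A rule: finite_induct) (auto intro: C_k_add C_k_const)

definition neg_laplacian :: "('a::euclidean_space \<Rightarrow> real) \<Rightarrow> 'a \<Rightarrow> real" where
  "neg_laplacian f x = - laplacian f x"

lemma C_k_neg_laplacian:
  assumes "C_k (Suc (Suc k)) f"
  shows "C_k k (neg_laplacian f)"
proof -
  have "C_k k (\<lambda>x. (-1) * laplacian f x)" unfolding laplacian_def[abs_def]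
    using assms by (intro C_k_scale C_k_sum) auto
  then show ?thesis by (simp add: neg_laplacian_def[abs_def])
qed

lemma smooth_neg_laplacian: "smooth f \<Longrightarrow> smooth (neg_laplacian f)"
  unfolding smooth_def using C_k_neg_laplacian by blast

lemma smooth_neg_laplacian_pow: "smooth f \<Longrightarrow> smooth ((neg_laplacian ^^ k) f)"
  by (induction k) (auto intro: smooth_neg_laplacian)

lemma smooth_affine: "smooth f \<Longrightarrow> smooth (\<lambda>z. c * f (a + r *\<^sub>R z))"
  unfolding smooth_def using C_k_affine by blast

lemma smooth_continuous: "smooth f \<Longrightarrow> continuous_on UNIV f"
  unfolding smooth_def using C_k_continuous by blast

section \<open>Laplacian and gradient under rescaling, sums and exponentials\<close>

lemma laplacian_affine:
  assumes "C_k 2 f"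
  shows "laplacian (\<lambda>z. c * f (a + r *\<^sub>R z)) z = (c * r\<^sup>2) * laplacian f (a + r *\<^sub>R z)"
proof -
  note f = C_k_2D[OF assms[unfolded numeral_2_eq_2]]
  have "partial_deriv b (\<lambda>z. c * f (a + r *\<^sub>R z)) = (\<lambda>z. (c * r) * partial_deriv b f (a + r *\<^sub>R z))" for b
    using f by (intro ext partial_deriv_affine) auto
  moreover have "partial_deriv b (\<lambda>z. (c * r) * partial_deriv b f (a + r *\<^sub>R z)) z
      = (c * r * r) * partial_deriv b (partial_deriv b f) (a + r *\<^sub>R z)" if "b \<in> Basis" for b
    using f(2)[OF that] by (rule partial_deriv_affine)
  ultimately show ?thesis unfolding laplacian_def
    by (simp add: sum_distrib_left power2_eq_square mult.assoc)
qed

lemma gradient_affine: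
  assumes "C_k 2 f"
  shows "gradient (\<lambda>z. c * f (a + r *\<^sub>R z)) z = (c * r) *\<^sub>R gradient f (a + r *\<^sub>R z)"
proof -
  note f = C_k_2D[OF assms[unfolded numeral_2_eq_2]]
  show ?thesis unfolding gradient_def using f
    by (simp add: partial_deriv_affine scaleR_sum_right)
qed

lemma neg_laplacian_pow_affine:
  assumes "smooth f"
  shows "(neg_laplacian ^^ k) (\<lambda>z. c * f (a + r *\<^sub>R z)) = (\<lambda>z. (c * r ^ (2 * k)) * (neg_laplacian ^^ k) f (a + r *\<^sub>R z))"
proof (induction k)
  case (Suc k)
  have "C_k 2 ((neg_laplacian ^^ k) f)" using smooth_neg_laplacian_pow[OF assms] smooth_def by blast
  from laplacian_affine[OF this, of "c * r ^ (2 * k)" a r] show ?case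
    unfolding funpow.simps comp_def Suc
    by (simp add: neg_laplacian_def fun_eq_iff power2_eq_square mult_ac)
qed auto

lemma laplacian_add:
  assumes "C_k 2 f" "C_k 2 g"
  shows "laplacian (\<lambda>x. f x + g x) x = laplacian f x + laplacian g x"
proof -
  note f = C_k_2D[OF assms(1)[unfolded numeral_2_eq_2]]
  note g = C_k_2D[OF assms(2)[unfolded numeral_2_eq_2]]
  have "partial_deriv b (\<lambda>x. f x + g x) = (\<lambda>x. partial_deriv b f x + partial_deriv b g x)" for b
    using f g by (intro ext partial_deriv_add) auto
  then show ?thesis unfolding laplacian_def using f g
    by (simp add: partial_deriv_add sum.distrib)
qed

lemma laplacian_const: "laplacian (\<lambda>_. c) x = 0"
  by (simp add: laplacian_def partial_deriv_const)

lemma norm_gradient_sq: "(norm (gradient f x))\<^sup>2 = (\<Sum>b\<in>Basis. (partial_deriv b f x)\<^sup>2)"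
proof -
  have "gradient f x \<bullet> b = partial_deriv b f x" if "b \<in> Basis" for b
    using that by (simp add: gradient_def)
  then show ?thesis unfolding power2_norm_eq_inner
    by (subst euclidean_inner) (simp add: power2_eq_square)
qed

text \<open>For c = (n - 2)/2 the bracket is, up to a negative factor, the scalar curvature of the
  conformal metric, so nonnegative curvature means that this exponential is superharmonic.\<close>

lemma exp_scaled_C_k_2:
  fixes u :: "'a::euclidean_space \<Rightarrow> real"
  assumes "C_k 2 u"
  shows "C_k 2 (\<lambda>x. exp (c * u x))"
    and "laplacian (\<lambda>x. exp (c * u x)) x = c * exp (c * u x) * (laplacian u x + c * (norm (gradient u x))\<^sup>2)"
proof -
  note u = C_k_2D[OF assms[unfolded numeral_2_eq_2]]
  have d1: "((\<lambda>x. exp (c * u x)) has_derivative (\<lambda>h. c * exp (c * u x) * frechet_derivative u (at x) h)) (at x)" for x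
    by (rule has_derivative_eq_rhs, rule has_derivative_exp, rule has_derivative_mult_right,
        rule u(1)[THEN frechet_derivative_works[THEN iffD1]]) (simp add: mult_ac)
  have p1: "partial_deriv b (\<lambda>x. exp (c * u x)) = (\<lambda>x. c * exp (c * u x) * partial_deriv b u x)" for b
    by (rule ext) (simp add: partial_deriv_eq[OF d1] partial_deriv_def)
  have d2: "((\<lambda>x. c * exp (c * u x) * partial_deriv b u x) has_derivative
      (\<lambda>h. c * exp (c * u x) * frechet_derivative (partial_deriv b u) (at x) h
        + c * (c * exp (c * u x) * frechet_derivative u (at x) h) * partial_deriv b u x)) (at x)"
    if "b \<in> Basis" for b x
    by (rule has_derivative_mult[OF has_derivative_mult_right[OF d1] u(2)[OF that, THEN frechet_derivative_works[THEN iffD1]]])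
  have p2: "partial_deriv b' (\<lambda>x. c * exp (c * u x) * partial_deriv b u x) =
      (\<lambda>x. c * exp (c * u x) * partial_deriv b' (partial_deriv b u) x
        + c * (c * exp (c * u x) * partial_deriv b' u x) * partial_deriv b u x)" if "b \<in> Basis" for b b'
    by (rule ext) (simp add: partial_deriv_eq[OF d2[OF that]] partial_deriv_def[of b'])
  have "(\<lambda>x. c * exp (c * u x) * partial_deriv b u x) differentiable (at x)" if "b \<in> Basis" for b x
    using d2[OF that] by (auto simp: differentiable_def)
  moreover have "continuous_on UNIV (\<lambda>x. c * exp (c * u x) * partial_deriv b' (partial_deriv b u) x
        + c * (c * exp (c * u x) * partial_deriv b' u x) * partial_deriv b u x)"
    if "b \<in> Basis" "b' \<in> Basis" for b b' :: 'a
    by (intro continuous_intros u that)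
  moreover have "(\<lambda>x. exp (c * u x)) differentiable (at x)" for x
    using d1[of x] unfolding differentiable_def by blast
  ultimately show "C_k 2 (\<lambda>x. exp (c * u x))"
    by (auto simp: numeral_2_eq_2 p1 p2)
  show "laplacian (\<lambda>x. exp (c * u x)) x = c * exp (c * u x) * (laplacian u x + c * (norm (gradient u x))\<^sup>2)"
  proof -
    have "laplacian (\<lambda>x. exp (c * u x)) x = (\<Sum>b\<in>Basis. c * exp (c * u x) * partial_deriv b (partial_deriv b u) x
        + c * (c * exp (c * u x) * partial_deriv b u x) * partial_deriv b u x)"
      unfolding laplacian_def p1 by (intro sum.cong refl) (simp only: p2)
    then show ?thesis
      by (simp only: laplacian_def norm_gradient_sq)
         (simp add: sum.distrib sum_distrib_left algebra_simps power2_eq_square)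
  qed
qed

section \<open>Truncated radial test functions\<close>

text \<open>A jet is a radial profile \<open>d 0\<close>, as a function of \<open>s = |z|\<^sup>2\<close>, together with all its derivatives.\<close>

definition is_jet :: "(nat \<Rightarrow> real \<Rightarrow> real) \<Rightarrow> bool" where
  "is_jet d \<longleftrightarrow> (\<forall>k. \<forall>s\<ge>0. (d k has_real_derivative d (Suc k) s) (at s))"

text \<open>The jet of the profile of \<open>-\<Delta>\<close> applied to \<open>d 0 (|z|\<^sup>2)\<close> in dimension \<open>2 * (M + 1)\<close>.\<close>

definition lap_jet :: "nat \<Rightarrow> (nat \<Rightarrow> real \<Rightarrow> real) \<Rightarrow> nat \<Rightarrow> real \<Rightarrow> real" where
  "lap_jet M d k s = - (4 * s * d (Suc (Suc k)) s + (4 * real k + 4 * real (Suc M)) * d (Suc k) s)"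

text \<open>The cut is at the unit sphere. Smoothness comes from the vanishing of the profile and
  its derivatives at s = 1, not from a cutoff function.\<close>

definition trunc :: "(real \<Rightarrow> real) \<Rightarrow> real \<Rightarrow> real" where
  "trunc f s = (if s < 1 then f s else 0)"

lemma is_jet_diff: "is_jet d \<Longrightarrow> is_jet e \<Longrightarrow> is_jet (\<lambda>k s. d k s - e k s)"
  unfolding is_jet_def by (auto intro!: DERIV_diff)

lemma is_jet_lap_jet:
  assumes "is_jet d" shows "is_jet (lap_jet M d)"
  unfolding is_jet_def
proof (intro allI impI)
  fix k and s :: real assume s: "s \<ge> 0"
  note d = assms[unfolded is_jet_def, rule_format, OF s]
  have "((\<lambda>s. - (4 * s * d (Suc (Suc k)) s + (4 * real k + 4 * real (Suc M)) * d (Suc k) s)) has_real_derivative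
     - ((4 * s * d (Suc (Suc (Suc k))) s + 4 * d (Suc (Suc k)) s) + (4 * real k + 4 * real (Suc M)) * d (Suc (Suc k)) s)) (at s)"
    by (rule derivative_eq_intros d refl)+ simp
  then show "(lap_jet M d k has_real_derivative lap_jet M d (Suc k) s) (at s)"
    unfolding lap_jet_def[abs_def] by (simp add: algebra_simps)
qed

lemma is_jet_continuous: "is_jet d \<Longrightarrow> continuous_on {0..} (d k)"
  unfolding is_jet_def by (intro DERIV_continuous_on_atLeast) blast

lemma is_jet_continuous_radial: "is_jet d \<Longrightarrow> continuous_on A (\<lambda>z::'a::euclidean_space. d k (z \<bullet> z))"
  using continuous_on_radial[OF is_jet_continuous] continuous_on_subset by blast

text \<open>At s = 1 the difference quotient is either 0 or that of \<open>f\<close>, and the latter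
  tends to 0.\<close>

lemma DERIV_trunc:
  assumes f: "(f has_real_derivative f' s) (at s)" and "f 1 = 0" "f' 1 = 0"
  shows "(trunc f has_real_derivative trunc f' s) (at s)"
proof -
  consider "s < 1" | "s > 1" | "s = 1" by linarith
  then show ?thesis
  proof cases
    case 1
    then have "eventually (\<lambda>x. x \<in> {..<1}) (nhds s)"
      by (intro eventually_nhds_in_open) auto
    then have "eventually (\<lambda>x. trunc f x = f x) (nhds s)" by eventually_elim (auto simp: trunc_def)
    then show ?thesis using f 1 DERIV_cong_ev[of s s "trunc f" f "f' s"] by (simp add: trunc_def)
  next
    case 2
    then have "eventually (\<lambda>x. x \<in> {1<..}) (nhds s)"
      by (intro eventually_nhds_in_open) auto
    then have "eventually (\<lambda>x. trunc f x = 0) (nhds s)" by eventually_elim (auto simp: trunc_def)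
    then show ?thesis using 2 DERIV_cong_ev[of s s "trunc f" "\<lambda>_. 0" 0] by (simp add: trunc_def)
  next
    case 3
    have "((\<lambda>h. (f (1 + h) - f 1) / h) \<longlongrightarrow> 0) (at 0)"
      using f 3 assms(3) by (simp add: DERIV_def)
    then have "((\<lambda>h. (trunc f (1 + h) - trunc f 1) / h) \<longlongrightarrow> 0) (at 0)"
      by (rule Lim_transform_bound[rotated]) (use assms(2) in \<open>auto simp: trunc_def intro!: always_eventually\<close>)
    then show ?thesis using 3 by (simp add: DERIV_def trunc_def)
  qed
qed

lemma continuous_trunc:
  assumes "is_jet d" "d k 1 = 0"
  shows "continuous_on {0..} (trunc (d k))"
proof -
  have "continuous_on {0..} (\<lambda>s. d k (min s 1))"
    by (rule continuous_on_compose2[OF is_jet_continuous[OF assms(1)]]) (auto intro!: continuous_intros)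
  moreover have "(\<lambda>s. d k (min s 1)) = trunc (d k)"
    using assms(2) by (auto simp: trunc_def fun_eq_iff min_def)
  ultimately show ?thesis by metis
qed

text \<open>Vanishing of the profile and two derivatives at s = 1 makes the truncation C^2, as two
  integrations by parts require.\<close>

lemma green_trunc:
  fixes v :: "'a::euclidean_space \<Rightarrow> real"
  assumes dim: "DIM('a) = 2 * Suc M" and d: "is_jet d" "d 0 1 = 0" "d 1 1 = 0" "d 2 1 = 0" and v: "C_k 2 v"
  shows "(LINT z|lborel. trunc (d 0) (z \<bullet> z) * neg_laplacian v z) = (LINT z|lborel. trunc (lap_jet M d 0) (z \<bullet> z) * v z)"
proof -
  note dd = d(1)[unfolded is_jet_def, rule_format]
  have "(LINT z|lborel. trunc (d 0) (z \<bullet> z) * laplacian v z) = (LINT z|lborel. (4 * (z \<bullet> z) * trunc (d 2) (z \<bullet> z) + 2 * real DIM('a) * trunc (d 1) (z \<bullet> z)) * v z)"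
  proof (rule green_radial(1))
    show "(trunc (d 0) has_real_derivative trunc (d 1) s) (at s)" if "s \<ge> 0" for s
      by (rule DERIV_trunc) (use dd[OF that, of 0] d in auto)
    show "(trunc (d 1) has_real_derivative trunc (d 2) s) (at s)" if "s \<ge> 0" for s
      by (rule DERIV_trunc) (use dd[OF that, of 1] d in \<open>auto simp: numeral_2_eq_2\<close>)
    show "continuous_on {0..} (trunc (d 1))" "continuous_on {0..} (trunc (d 2))"
      using d by (auto intro: continuous_trunc)
    show "trunc (d 0) s = 0" if "s \<ge> 1" for s using that by (simp add: trunc_def)
  qed (use v in auto)
  also have "\<dots> = (LINT z|lborel. - (trunc (lap_jet M d 0) (z \<bullet> z) * v z))"
    by (intro arg_cong[where f="integral\<^sup>L lborel"] ext)
       (auto simp: trunc_def lap_jet_def dim numeral_2_eq_2 algebra_simps)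
  finally show ?thesis by (simp add: neg_laplacian_def)
qed

text \<open>A Laplacian uses two further derivatives, so each application costs two orders of
  vanishing at the sphere.\<close>

lemma lap_jet_vanish:
  assumes "\<And>i. i \<le> 2 * Suc k \<Longrightarrow> d i 1 = 0" "i \<le> 2 * k"
  shows "lap_jet M d i 1 = 0"
  using assms by (simp add: lap_jet_def)

text \<open>Laplacians are moved off \<open>v\<close> one at a time; vanishing up to order 2k is
  what k rounds consume.\<close>

lemma green_trunc_pow:
  fixes v :: "'a::euclidean_space \<Rightarrow> real"
  assumes dim: "DIM('a) = 2 * Suc M" and v: "smooth v"
  shows "is_jet d \<Longrightarrow> (\<And>i. i \<le> 2 * k \<Longrightarrow> d i 1 = 0) \<Longrightarrow>
    (LINT z|lborel. trunc (d 0) (z \<bullet> z) * (neg_laplacian ^^ k) v z) = (LINT z|lborel. trunc ((lap_jet M ^^ k) d 0) (z \<bullet> z) * v z)"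
proof (induction k arbitrary: d)
  case (Suc k)
  have "(LINT z|lborel. trunc (d 0) (z \<bullet> z) * neg_laplacian ((neg_laplacian ^^ k) v) z)
     = (LINT z|lborel. trunc (lap_jet M d 0) (z \<bullet> z) * (neg_laplacian ^^ k) v z)"
    by (rule green_trunc[OF dim Suc.prems(1)])
       (use Suc.prems(2) smooth_neg_laplacian_pow[OF v] in \<open>auto simp: smooth_def\<close>)
  also have "\<dots> = (LINT z|lborel. trunc ((lap_jet M ^^ k) (lap_jet M d) 0) (z \<bullet> z) * v z)"
    by (rule Suc.IH[OF is_jet_lap_jet[OF Suc.prems(1)]]) (rule lap_jet_vanish[where d=d and k=k], use Suc.prems(2) in auto)
  finally show ?case by (simp add: funpow_swap1)
qed auto

section \<open>The regularised logarithm\<close>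

text \<open>The jet of (e + s)^(-k); the rising factorial arises from repeated
  differentiation.\<close>

definition power_jet :: "real \<Rightarrow> nat \<Rightarrow> nat \<Rightarrow> real \<Rightarrow> real" where
  "power_jet e k l s = (- 1) ^ l * pochhammer (real k) l * inverse (e + s) ^ (k + l)"

definition log_jet :: "real \<Rightarrow> nat \<Rightarrow> real \<Rightarrow> real" where
  "log_jet e l s = (case l of 0 \<Rightarrow> - ln (e + s) | Suc l' \<Rightarrow> - power_jet e 1 l' s)"

lemma is_jet_power_jet:
  assumes "e > 0" shows "is_jet (power_jet e k)"
  unfolding is_jet_def
proof (intro allI impI)
  fix l and s :: real assume "s \<ge> 0"
  then have "e + s \<noteq> 0" using assms by auto
  then have "((\<lambda>s. inverse (e + s) ^ (k + l)) has_real_derivative - (real (k + l) * inverse (e + s) ^ Suc (k + l))) (at s)"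
  proof (cases "k + l")
    case (Suc j)
    have "((\<lambda>s. inverse (e + s)) has_real_derivative - (inverse (e + s) * inverse (e + s))) (at s)"
      using \<open>e + s \<noteq> 0\<close> by (auto intro!: derivative_eq_intros)
    from DERIV_power[OF this, of "Suc j"] show ?thesis unfolding Suc by (simp add: mult_ac)
  qed auto
  then have "((\<lambda>s. ((- 1) ^ l * pochhammer (real k) l) * inverse (e + s) ^ (k + l)) has_real_derivative
     ((- 1) ^ l * pochhammer (real k) l) * - (real (k + l) * inverse (e + s) ^ Suc (k + l))) (at s)"
    by (rule DERIV_cmult)
  then show "(power_jet e k l has_real_derivative power_jet e k (Suc l) s) (at s)"
    unfolding power_jet_def[abs_def] by (simp add: pochhammer_Suc mult_ac)
qed

lemma is_jet_log_jet:
  assumes "e > 0" shows "is_jet (log_jet e)"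
  unfolding is_jet_def
proof (intro allI impI)
  fix l and s :: real assume s: "s \<ge> 0"
  show "(log_jet e l has_real_derivative log_jet e (Suc l) s) (at s)"
  proof (cases l)
    case 0
    have "((\<lambda>s. - ln (e + s)) has_real_derivative - inverse (e + s)) (at s)"
      using s assms by (auto intro!: derivative_eq_intros simp: field_simps)
    then show ?thesis using 0 by (simp add: log_jet_def[abs_def] power_jet_def)
  next
    case (Suc l')
    then show ?thesis using is_jet_power_jet[OF assms, of 1] s
      unfolding is_jet_def by (auto simp: log_jet_def[abs_def] intro!: DERIV_minus)
  qed
qed

text \<open>The identity s/(e + s) = 1 - e/(e + s) removes the explicit s. For k = M the first term
  drops out: (e + s)^(-M) regularises the Newton kernel |z|^(2 - n).\<close>

lemma lap_jet_power_jet: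
  assumes "e > 0" "s \<ge> 0"
  shows "lap_jet M (power_jet e k) l s =
    4 * real k * (real M - real k) * power_jet e (Suc k) l s + 4 * e * real k * (real k + 1) * power_jet e (k + 2) l s"
proof -
  define x where "x = inverse (e + s)"
  have s: "s * x = 1 - e * x" using assms by (simp add: x_def field_simps)
  have p1: "pochhammer (real k) (Suc l) = real k * pochhammer (real (Suc k)) l"
    by (simp add: pochhammer_rec add.commute)
  have p2: "pochhammer (real k) (Suc (Suc l)) = real k * (real k + 1) * pochhammer (real (k + 2)) l"
    by (simp add: pochhammer_rec add.commute add.left_commute)
  have p3: "pochhammer (real k) (Suc (Suc l)) = (real k + real l + 1) * (real k * pochhammer (real (Suc k)) l)"
    unfolding p1[symmetric] by (simp add: pochhammer_Suc[of _ "Suc l"] algebra_simps)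
  have "lap_jet M (power_jet e k) l s = (- 1) ^ l *
     (- 4 * pochhammer (real k) (Suc (Suc l)) * x ^ (k + l + 1) * (s * x)
      + (4 * real l + 4 * real (Suc M)) * pochhammer (real k) (Suc l) * x ^ (k + l + 1))"
    unfolding lap_jet_def power_jet_def x_def[symmetric] by (simp add: algebra_simps)
  also have "\<dots> = (- 1) ^ l * (4 * e * pochhammer (real k) (Suc (Suc l)) * x ^ (k + l + 2)
     - 4 * ((real k + real l + 1) * (real k * pochhammer (real (Suc k)) l)) * x ^ (k + l + 1)
     + (4 * real l + 4 * real (Suc M)) * (real k * pochhammer (real (Suc k)) l) * x ^ (k + l + 1))"
    unfolding s p1 p3[symmetric] by (simp add: algebra_simps)
  also have "\<dots> = 4 * real k * (real M - real k) * power_jet e (Suc k) l s + 4 * e * real k * (real k + 1) * power_jet e (k + 2) l s"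
    unfolding p2 power_jet_def x_def[symmetric] by (simp add: algebra_simps)
  finally show ?thesis .
qed

lemma lap_jet_log_jet:
  assumes "e > 0" "s \<ge> 0"
  shows "lap_jet M (log_jet e) l s = 4 * real M * power_jet e 1 l s + 4 * e * power_jet e 2 l s"
proof -
  define x where "x = inverse (e + s)"
  have s: "s * x = 1 - e * x" using assms by (simp add: x_def field_simps)
  have p1: "pochhammer 1 (Suc l) = (pochhammer 2 l :: real)" by (simp add: pochhammer_rec)
  have p3: "pochhammer 1 (Suc l) = (1 + real l) * pochhammer 1 l" by (simp add: pochhammer_Suc algebra_simps)
  have "lap_jet M (log_jet e) l s = (- 1) ^ l *
     (- 4 * pochhammer 1 (Suc l) * x ^ (l + 1) * (s * x) + (4 * real l + 4 * real (Suc M)) * pochhammer 1 l * x ^ (l + 1))"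
    unfolding lap_jet_def log_jet_def power_jet_def x_def[symmetric] by (simp add: algebra_simps)
  also have "\<dots> = (- 1) ^ l * (4 * e * pochhammer 1 (Suc l) * x ^ (l + 2)
      - 4 * ((1 + real l) * pochhammer 1 l) * x ^ (l + 1) + (4 * real l + 4 * real (Suc M)) * pochhammer 1 l * x ^ (l + 1))"
    unfolding s p3[symmetric] by (simp add: algebra_simps)
  also have "\<dots> = 4 * real M * power_jet e 1 l s + 4 * e * power_jet e 2 l s"
    unfolding p1 power_jet_def x_def[symmetric] by (simp add: algebra_simps)
  finally show ?thesis .
qed

text \<open>Coefficients of (-\<Delta>)^j applied to -ln(e + |z|^2), for 1 \<le> j \<le> M, in terms
  of e^i (e + s)^(-(j + i)). The closed form solves the recursion imposed by
  \<open>lap_jet_power_jet\<close> and makes the sign visible.\<close>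

definition log_coeff :: "nat \<Rightarrow> nat \<Rightarrow> nat \<Rightarrow> real" where
  "log_coeff M j i = 4 ^ j * real (j choose i) * fact (j + i - 1) * fact (M - i) / fact (M - j)"

lemma log_coeff_nonneg: "log_coeff M j i \<ge> 0"
  by (simp add: log_coeff_def)

lemma log_coeff_Suc_0:
  assumes "1 \<le> j" "j < M"
  shows "log_coeff M (Suc j) 0 = 4 * real j * (real M - real j) * log_coeff M j 0"
proof -
  obtain q where q: "M = Suc (j + q)" using assms less_iff_Suc_add by auto
  obtain j' where j: "j = Suc j'" using assms by (cases j) auto
  have f: "M - j = Suc q" "M - Suc j = q" "Suc j + 0 - 1 = Suc j'" "j + 0 - 1 = j'" "real M - real j = real q + 1"
    using q j by auto
  have "log_coeff M (Suc j) 0 = 4 ^ Suc j * fact (Suc j') * fact M / fact q"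
    unfolding log_coeff_def f by simp
  also have "\<dots> = 4 * real j * (real q + 1) * (4 ^ j * fact j' * fact M / fact (Suc q))"
  proof -
    have "real q + 1 \<noteq> 0" by linarith
    moreover have "fact (Suc q) = (real q + 1) * fact q" "fact (Suc j') = real j * fact j'" using j by (auto simp: algebra_simps)
    ultimately show ?thesis by (simp only:) (simp add: divide_simps)
  qed
  finally show ?thesis unfolding log_coeff_def f by simp
qed

lemma log_coeff_Suc_Suc:
  assumes "1 \<le> j" "j < M" "i \<le> j"
  shows "log_coeff M (Suc j) (Suc i) =
    4 * real (j + Suc i) * (real M - real (j + Suc i)) * log_coeff M j (Suc i)
    + 4 * real (j + i) * (real (j + i) + 1) * log_coeff M j i"
proof -
  obtain q where q: "M = Suc (i + q)" using assms less_iff_Suc_add[of i M] by auto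
  obtain r where r: "M = Suc (j + r)" using assms less_iff_Suc_add[of j M] by auto
  obtain t where t: "j + i = Suc t" using assms by (cases "j + i") auto
  have jt: "j = Suc t - i" "i \<le> Suc t" using t by auto
  \<comment> \<open>The only combinatorial input: (i + 1) C(j, i + 1) = (j - i) C(j, i). Everything
    else is cancellation of factorials.\<close>
  have c0: "(Suc i) * (j choose Suc i) = (j - i) * (j choose i)"
    by (simp only: binomial_absorption binomial_absorb_comp)
  have c: "(real i + 1) * real (j choose Suc i) = (real j - real i) * real (j choose i)"
    using arg_cong[OF c0, of real] assms(3) by (simp add: of_nat_diff algebra_simps)
  have f: "M - i = Suc q" "M - Suc i = q" "M - j = Suc r" "M - Suc j = r" using q r by auto
  have g: "Suc j + Suc i - 1 = Suc (Suc t)" "j + Suc i - 1 = Suc t" "j + i - 1 = t" "j + Suc i = Suc (Suc t)" using t by auto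
  define A where "A = real (j choose i)"
  define B where "B = real (j choose Suc i)"
  \<comment> \<open>What remains of the recursion once the common factorials and powers of 4 are
    divided out.\<close>
  have key: "(real r + 1) * (A + B) = (real M - (real t + 2)) * B + (real q + 1) * A"
  proof -
    have e1: "real r + 1 = real M - real j" "real q + 1 = real M - real i" "real t + 1 = real j + real i"
      using q r t by (auto simp flip: of_nat_Suc of_nat_add)
    have "(real i + 1) * B = (real j - real i) * A" using c by (simp add: A_def B_def)
    moreover have e2: "real t = real i + real j - 1" using e1(3) by simp
    ultimately show ?thesis unfolding e1 e2 by (simp add: algebra_simps)
  qed
  have bin: "real (Suc j choose Suc i) = A + B" by (simp add: A_def B_def)
  have ft: "fact (Suc (Suc t)) = (real t + 2) * (fact (Suc t) :: real)" "fact (Suc t) = (real t + 1) * (fact t :: real)"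
     "fact (Suc q) = (real q + 1) * (fact q :: real)" "fact (Suc r) = (real r + 1) * (fact r :: real)"
    by (simp_all add: algebra_simps)
  have "log_coeff M (Suc j) (Suc i) = 4 * 4 ^ j * ((real r + 1) * (A + B)) * (real t + 2) * (real t + 1) * fact t * fact q / fact (Suc r)"
  proof -
    have "real r + 1 \<noteq> 0" by linarith
    then show ?thesis unfolding log_coeff_def f g bin ft by (simp add: divide_simps)
  qed
  also have "\<dots> = 4 * (real t + 2) * (real M - (real t + 2)) * (4 ^ j * B * fact (Suc t) * fact q / fact (Suc r))
      + 4 * (real t + 1) * (real t + 2) * (4 ^ j * A * fact t * fact (Suc q) / fact (Suc r))"
  proof -
    define X where "X = (fact (Suc r) :: real)"
    show ?thesis unfolding key ft(2,3) X_def[symmetric]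
      by (simp add: add_divide_distrib diff_divide_distrib algebra_simps)
  qed
  also have "\<dots> = 4 * real (j + Suc i) * (real M - real (j + Suc i)) * log_coeff M j (Suc i)
    + 4 * real (j + i) * (real (j + i) + 1) * log_coeff M j i"
    unfolding log_coeff_def f g A_def[symmetric] B_def[symmetric] t by (simp add: algebra_simps)
  finally show ?thesis .
qed

text \<open>Each term of the sum for j produces one term with the same power of e and one with the
  next power; collecting equal powers of e gives the recursion for the coefficients.\<close>

lemma lap_jet_pow_log_jet:
  assumes e: "e > 0" and s: "s \<ge> 0"
  shows "1 \<le> j \<Longrightarrow> j \<le> M \<Longrightarrow>
    (lap_jet M ^^ j) (log_jet e) l s = (\<Sum>i\<le>j. log_coeff M j i * e ^ i * power_jet e (j + i) l s)"
proof (induction j arbitrary: l)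
  case (Suc j)
  show ?case
  proof (cases "j = 0")
    case True
    obtain M' where "M = Suc M'" using Suc.prems by (cases M) auto
    then have "fact M = real M * fact (M - Suc 0)" by simp
    then have "log_coeff M 1 0 = 4 * real M" "log_coeff M 1 1 = 4" by (auto simp: log_coeff_def)
    then show ?thesis using True lap_jet_log_jet[OF e s] by (simp add: numeral_2_eq_2)
  next
    case False
    then have j: "1 \<le> j" "j < M" using Suc.prems by auto
    let ?X = "\<lambda>l s. \<Sum>i\<le>j. log_coeff M j i * e ^ i * power_jet e (j + i) l s"
    let ?c = "log_coeff M j" and ?p = "\<lambda>k. power_jet e k l s"
    have "(lap_jet M ^^ Suc j) (log_jet e) l s = lap_jet M ?X l s"
      unfolding funpow.simps o_apply lap_jet_def[of M "(lap_jet M ^^ j) (log_jet e)"] lap_jet_def[of M ?X]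
      using Suc.IH[OF j(1)] j(2) by simp
    also have "\<dots> = (\<Sum>i\<le>j. ?c i * e ^ i * lap_jet M (power_jet e (j + i)) l s)"
      unfolding lap_jet_def by (simp add: sum_distrib_left sum.distrib sum_negf sum_subtractf algebra_simps)
    also have "\<dots> = (\<Sum>i\<le>j. 4 * real (j + i) * (real M - real (j + i)) * ?c i * e ^ i * ?p (Suc j + i))
        + (\<Sum>i\<le>j. 4 * real (j + i) * (real (j + i) + 1) * ?c i * e ^ Suc i * ?p (Suc j + Suc i))"
      unfolding lap_jet_power_jet[OF e s] sum.distrib[symmetric]
      by (intro sum.cong refl) (simp add: algebra_simps)
    \<comment> \<open>The additional index costs nothing because \<open>j choose Suc j\<close> is 0;
      it aligns the two sums for the shift.\<close>
    also have "(\<Sum>i\<le>j. 4 * real (j + i) * (real M - real (j + i)) * ?c i * e ^ i * ?p (Suc j + i))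
       = (\<Sum>i\<le>Suc j. 4 * real (j + i) * (real M - real (j + i)) * ?c i * e ^ i * ?p (Suc j + i))"
      by (simp add: log_coeff_def)
    also have "\<dots> = log_coeff M (Suc j) 0 * ?p (Suc j)
       + (\<Sum>i\<le>j. 4 * real (j + Suc i) * (real M - real (j + Suc i)) * ?c (Suc i) * e ^ Suc i * ?p (Suc j + Suc i))"
      unfolding sum.atMost_Suc_shift[of _ j] log_coeff_Suc_0[OF j] by simp
    finally have "(lap_jet M ^^ Suc j) (log_jet e) l s = log_coeff M (Suc j) 0 * ?p (Suc j)
       + (\<Sum>i\<le>j. log_coeff M (Suc j) (Suc i) * e ^ Suc i * ?p (Suc j + Suc i))"
      unfolding add.assoc sum.distrib[symmetric]
      by (simp only:) (intro arg_cong2[of _ _ _ _ "(+)"] sum.cong refl, simp add: log_coeff_Suc_Suc[OF j] algebra_simps)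
    then show ?thesis unfolding sum.atMost_Suc_shift[of _ j] by simp
  qed
qed auto

section \<open>Integration over the unit ball\<close>

lemma trunc_indicator: "trunc f (z \<bullet> z) = indicator (ball 0 1) (z::'a::euclidean_space) * f (z \<bullet> z)"
  by (simp add: trunc_def indicator_def dot_square_norm abs_square_less_1)

lemma trunc_set_integral:
  "(LINT z|lborel. trunc f (z \<bullet> z) * v z) = (LINT z:ball 0 1|lborel. f (z \<bullet> z) * v (z::'a::euclidean_space))"
  unfolding set_lebesgue_integral_def trunc_indicator by (simp add: mult_ac)

text \<open>1/|z| is dominated by the sum over k of 2^(k + 1) times the indicator of the ball of
  radius 2^(-k). In dimension at least 2 the volumes are O(4^(-k)), which leaves a geometric
  series.\<close>

lemma set_integrable_inverse_norm:
  assumes "DIM('a::euclidean_space) \<ge> 2"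
  shows "set_integrable lborel (ball 0 1) (\<lambda>z::'a. 1 / norm z)"
proof -
  let ?V = "measure lborel (ball (0::'a) 1)"
  let ?g = "\<lambda>k z::'a. ennreal (2 ^ Suc k) * indicator (ball 0 ((1/2) ^ k)) z"
  have term_le: "f j \<le> (\<Sum>k. f k)" for f :: "nat \<Rightarrow> ennreal" and j
    using sum_le_suminf[of f "{j}"] by simp
  have le: "ennreal (norm (indicator (ball 0 1) z *\<^sub>R (1 / norm z))) \<le> (\<Sum>k. ?g k z)" for z :: 'a
  proof (cases "z \<noteq> 0 \<and> norm z < 1")
    case True
    define k where "k = (LEAST k. (1/2) ^ k \<le> norm z)"
    have ex: "\<exists>k. (1/2) ^ k \<le> norm z"
      using real_arch_pow_inv[of "norm z" "1/2"] True by (auto intro: less_imp_le)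
    have k1: "(1/2) ^ k \<le> norm z" unfolding k_def using ex by (rule LeastI_ex)
    obtain j where j: "k = Suc j" using k1 True by (cases k) auto
    have k2: "norm z < (1/2) ^ j" using not_less_Least[of j "\<lambda>k. (1/2) ^ k \<le> norm z"] j by (auto simp: k_def[symmetric])
    have "1 / norm z \<le> 2 ^ Suc j"
      using k1 True unfolding j by (simp add: field_simps power_one_over)
    then have "ennreal (norm (indicator (ball 0 1) z *\<^sub>R (1 / norm z))) \<le> ?g j z"
      using True k2 by (simp add: ennreal_leI)
    also have "\<dots> \<le> (\<Sum>k. ?g k z)"
      by (rule term_le)
    finally show ?thesis .
  qed auto
  have "(\<integral>\<^sup>+z. ennreal (norm (indicator (ball 0 1) z *\<^sub>R (1 / norm (z::'a)))) \<partial>lborel) \<le> (\<integral>\<^sup>+z. (\<Sum>k. ?g k z) \<partial>lborel)"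
    by (intro nn_integral_mono le)
  also have "\<dots> = (\<Sum>k. (\<integral>\<^sup>+z. ?g k z \<partial>lborel))"
    by (rule nn_integral_suminf) (intro borel_measurable_times_ennreal borel_measurable_indicator; simp)
  also have "\<dots> = (\<Sum>k. ennreal (2 ^ Suc k * (((1/2) ^ k) ^ DIM('a) * ?V)))"
  proof (rule suminf_cong)
    fix k
    have "emeasure lborel (ball (0::'a) ((1/2) ^ k)) = ennreal (((1/2) ^ k) ^ DIM('a) * ?V)"
      using content_ball_conv_unit_ball[of "(1/2) ^ k" "0::'a"] emeasure_lborel_ball_finite[of "0::'a" "(1/2) ^ k"]
      by (subst emeasure_eq_ennreal_measure) auto
    then show "(\<integral>\<^sup>+z. ?g k z \<partial>lborel) = ennreal (2 ^ Suc k * (((1/2) ^ k) ^ DIM('a) * ?V))"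
      by (subst nn_integral_cmult_indicator) (auto simp: ennreal_mult[symmetric])
  qed
  also have "\<dots> \<le> (\<Sum>k. ennreal (2 * ?V * (1/2) ^ k))"
  proof (rule suminf_le)
    fix k
    have "((1/2::real) ^ k) ^ DIM('a) \<le> ((1/2) ^ k) ^ 2"
      by (rule power_decreasing) (use assms in \<open>auto simp: power_le_one\<close>)
    then have "2 ^ Suc k * (((1/2) ^ k) ^ DIM('a) * ?V) \<le> 2 ^ Suc k * (((1/2) ^ k) ^ 2 * ?V)"
      by (intro mult_left_mono mult_right_mono) auto
    also have "\<dots> = 2 * ?V * (1/2) ^ k"
      by (simp add: power2_eq_square power_one_over field_simps)
    finally show "ennreal (2 ^ Suc k * (((1/2) ^ k) ^ DIM('a) * ?V)) \<le> ennreal (2 * ?V * (1/2) ^ k)"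
      by (rule ennreal_leI)
  qed auto
  also have "\<dots> < \<infinity>"
  proof -
    have "summable (\<lambda>k. 2 * ?V * (1/2::real) ^ k)" by (intro summable_mult summable_geometric) auto
    then have "(\<Sum>k. ennreal (2 * ?V * (1/2) ^ k)) \<noteq> top"
      by (rule ennreal_suminf_neq_top) simp
    then show ?thesis unfolding infinity_ennreal_def less_top .
  qed
  finally have fin: "(\<integral>\<^sup>+z. ennreal (norm (indicator (ball 0 1) z *\<^sub>R (1 / norm (z::'a)))) \<partial>lborel) < \<infinity>" .
  have "(\<lambda>z::'a. 1 / norm z) \<in> borel_measurable lborel" by simp
  then have "(\<lambda>z::'a. indicator (ball 0 1) z *\<^sub>R (1 / norm z)) \<in> borel_measurable lborel"
    by (intro borel_measurable_scaleR borel_measurable_indicator) simp_all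
  then show ?thesis unfolding set_integrable_def using fin by (rule integrableI_bounded)
qed

lemma set_integrable_bound_mult:
  fixes g h :: "'a::euclidean_space \<Rightarrow> real"
  assumes "set_integrable lborel (ball 0 1) g" "continuous_on UNIV h"
  shows "set_integrable lborel (ball 0 1) (\<lambda>z. g z * h z)"
proof -
  have "compact (h ` cball 0 1)"
    using assms(2) by (intro compact_continuous_image) (auto intro: continuous_on_subset)
  then obtain B where B: "\<And>z. z \<in> cball 0 1 \<Longrightarrow> \<bar>h z\<bar> \<le> B"
    using compact_imp_bounded bounded_real by (metis image_eqI)
  have [measurable]: "h \<in> borel_measurable borel" using assms(2) by (rule borel_measurable_continuous_onI)
  have [measurable]: "(\<lambda>x. indicator (ball 0 1) x *\<^sub>R g x) \<in> borel_measurable lborel"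
    using assms(1) unfolding set_integrable_def by auto
  have "integrable lborel (\<lambda>x. (indicator (ball 0 1) x *\<^sub>R g x) * B)"
    using assms(1) unfolding set_integrable_def by auto
  then have "integrable lborel (\<lambda>x. (indicator (ball 0 1) x *\<^sub>R g x) * h x)"
  proof (rule Bochner_Integration.integrable_bound)
    show "AE x in lborel. norm ((indicator (ball 0 1) x *\<^sub>R g x) * h x) \<le> norm ((indicator (ball 0 1) x *\<^sub>R g x) * B)"
    proof (rule AE_I2)
      fix x :: 'a
      show "norm ((indicator (ball 0 1) x *\<^sub>R g x) * h x) \<le> norm ((indicator (ball 0 1) x *\<^sub>R g x) * B)"
      proof (cases "norm x < 1")
        case True
        then have "\<bar>h x\<bar> \<le> B" using B[of x] by auto
        then have "\<bar>h x\<bar> \<le> \<bar>B\<bar>" by simp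
        then have "\<bar>g x\<bar> * \<bar>h x\<bar> \<le> \<bar>g x\<bar> * \<bar>B\<bar>" by (rule mult_left_mono) simp
        then show ?thesis using True by (simp add: abs_mult)
      qed auto
    qed
  qed measurable
  then show ?thesis unfolding set_integrable_def by (simp add: mult.assoc)
qed

text \<open>The added 1 makes the kernel at least 1 on the punctured unit ball, so that it absorbs
  bounded errors; its exponential there is e/|z|.\<close>

definition log_kernel :: "'a::euclidean_space \<Rightarrow> real" where
  "log_kernel z = 1 + ln (1 / norm z)"

lemma log_kernel_nonneg: "norm z < 1 \<Longrightarrow> log_kernel z \<ge> 0"
  using ln_le_minus_one[of "norm z"] by (cases "z = 0") (auto simp: log_kernel_def ln_div)

lemma log_kernel_measurable[measurable]: "log_kernel \<in> borel_measurable borel"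
  unfolding log_kernel_def[abs_def] by measurable

text \<open>The inequality ln t \<le> t - 1 at t = 1/|z| gives the majorant 1/|z|.\<close>

lemma set_integrable_log_kernel:
  assumes "DIM('a::euclidean_space) \<ge> 2"
  shows "set_integrable lborel (ball 0 1) (log_kernel :: 'a \<Rightarrow> real)"
proof (rule set_integrable_bound[OF set_integrable_inverse_norm[OF assms]])
  show "set_borel_measurable lborel (ball 0 1) (log_kernel :: 'a \<Rightarrow> real)"
    unfolding set_borel_measurable_def
    by (intro borel_measurable_scaleR borel_measurable_indicator) simp_all
  have "AE z in lborel. z \<noteq> (0::'a)" by (rule AE_lborel_singleton)
  then show "AE z in lborel. z \<in> ball 0 1 \<longrightarrow> norm (log_kernel z) \<le> norm (1 / norm (z::'a))"
  proof eventually_elim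
    case (elim z)
    have "ln (1 / norm z) \<le> 1 / norm z - 1" by (rule ln_le_minus_one) (use elim in auto)
    then show ?case using log_kernel_nonneg[of z] by (auto simp: log_kernel_def)
  qed
qed

lemma set_integral_pos_const:
  fixes f :: "'a::euclidean_space \<Rightarrow> real"
  assumes "set_integrable lborel (ball 0 1) f" "\<And>z. norm z < 1 \<Longrightarrow> f z \<ge> 0"
    "\<And>z. norm z < 1/2 \<Longrightarrow> f z \<ge> c"
  shows "(LINT z:ball 0 1|lborel. f z) \<ge> c * measure lborel (ball (0::'a) (1/2))"
proof -
  have i: "integrable lborel (\<lambda>z. indicator (ball (0::'a) (1/2)) z *\<^sub>R c)"
    using set_integrable_continuous_ball[OF continuous_on_const] unfolding set_integrable_def .
  have "c * measure lborel (ball (0::'a) (1/2)) = (LINT z|lborel. indicator (ball (0::'a) (1/2)) z *\<^sub>R c)"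
    by simp
  also have "\<dots> \<le> (LINT z|lborel. indicator (ball 0 1) z *\<^sub>R f z)"
    by (rule integral_mono[OF i assms(1)[unfolded set_integrable_def]])
       (use assms in \<open>auto simp: indicator_def\<close>)
  finally show ?thesis unfolding set_lebesgue_integral_def .
qed

section \<open>Taylor polynomials of jets\<close>

text \<open>The jet of the Taylor polynomial of degree below N at s = 1; from order N on the sum is
  empty. Subtracting it takes the place of a cutoff: the difference vanishes at the sphere and its
  Laplacians stay explicit.\<close>

definition taylor_jet :: "nat \<Rightarrow> (nat \<Rightarrow> real \<Rightarrow> real) \<Rightarrow> nat \<Rightarrow> real \<Rightarrow> real" where
  "taylor_jet N d l s = (\<Sum>i<N - l. d (l + i) 1 * (s - 1) ^ i / fact i)"

lemma is_jet_taylor_jet: "is_jet (taylor_jet N d)"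
  unfolding is_jet_def
proof (intro allI impI)
  fix l and s :: real
  show "(taylor_jet N d l has_real_derivative taylor_jet N d (Suc l) s) (at s)"
  proof (cases "N - l")
    case 0
    then show ?thesis by (simp add: taylor_jet_def[abs_def])
  next
    case (Suc r)
    then have r: "N - Suc l = r" by simp
    have "((\<lambda>s. s - 1) has_real_derivative 1) (at s)" by (auto intro!: derivative_eq_intros)
    from DERIV_power_Suc[OF this]
    have p: "((\<lambda>s. (s - 1) ^ Suc n) has_real_derivative real (Suc n) * (s - 1) ^ n) (at s)" for n
      by (simp add: add.commute)
    have "((\<lambda>s. d l 1 + (\<Sum>i<r. d (l + Suc i) 1 * (s - 1) ^ Suc i / fact (Suc i))) has_real_derivative
        0 + (\<Sum>i<r. d (l + Suc i) 1 * (real (Suc i) * (s - 1) ^ i) / fact (Suc i))) (at s)"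
      by (intro DERIV_add DERIV_const DERIV_sum DERIV_cdivide DERIV_cmult p)
    moreover have "d (l + Suc i) 1 * (real (Suc i) * (s - 1) ^ i) / fact (Suc i) = d (Suc l + i) 1 * (s - 1) ^ i / fact i" for i
      by (simp add: field_simps del: of_nat_Suc)
    ultimately show ?thesis
      unfolding taylor_jet_def[abs_def] Suc r sum.lessThan_Suc_shift by simp
  qed
qed

lemma taylor_jet_at_1: "l < N \<Longrightarrow> taylor_jet N d l 1 = d l 1"
  by (cases "N - l") (auto simp: taylor_jet_def sum.lessThan_Suc_shift)

text \<open>The logarithmic and power jets blow up as e and s tend to 0. Their Taylor polynomials at
  s = 1 do not, and these are the families to which this notion is applied.\<close>

definition unif_bdd :: "(real \<Rightarrow> nat \<Rightarrow> real \<Rightarrow> real) \<Rightarrow> bool" where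
  "unif_bdd D \<longleftrightarrow> (\<forall>k. \<exists>B. \<forall>e s. 0 < e \<longrightarrow> e \<le> 1 \<longrightarrow> 0 \<le> s \<longrightarrow> s \<le> 1 \<longrightarrow> \<bar>D e k s\<bar> \<le> B)"

lemma unif_bddE:
  assumes "unif_bdd D"
  obtains B where "B \<ge> 0" "\<And>e s. 0 < e \<Longrightarrow> e \<le> 1 \<Longrightarrow> 0 \<le> s \<Longrightarrow> s \<le> 1 \<Longrightarrow> \<bar>D e k s\<bar> \<le> B"
proof -
  obtain B where "\<And>e s. 0 < e \<Longrightarrow> e \<le> 1 \<Longrightarrow> 0 \<le> s \<Longrightarrow> s \<le> 1 \<Longrightarrow> \<bar>D e k s\<bar> \<le> B"
    using assms unfolding unif_bdd_def by blast
  then show ?thesis using that[of "max 0 B"] by (meson max.cobounded1 max.cobounded2 order_trans)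
qed

lemma unif_bdd_lap_jet:
  assumes "unif_bdd D" shows "unif_bdd (\<lambda>e. lap_jet M (D e))"
  unfolding unif_bdd_def
proof
  fix k
  obtain B1 where B1: "B1 \<ge> 0" "\<And>e s. 0 < e \<Longrightarrow> e \<le> 1 \<Longrightarrow> 0 \<le> s \<Longrightarrow> s \<le> 1 \<Longrightarrow> \<bar>D e (Suc k) s\<bar> \<le> B1"
    using unif_bddE[OF assms] by metis
  obtain B2 where B2: "B2 \<ge> 0" "\<And>e s. 0 < e \<Longrightarrow> e \<le> 1 \<Longrightarrow> 0 \<le> s \<Longrightarrow> s \<le> 1 \<Longrightarrow> \<bar>D e (Suc (Suc k)) s\<bar> \<le> B2"
    using unif_bddE[OF assms] by metis
  let ?c = "4 * real k + 4 * real (Suc M)"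
  have "\<bar>lap_jet M (D e) k s\<bar> \<le> 4 * B2 + ?c * B1" if "0 < e" "e \<le> 1" "0 \<le> s" "s \<le> 1" for e s
  proof -
    have "\<bar>lap_jet M (D e) k s\<bar> \<le> \<bar>4 * s * D e (Suc (Suc k)) s\<bar> + \<bar>?c * D e (Suc k) s\<bar>"
      unfolding lap_jet_def by linarith
    also have "\<dots> = (4 * s) * \<bar>D e (Suc (Suc k)) s\<bar> + ?c * \<bar>D e (Suc k) s\<bar>"
      using that by (simp add: abs_mult)
    also have "\<dots> \<le> 4 * B2 + ?c * B1"
      using that B1 B2 by (intro add_mono mult_mono) auto
    finally show ?thesis .
  qed
  then show "\<exists>B. \<forall>e s. 0 < e \<longrightarrow> e \<le> 1 \<longrightarrow> 0 \<le> s \<longrightarrow> s \<le> 1 \<longrightarrow> \<bar>lap_jet M (D e) k s\<bar> \<le> B" by blast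
qed

lemma unif_bdd_lap_jet_pow: "unif_bdd D \<Longrightarrow> unif_bdd (\<lambda>e. (lap_jet M ^^ j) (D e))"
  by (induction j) (auto intro: unif_bdd_lap_jet)

lemma unif_bdd_taylor_jet:
  assumes "\<And>l. \<exists>B. \<forall>e. 0 < e \<longrightarrow> e \<le> 1 \<longrightarrow> \<bar>D e l 1\<bar> \<le> B"
  shows "unif_bdd (\<lambda>e. taylor_jet N (D e))"
  unfolding unif_bdd_def
proof
  fix k
  obtain B where B: "\<And>l e. 0 < e \<Longrightarrow> e \<le> 1 \<Longrightarrow> \<bar>D e l 1\<bar> \<le> B l" using assms by metis
  have "\<bar>taylor_jet N (D e) k s\<bar> \<le> (\<Sum>i<N - k. B (k + i))" if "0 < e" "e \<le> 1" "0 \<le> s" "s \<le> 1" for e s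
  proof -
    have "\<bar>taylor_jet N (D e) k s\<bar> \<le> (\<Sum>i<N - k. \<bar>D e (k + i) 1 * (s - 1) ^ i / fact i\<bar>)"
      unfolding taylor_jet_def by (rule sum_abs)
    also have "\<dots> \<le> (\<Sum>i<N - k. B (k + i))"
    proof (rule sum_mono)
      fix i
      have "\<bar>s - 1\<bar> ^ i \<le> 1" using that by (intro power_le_one) auto
      then have "\<bar>(s - 1) ^ i / fact i\<bar> \<le> 1"
        by (simp add: power_abs field_simps) (meson fact_ge_1 order_trans)
      then have "\<bar>D e (k + i) 1\<bar> * \<bar>(s - 1) ^ i / fact i\<bar> \<le> \<bar>D e (k + i) 1\<bar>"
        by (intro mult_left_le) auto
      also have "\<dots> \<le> B (k + i)" using B that by blast
      finally show "\<bar>D e (k + i) 1 * (s - 1) ^ i / fact i\<bar> \<le> B (k + i)"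
        by (simp add: abs_mult)
    qed
    finally show ?thesis .
  qed
  then show "\<exists>B. \<forall>e s. 0 < e \<longrightarrow> e \<le> 1 \<longrightarrow> 0 \<le> s \<longrightarrow> s \<le> 1 \<longrightarrow> \<bar>taylor_jet N (D e) k s\<bar> \<le> B" by blast
qed

lemma power_jet_at_1_bound:
  assumes "e > 0" shows "\<bar>power_jet e k l 1\<bar> \<le> \<bar>pochhammer (real k) l\<bar>"
proof -
  have "inverse (e + 1) ^ (k + l) \<le> 1" using assms by (intro power_le_one) (auto simp: field_simps)
  then show ?thesis using assms unfolding power_jet_def
    by (simp add: abs_mult mult_left_le)
qed

lemma unif_bdd_taylor_power_jet: "unif_bdd (\<lambda>e. taylor_jet N (power_jet e k))"
  by (rule unif_bdd_taylor_jet) (use power_jet_at_1_bound in blast)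

lemma unif_bdd_taylor_log_jet: "unif_bdd (\<lambda>e. taylor_jet N (log_jet e))"
proof (rule unif_bdd_taylor_jet)
  fix l
  show "\<exists>B. \<forall>e. 0 < e \<longrightarrow> e \<le> 1 \<longrightarrow> \<bar>log_jet e l 1\<bar> \<le> B"
  proof (cases l)
    case 0
    have "\<bar>ln (e + 1)\<bar> \<le> 1" if "0 < e" "e \<le> 1" for e :: real
      using ln_add_one_self_le_self[of e] that by (simp add: add.commute)
    then show ?thesis using 0 by (auto simp: log_jet_def)
  next
    case (Suc l')
    then show ?thesis using power_jet_at_1_bound[of _ 1 l'] by (auto simp: log_jet_def)
  qed
qed

lemma lap_jet_diff:
  "lap_jet M (\<lambda>k s. d k s - d' k s) = (\<lambda>k s. lap_jet M d k s - lap_jet M d' k s)"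
  by (simp add: lap_jet_def fun_eq_iff algebra_simps)

lemma lap_jet_pow_diff:
  "(lap_jet M ^^ j) (\<lambda>k s. d k s - d' k s) = (\<lambda>k s. (lap_jet M ^^ j) d k s - (lap_jet M ^^ j) d' k s)"
  by (induction j) (simp_all add: lap_jet_diff)

section \<open>The pointwise upper bound\<close>

text \<open>With 2M + 1 Taylor terms the derivatives of order 0 to 2M vanish at s = 1, which permits
  M integrations by parts of the Laplacian.\<close>

definition log_test :: "nat \<Rightarrow> real \<Rightarrow> nat \<Rightarrow> real \<Rightarrow> real" where
  "log_test M e k s = log_jet e k s - taylor_jet (2 * M + 1) (log_jet e) k s"

text \<open>Three Taylor terms suffice here, since a single Laplacian is to be moved.\<close>

definition newton_test :: "nat \<Rightarrow> real \<Rightarrow> nat \<Rightarrow> real \<Rightarrow> real" where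
  "newton_test M e k s = power_jet e M k s - taylor_jet 3 (power_jet e M) k s"

text \<open>Minus the Laplacian of the regularised Newton kernel: an approximate multiple of the
  Dirac mass at the origin as e tends to 0.\<close>

definition bubble :: "nat \<Rightarrow> real \<Rightarrow> real \<Rightarrow> real" where
  "bubble M e s = 4 * e * real M * (real M + 1) * inverse (e + s) ^ (M + 2)"

text \<open>Minus the Laplacian of the Taylor correction. It is the weight of the average of
  \<open>v\<close> with which \<open>v 0\<close> is compared.\<close>

definition bubble_mean :: "nat \<Rightarrow> real \<Rightarrow> real \<Rightarrow> real" where
  "bubble_mean M e s = lap_jet M (taylor_jet 3 (power_jet e M)) 0 s"

lemma is_jet_log_test: "e > 0 \<Longrightarrow> is_jet (log_test M e)"
  unfolding log_test_def[abs_def] by (intro is_jet_diff is_jet_log_jet is_jet_taylor_jet)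

lemma is_jet_newton_test: "e > 0 \<Longrightarrow> is_jet (newton_test M e)"
  unfolding newton_test_def[abs_def] by (intro is_jet_diff is_jet_power_jet is_jet_taylor_jet)

lemma lap_jet_newton_test:
  assumes "e > 0" "s \<ge> 0"
  shows "lap_jet M (newton_test M e) 0 s = bubble M e s - bubble_mean M e s"
proof -
  have "lap_jet M (newton_test M e) 0 s = lap_jet M (power_jet e M) 0 s - bubble_mean M e s"
    unfolding newton_test_def bubble_mean_def lap_jet_def by (simp add: algebra_simps)
  then show ?thesis
    unfolding lap_jet_power_jet[OF assms] bubble_def by (simp add: power_jet_def)
qed

text \<open>The Taylor correction is quadratic in s, so its Laplacian is affine. The bounds are free
  of e: the lower one makes the function a genuine averaging weight whose mass stays away from
  0.\<close>

lemma bubble_mean_bounds: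
  assumes e: "0 < e" "e \<le> 1" and s: "0 \<le> s" "s \<le> 1"
  shows "(1 - s) * (4 * (real M + 2) * real M * (real M + 1) * (1/2) ^ (M + 2)) \<le> bubble_mean M e s"
    and "bubble_mean M e s \<le> 4 * (real M + 1) * real M + 4 * (real M + 2) * real M * (real M + 1)"
proof -
  define t where "t = inverse (e + 1)"
  have t: "1/2 \<le> t" "t \<le> 1" "0 < t" using e by (auto simp: t_def field_simps)
  define a1 where "a1 = real M * t ^ (M + 1)"
  define a2 where "a2 = real M * (real M + 1) * t ^ (M + 2)"
  have p1: "power_jet e M 1 1 = - a1" by (simp add: power_jet_def a1_def t_def)
  have p2: "power_jet e M 2 1 = a2"
    by (simp add: power_jet_def a2_def t_def numeral_2_eq_2 pochhammer_Suc)
  have T2: "taylor_jet 3 (power_jet e M) (Suc (Suc 0)) s = a2"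
    using p2 by (simp add: taylor_jet_def numeral_2_eq_2 numeral_3_eq_3)
  have T1: "taylor_jet 3 (power_jet e M) (Suc 0) s = - a1 + a2 * (s - 1)"
    using p1 p2 by (simp add: taylor_jet_def numeral_2_eq_2 numeral_3_eq_3)
  \<comment> \<open>The constant part turns out to carry the factor 1 - t \<ge> 0, so it may be
    dropped in the lower bound; t \<ge> 1/2 explains the power of 1/2.\<close>
  have eq: "bubble_mean M e s = (4 * (real M + 1) * a1 - 4 * a2) + (1 - s) * (4 * (real M + 2) * a2)"
    unfolding bubble_mean_def lap_jet_def T1 T2 by (simp add: algebra_simps)
  have "4 * (real M + 1) * a1 - 4 * a2 = 4 * real M * (real M + 1) * t ^ (M + 1) * (1 - t)"
    by (simp add: a1_def a2_def algebra_simps)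
  also have "\<dots> \<ge> 0" using t by simp
  finally have pos: "4 * (real M + 1) * a1 - 4 * a2 \<ge> 0" .
  have pw: "(1/2) ^ (M + 2) \<le> t ^ (M + 2)" using t by (intro power_mono) auto
  have a2l: "real M * (real M + 1) * (1/2) ^ (M + 2) \<le> a2" unfolding a2_def
    by (rule mult_left_mono[OF pw]) auto
  have a2u: "a2 \<le> real M * (real M + 1)" "a2 \<ge> 0"
    using t power_le_one[of t "M + 2"] by (auto simp: a2_def mult_left_le)
  have a1u: "a1 \<le> real M" "a1 \<ge> 0" using t power_le_one[of t "M + 1"] by (auto simp: a1_def mult_left_le)
  have "(1 - s) * (4 * (real M + 2) * (real M * (real M + 1) * (1/2) ^ (M + 2))) \<le> (1 - s) * (4 * (real M + 2) * a2)"
    using s a2l by (intro mult_left_mono) auto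
  then show "(1 - s) * (4 * (real M + 2) * real M * (real M + 1) * (1/2) ^ (M + 2)) \<le> bubble_mean M e s"
    unfolding eq using pos by (simp add: mult.assoc)
  have "(1 - s) * (4 * (real M + 2) * a2) \<le> 1 * (4 * (real M + 2) * (real M * (real M + 1)))"
    using s a2u by (intro mult_mono) auto
  moreover have "4 * (real M + 1) * a1 \<le> 4 * (real M + 1) * real M"
    using a1u by (intro mult_left_mono) auto
  ultimately show "bubble_mean M e s \<le> 4 * (real M + 1) * real M + 4 * (real M + 2) * real M * (real M + 1)"
    unfolding eq using a2u(2) by linarith
qed

text \<open>All coefficients of (-\<Delta>)^M of the logarithm are nonnegative, so the leading term,
  a positive multiple of the Newton kernel, lies below the whole sum. The other terms are of size
  e^(-M) at the origin, hence only a one-sided comparison holds; it suffices against -\<Delta> v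
  \<ge> 0.\<close>

lemma newton_test_le:
  assumes M: "M \<ge> 1"
  obtains a C where "a > 0" "C \<ge> 0"
    "\<And>e s. 0 < e \<Longrightarrow> e \<le> 1 \<Longrightarrow> 0 \<le> s \<Longrightarrow> s \<le> 1 \<Longrightarrow>
       newton_test M e 0 s \<le> a * (lap_jet M ^^ M) (log_test M e) 0 s + C"
proof -
  let ?c = "log_coeff M M 0"
  have c: "?c > 0" by (simp add: log_coeff_def)
  obtain B1 where B1: "B1 \<ge> 0" "\<And>e s. 0 < e \<Longrightarrow> e \<le> 1 \<Longrightarrow> 0 \<le> s \<Longrightarrow> s \<le> 1 \<Longrightarrow> \<bar>taylor_jet 3 (power_jet e M) 0 s\<bar> \<le> B1"
    using unif_bddE[OF unif_bdd_taylor_power_jet] by metis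
  obtain B2 where B2: "B2 \<ge> 0" "\<And>e s. 0 < e \<Longrightarrow> e \<le> 1 \<Longrightarrow> 0 \<le> s \<Longrightarrow> s \<le> 1 \<Longrightarrow> \<bar>(lap_jet M ^^ M) (taylor_jet (2 * M + 1) (log_jet e)) 0 s\<bar> \<le> B2"
    using unif_bddE[OF unif_bdd_lap_jet_pow[OF unif_bdd_taylor_log_jet]] by metis
  show ?thesis
  proof (rule that[of "1 / ?c" "B1 + B2 / ?c"])
    fix e s :: real assume es: "0 < e" "e \<le> 1" "0 \<le> s" "s \<le> 1"
    have "?c * power_jet e M 0 s \<le> (\<Sum>i\<le>M. log_coeff M M i * e ^ i * power_jet e (M + i) 0 s)"
    proof -
      have "(\<Sum>i\<in>{0}. log_coeff M M i * e ^ i * power_jet e (M + i) 0 s) \<le> (\<Sum>i\<le>M. log_coeff M M i * e ^ i * power_jet e (M + i) 0 s)"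
        by (rule sum_mono2) (use es log_coeff_nonneg in \<open>auto simp: power_jet_def\<close>)
      then show ?thesis by simp
    qed
    also have "\<dots> = (lap_jet M ^^ M) (log_jet e) 0 s"
      by (rule lap_jet_pow_log_jet[symmetric]) (use es M in auto)
    also have "\<dots> = (lap_jet M ^^ M) (log_test M e) 0 s + (lap_jet M ^^ M) (taylor_jet (2 * M + 1) (log_jet e)) 0 s"
      unfolding log_test_def[abs_def] lap_jet_pow_diff by simp
    also have "\<dots> \<le> (lap_jet M ^^ M) (log_test M e) 0 s + B2" using B2(2)[OF es] by simp
    finally have "power_jet e M 0 s \<le> ((lap_jet M ^^ M) (log_test M e) 0 s + B2) / ?c"
      using c by (simp add: field_simps)
    then show "newton_test M e 0 s \<le> 1 / ?c * (lap_jet M ^^ M) (log_test M e) 0 s + (B1 + B2 / ?c)"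
      using B1(2)[OF es] by (simp add: newton_test_def add_divide_distrib)
  qed (use c B1 B2 in auto)
qed

text \<open>The singular part ln(e + s) lies between ln s = 2 ln|z| and e + s - 1; the bounded
  Taylor part is absorbed since the kernel is at least 1.\<close>

lemma log_test_bound:
  obtains C :: real where "C \<ge> 0"
    "\<And>e (z::'a::euclidean_space). 0 < e \<Longrightarrow> e \<le> 1 \<Longrightarrow> z \<noteq> 0 \<Longrightarrow> norm z < 1 \<Longrightarrow> \<bar>log_test M e 0 (z \<bullet> z)\<bar> \<le> C * log_kernel z"
proof -
  obtain B where B: "B \<ge> 0" "\<And>e s. 0 < e \<Longrightarrow> e \<le> 1 \<Longrightarrow> 0 \<le> s \<Longrightarrow> s \<le> 1 \<Longrightarrow> \<bar>taylor_jet (2 * M + 1) (log_jet e) 0 s\<bar> \<le> B"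
    using unif_bddE[OF unif_bdd_taylor_log_jet] by metis
  show ?thesis
  proof (rule that[of "B + 2"])
    fix e :: real and z :: 'a assume e: "0 < e" "e \<le> 1" and z: "z \<noteq> 0" "norm z < 1"
    have s: "z \<bullet> z = norm z * norm z" by (simp add: dot_square_norm power2_eq_square)
    have s1: "0 < z \<bullet> z" "z \<bullet> z \<le> 1" using z by (auto simp: s intro: mult_le_one)
    have l: "ln (1 / norm z) \<ge> 0" "ln (1 / norm z) = - ln (norm z)" using z by (auto simp: ln_div)
    have "ln (e + z \<bullet> z) \<ge> ln (z \<bullet> z)" 
      by (rule iffD2[OF ln_le_cancel_iff[OF s1(1) add_pos_pos[OF e(1) s1(1)]]]) (use e in simp)
    then have "ln (e + z \<bullet> z) \<ge> - 2 * ln (1 / norm z)" using z l by (simp add: s ln_mult)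
    moreover have "ln (e + z \<bullet> z) \<le> (e + z \<bullet> z) - 1" by (rule ln_le_minus_one[OF add_pos_pos[OF e(1) s1(1)]])
    ultimately have "\<bar>ln (e + z \<bullet> z)\<bar> \<le> 2 * log_kernel z"
      using l e s1 by (simp add: log_kernel_def)
    moreover have "\<bar>taylor_jet (2 * M + 1) (log_jet e) 0 (z \<bullet> z)\<bar> \<le> B * log_kernel z"
    proof -
      have "B * 1 \<le> B * log_kernel z" using B(1) l by (intro mult_left_mono) (auto simp: log_kernel_def)
      then show ?thesis using B(2)[OF e, of "z \<bullet> z"] s1 by simp
    qed
    ultimately show "\<bar>log_test M e 0 (z \<bullet> z)\<bar> \<le> (B + 2) * log_kernel z"
      unfolding log_test_def log_jet_def by (simp add: algebra_simps)
  qed (use B in auto)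
qed

lemma continuous_on_bubble: "e > 0 \<Longrightarrow> continuous_on A (\<lambda>z::'a::euclidean_space. bubble M e (z \<bullet> z))"
proof -
  assume "e > 0"
  then have "e + z \<bullet> z \<noteq> 0" for z :: 'a by (metis add_pos_nonneg inner_ge_zero less_irrefl)
  then show ?thesis unfolding bubble_def by (intro continuous_intros) auto
qed

lemma continuous_on_bubble_mean: "continuous_on A (\<lambda>z::'a::euclidean_space. bubble_mean M e (z \<bullet> z))"
  unfolding bubble_mean_def by (rule is_jet_continuous_radial[OF is_jet_lap_jet[OF is_jet_taylor_jet]])

lemma set_integral_mono_ball:
  fixes f g :: "'a::euclidean_space \<Rightarrow> real"
  assumes "set_integrable lborel (ball 0 1) f" "set_integrable lborel (ball 0 1) g"
    "\<And>z. z \<noteq> 0 \<Longrightarrow> norm z < 1 \<Longrightarrow> f z \<le> g z"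
  shows "(LINT z:ball 0 1|lborel. f z) \<le> (LINT z:ball 0 1|lborel. g z)"
proof (rule set_integral_mono_AE[OF assms(1,2)])
  have "AE z in lborel. z \<noteq> (0::'a)" by (rule AE_lborel_singleton)
  then show "AE z in lborel. z \<in> ball 0 1 \<longrightarrow> f z \<le> g z"
    by eventually_elim (use assms(3) in auto)
qed

text \<open>
  Testing \<open>-\<Delta> v\<close> against the truncated Newton kernel recovers \<open>v 0\<close> up to the error of the bubble, and
  since \<open>-\<Delta> v \<ge> 0\<close> the Newton kernel may be replaced by \<open>(-\<Delta>)\<^sup>M\<close> of the truncated logarithm.
\<close>

lemma bubble_inequality:
  fixes v :: "'a::euclidean_space \<Rightarrow> real"
  assumes dim: "DIM('a) = 2 * Suc M" and a: "a > 0" and e: "0 < e" "e \<le> 1"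
    and v: "smooth v" "\<And>z. norm z < 1 \<Longrightarrow> laplacian v z \<le> 0"
    and b: "b \<ge> 0" "\<And>s. 0 \<le> s \<Longrightarrow> s \<le> 1 \<Longrightarrow> newton_test M e 0 s \<le> b * (lap_jet M ^^ M) (log_test M e) 0 s + C1"
    and C2: "\<And>z::'a. z \<noteq> 0 \<Longrightarrow> norm z < 1 \<Longrightarrow> \<bar>log_test M e 0 (z \<bullet> z)\<bar> \<le> C2 * log_kernel z"
    and C3: "\<And>s. 0 \<le> s \<Longrightarrow> s \<le> 1 \<Longrightarrow> 0 \<le> bubble_mean M e s \<and> bubble_mean M e s \<le> C3"
  shows "v 0 * (LINT z:ball 0 1|lborel. bubble_mean M e ((z::'a) \<bullet> z)) \<le>
      C3 / a * (LINT z:ball 0 1|lborel. exp (a * v z)) + C1 * (LINT z:ball 0 1|lborel. neg_laplacian v z)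
      + b * C2 * (LINT z:ball 0 1|lborel. log_kernel z * \<bar>(neg_laplacian ^^ Suc M) v z\<bar>)
      + (LINT z:ball 0 1|lborel. bubble M e (z \<bullet> z) * \<bar>v z - v 0\<bar>)"
    and "(LINT z:ball 0 1|lborel. bubble M e ((z::'a) \<bullet> z)) = (LINT z:ball 0 1|lborel. bubble_mean M e ((z::'a) \<bullet> z))"
proof -
  let ?I = "\<lambda>f::'a \<Rightarrow> real. (LINT z:ball 0 1|lborel. f z)"
  let ?S = "\<lambda>f::'a \<Rightarrow> real. set_integrable lborel (ball 0 1) f"
  define G where "G z = bubble M e (z \<bullet> z)" for z :: 'a
  define X where "X z = bubble_mean M e (z \<bullet> z)" for z :: 'a
  define L where "L = neg_laplacian v"
  define f where "f = (neg_laplacian ^^ Suc M) v"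
  define E where "E z = (lap_jet M ^^ M) (log_test M e) 0 (z \<bullet> z)" for z :: 'a
  note defs = G_def[abs_def] X_def[abs_def] E_def[abs_def]
  have cG: "continuous_on A G" for A unfolding defs by (rule continuous_on_bubble[OF e(1)])
  have cX: "continuous_on A X" for A unfolding defs by (rule continuous_on_bubble_mean)
  have jE: "is_jet ((lap_jet M ^^ j) (log_test M e))" for j
    by (induction j) (auto intro: is_jet_lap_jet is_jet_log_test e)
  have cE: "continuous_on A E" for A unfolding defs by (rule is_jet_continuous_radial[OF jE])
  have cv: "continuous_on A v" for A using smooth_continuous[OF v(1)] continuous_on_subset by blast
  have sL: "smooth L" unfolding L_def by (rule smooth_neg_laplacian[OF v(1)])
  have cL: "continuous_on A L" for A using smooth_continuous[OF sL] continuous_on_subset by blast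
  have sf: "smooth f" unfolding f_def by (rule smooth_neg_laplacian_pow[OF v(1)])
  have cf: "continuous_on A f" for A using smooth_continuous[OF sf] continuous_on_subset by blast
  have cN: "continuous_on A (\<lambda>z::'a. newton_test M e 0 (z \<bullet> z))" for A
    by (rule is_jet_continuous_radial[OF is_jet_newton_test[OF e(1)]])
  have cT: "continuous_on A (\<lambda>z::'a. log_test M e 0 (z \<bullet> z))" for A
    by (rule is_jet_continuous_radial[OF is_jet_log_test[OF e(1)]])
  note conts = cG cX cE cv cL cf cN cT
  have L0: "L z \<ge> 0" if "norm z < 1" for z using v(2)[OF that] by (simp add: L_def neg_laplacian_def)
  have s01: "0 \<le> z \<bullet> z \<and> z \<bullet> z \<le> 1" if "norm z < 1" for z :: 'a
    using that by (simp add: dot_square_norm abs_square_le_1)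
  have newton: "?I (\<lambda>z. newton_test M e 0 (z \<bullet> z) * neg_laplacian w z) = ?I (\<lambda>z. (G z - X z) * w z)" if "C_k 2 w" for w
  proof -
    have "?I (\<lambda>z. newton_test M e 0 (z \<bullet> z) * neg_laplacian w z) = ?I (\<lambda>z. lap_jet M (newton_test M e) 0 (z \<bullet> z) * w z)"
      unfolding trunc_set_integral[symmetric]
      by (rule green_trunc[OF dim is_jet_newton_test[OF e(1)] _ _ _ that])
         (auto simp: newton_test_def taylor_jet_at_1)
    also have "\<dots> = ?I (\<lambda>z. (G z - X z) * w z)"
      by (intro arg_cong[where f="\<lambda>f. ?I f"] ext)
         (simp add: lap_jet_newton_test[OF e(1)] G_def X_def)
    finally show ?thesis .
  qed
  \<comment> \<open>Testing the constant function 1 shows that the bubble and the averaging weight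
    have the same mass.\<close>
  have "?I (\<lambda>z. (G z - X z) * 1) = 0"
    using newton[OF C_k_const[of 2 1]] by (simp add: neg_laplacian_def laplacian_const)
  moreover have "?I (\<lambda>z. G z - X z) = ?I G - ?I X"
    by (intro set_integral_diff set_integrable_continuous_ball conts)
  ultimately show GX: "?I (\<lambda>z. bubble M e (z \<bullet> z)) = ?I (\<lambda>z. bubble_mean M e (z \<bullet> z))"
    unfolding defs by simp
  have "?I (\<lambda>z. (G z - X z) * v z) = ?I (\<lambda>z. G z * v z) - ?I (\<lambda>z. X z * v z)"
    unfolding left_diff_distrib
    by (intro set_integral_diff set_integrable_continuous_ball continuous_on_mult conts)
  moreover have "?I (\<lambda>z. G z * (v z - v 0)) = ?I (\<lambda>z. G z * v z) - ?I (\<lambda>z. v 0 * G z)"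
    unfolding right_diff_distrib mult.commute[of _ "v 0"]
    by (intro set_integral_diff set_integrable_continuous_ball continuous_on_mult continuous_on_const conts)
  moreover have "C_k 2 v" using v(1) by (simp add: smooth_def)
  \<comment> \<open>A mean value formula: \<open>v 0\<close> times the common mass is the weighted
    average of \<open>v\<close>, plus the Newton potential term, minus the error caused by the
    positive width of the bubble.\<close>
  ultimately have main: "v 0 * ?I X = ?I (\<lambda>z. X z * v z) + ?I (\<lambda>z. newton_test M e 0 (z \<bullet> z) * L z) - ?I (\<lambda>z. G z * (v z - v 0))"
    using newton[of v] GX unfolding L_def defs by simp
  \<comment> \<open>Since x \<le> exp(a x)/a and the weight is nonnegative, the average is
    controlled without any bound on the negative part of \<open>v\<close>.\<close>
  have 1: "?I (\<lambda>z. X z * v z) \<le> C3 / a * ?I (\<lambda>z. exp (a * v z))"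
  proof -
    have "?I (\<lambda>z. X z * v z) \<le> ?I (\<lambda>z. C3 / a * exp (a * v z))"
    proof (rule set_integral_mono_ball)
      fix z :: 'a assume z: "norm z < 1"
      have "a * v z \<le> exp (a * v z)" using exp_ge_add_one_self[of "a * v z"] by linarith
      then have "v z \<le> exp (a * v z) / a" using a by (simp add: field_simps)
      then have "X z * v z \<le> X z * (exp (a * v z) / a)"
        using C3 s01[OF z] by (intro mult_left_mono) (auto simp: X_def)
      also have "\<dots> \<le> C3 * (exp (a * v z) / a)"
        using C3 s01[OF z] a by (intro mult_right_mono) (auto simp: X_def)
      finally show "X z * v z \<le> C3 / a * exp (a * v z)" by simp
    qed (intro set_integrable_continuous_ball continuous_intros conts)+
    then show ?thesis by simp
  qed
  have 2: "?I (\<lambda>z. newton_test M e 0 (z \<bullet> z) * L z) \<le> b * ?I (\<lambda>z. E z * L z) + C1 * ?I L"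
  proof -
    have "?I (\<lambda>z. newton_test M e 0 (z \<bullet> z) * L z) \<le> ?I (\<lambda>z. b * (E z * L z) + C1 * L z)"
    proof (rule set_integral_mono_ball)
      fix z :: 'a assume z: "norm z < 1"
      have "newton_test M e 0 (z \<bullet> z) * L z \<le> (b * E z + C1) * L z"
        using b(2) s01[OF z] L0[OF z] by (intro mult_right_mono) (auto simp: E_def)
      then show "newton_test M e 0 (z \<bullet> z) * L z \<le> b * (E z * L z) + C1 * L z"
        by (simp add: algebra_simps)
    qed (intro set_integrable_continuous_ball continuous_intros conts)+
    also have "\<dots> = ?I (\<lambda>z. b * (E z * L z)) + ?I (\<lambda>z. C1 * L z)"
      by (intro set_integral_add set_integrable_continuous_ball continuous_intros conts)
    finally show ?thesis by simp
  qed
  \<comment> \<open>All M Laplacians move from the logarithm onto L = -\<Delta> v, which becomes the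
    top-order term f.\<close>
  have 3: "?I (\<lambda>z. E z * L z) \<le> C2 * ?I (\<lambda>z. log_kernel z * \<bar>f z\<bar>)"
  proof -
    have "?I (\<lambda>z. E z * L z) = ?I (\<lambda>z. log_test M e 0 (z \<bullet> z) * (neg_laplacian ^^ M) L z)"
      unfolding E_def trunc_set_integral[symmetric]
      by (rule green_trunc_pow[OF dim sL is_jet_log_test[OF e(1)], symmetric])
         (simp add: log_test_def taylor_jet_at_1)
    also have "(neg_laplacian ^^ M) L = f" unfolding L_def f_def by (simp add: funpow_swap1)
    also have "?I (\<lambda>z. log_test M e 0 (z \<bullet> z) * f z) \<le> ?I (\<lambda>z. C2 * (log_kernel z * \<bar>f z\<bar>))"
    proof (rule set_integral_mono_ball)
      show "?S (\<lambda>z. C2 * (log_kernel z * \<bar>f z\<bar>))"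
        using dim by (intro set_integrable_mult_right set_integrable_bound_mult set_integrable_log_kernel continuous_intros conts) auto
      fix z :: 'a assume z: "z \<noteq> 0" "norm z < 1"
      have "log_test M e 0 (z \<bullet> z) * f z \<le> \<bar>log_test M e 0 (z \<bullet> z)\<bar> * \<bar>f z\<bar>"
        by (metis abs_ge_self abs_mult)
      also have "\<dots> \<le> (C2 * log_kernel z) * \<bar>f z\<bar>" by (rule mult_right_mono[OF C2[OF z]]) simp
      finally show "log_test M e 0 (z \<bullet> z) * f z \<le> C2 * (log_kernel z * \<bar>f z\<bar>)" by (simp add: mult.assoc)
    qed (intro set_integrable_continuous_ball continuous_intros conts)
    finally show ?thesis by simp
  qed
  have G0: "G z \<ge> 0" for z using e by (simp add: G_def bubble_def)
  have 4: "- ?I (\<lambda>z. G z * (v z - v 0)) \<le> ?I (\<lambda>z. G z * \<bar>v z - v 0\<bar>)"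
  proof -
    have "?I (\<lambda>z. - (G z * (v z - v 0))) \<le> ?I (\<lambda>z. G z * \<bar>v z - v 0\<bar>)"
    proof (rule set_integral_mono_ball)
      fix z :: 'a
      have "G z * (- (v z - v 0)) \<le> G z * \<bar>v z - v 0\<bar>" using G0 by (intro mult_left_mono) auto
      then show "- (G z * (v z - v 0)) \<le> G z * \<bar>v z - v 0\<bar>" by (simp only: mult_minus_right)
    qed (intro set_integrable_continuous_ball continuous_intros conts)+
    moreover have "?I (\<lambda>z. - (G z * (v z - v 0))) = - ?I (\<lambda>z. G z * (v z - v 0))"
      by (intro set_integral_uminus set_integrable_continuous_ball continuous_intros conts)
    ultimately show ?thesis by simp
  qed
  have "b * ?I (\<lambda>z. E z * L z) \<le> b * (C2 * ?I (\<lambda>z. log_kernel z * \<bar>f z\<bar>))"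
    using 3 b(1) by (rule mult_left_mono)
  then show "v 0 * ?I (\<lambda>z. bubble_mean M e (z \<bullet> z)) \<le>
      C3 / a * ?I (\<lambda>z. exp (a * v z)) + C1 * ?I (\<lambda>z. neg_laplacian v z)
      + b * C2 * ?I (\<lambda>z. log_kernel z * \<bar>(neg_laplacian ^^ Suc M) v z\<bar>)
      + ?I (\<lambda>z. bubble M e (z \<bullet> z) * \<bar>v z - v 0\<bar>)"
    using main 1 2 4 unfolding L_def f_def[symmetric] defs by simp
qed

text \<open>Approximate identity for one fixed \<open>v\<close>: near the origin continuity makes
  the oscillation at most h, and outside the ball of radius d the bubble is at most e Q. That e
  depends on \<open>v\<close> is harmless, as the final estimate does not contain e.\<close>

lemma bubble_concentrates:
  fixes v :: "'a::euclidean_space \<Rightarrow> real"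
  assumes v: "continuous_on UNIV v" and K: "K \<ge> 0" "\<And>e. 0 < e \<Longrightarrow> e \<le> 1 \<Longrightarrow> (LINT z:ball 0 1|lborel. bubble M e ((z::'a) \<bullet> z)) \<le> K"
    and t: "t > 0"
  obtains e where "0 < e" "e \<le> 1" "(LINT z:ball 0 1|lborel. bubble M e (z \<bullet> z) * \<bar>v z - v 0\<bar>) \<le> t"
proof -
  have "compact ((\<lambda>z. v z - v 0) ` cball 0 1)"
    using v by (intro compact_continuous_image continuous_intros) (auto intro: continuous_on_subset)
  then obtain W where W: "\<And>z. z \<in> cball 0 1 \<Longrightarrow> \<bar>v z - v 0\<bar> \<le> W"
    using compact_imp_bounded bounded_real by (metis (mono_tags, lifting) image_eqI)
  have W0: "W \<ge> 0" using W[of 0] by simp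
  \<comment> \<open>Half of t is spent near the origin and half away from it; the summands 1 here
    and in the choice of e keep the denominators positive.\<close>
  define h where "h = t / (2 * (K + 1))"
  have h: "h > 0" using t K(1) by (simp add: h_def)
  have "isCont v 0" using v by (simp add: continuous_on_eq_continuous_at)
  then obtain d where d: "d > 0" "\<And>z. dist z 0 < d \<Longrightarrow> dist (v z) (v 0) < h"
    using h unfolding continuous_at_eps_delta by blast
  define Vol where "Vol = measure lborel (ball (0::'a) 1)"
  define Q where "Q = 4 * real M * (real M + 1) * inverse (d\<^sup>2) ^ (M + 2)"
  have Q: "Q \<ge> 0" by (simp add: Q_def)
  define e where "e = min 1 (t / (2 * (Q * W * Vol + 1)))"
  have QWV: "Q * W * Vol \<ge> 0" using Q W0 by (simp add: Vol_def)
  have e: "0 < e" "e \<le> 1" using t QWV by (auto simp: e_def)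
  have eq: "e * (Q * W * Vol) \<le> t / 2"
  proof -
    have "e * (Q * W * Vol) \<le> t / (2 * (Q * W * Vol + 1)) * (Q * W * Vol + 1)"
      using QWV t by (intro mult_mono) (auto simp: e_def)
    also have "\<dots> = t / 2"
    proof -
      have "Q * W * Vol + 1 \<noteq> 0" using QWV by linarith
      then show ?thesis by (simp add: divide_simps)
    qed
    finally show ?thesis .
  qed
  have bub0: "bubble M e s \<ge> 0" if "s \<ge> 0" for s using e that by (simp add: bubble_def)
  have le: "bubble M e (z \<bullet> z) * \<bar>v z - v 0\<bar> \<le> h * bubble M e (z \<bullet> z) + e * Q * W" if z: "norm z < 1" for z
  proof (cases "norm z < d")
    case True
    then have "\<bar>v z - v 0\<bar> \<le> h" using d(2)[of z] by (simp add: dist_real_def)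
    then have "bubble M e (z \<bullet> z) * \<bar>v z - v 0\<bar> \<le> bubble M e (z \<bullet> z) * h"
      using bub0 by (intro mult_left_mono) auto
    moreover have "e * Q * W \<ge> 0" using e Q W0 by simp
    ultimately show ?thesis by (simp add: mult.commute)
  next
    case False
    have "d\<^sup>2 \<le> z \<bullet> z" using inner_self_ge_of_norm[of d z] False d by auto
    then have "d\<^sup>2 \<le> e + z \<bullet> z" using e by linarith
    then have "inverse (e + z \<bullet> z) \<le> inverse (d\<^sup>2)" using d(1) by (intro le_imp_inverse_le) auto
    then have "inverse (e + z \<bullet> z) ^ (M + 2) \<le> inverse (d\<^sup>2) ^ (M + 2)"
      using e by (intro power_mono) auto
    then have "(4 * e * real M * (real M + 1)) * inverse (e + z \<bullet> z) ^ (M + 2) \<le> (4 * e * real M * (real M + 1)) * inverse (d\<^sup>2) ^ (M + 2)"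
      using e by (intro mult_left_mono) auto
    also have "\<dots> = e * Q" by (simp add: Q_def mult_ac)
    finally have "bubble M e (z \<bullet> z) \<le> e * Q" by (simp add: bubble_def)
    moreover have "\<bar>v z - v 0\<bar> \<le> W" by (rule W) (use z in simp)
    moreover have "0 \<le> e * Q" using e(1) Q by simp
    ultimately have "bubble M e (z \<bullet> z) * \<bar>v z - v 0\<bar> \<le> (e * Q) * W"
      by (intro mult_mono) (rule abs_ge_zero | assumption)+
    moreover have "h * bubble M e (z \<bullet> z) \<ge> 0" using h bub0 by simp
    ultimately show ?thesis by linarith
  qed
  note cb = continuous_on_bubble[OF e(1)]
  have cv: "continuous_on (cball 0 1) v" using v continuous_on_subset by blast
  have "(LINT z:ball 0 1|lborel. bubble M e (z \<bullet> z) * \<bar>v z - v 0\<bar>) \<le> (LINT z:ball 0 1|lborel. h * bubble M e ((z::'a) \<bullet> z) + e * Q * W)"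
    by (rule set_integral_mono_ball[OF _ _ le])
       (intro set_integrable_continuous_ball continuous_intros cb cv)+
  also have "\<dots> = (LINT z:ball 0 1|lborel. h * bubble M e ((z::'a) \<bullet> z)) + (LINT z:ball (0::'a) 1|lborel. e * Q * W)"
    by (intro set_integral_add set_integrable_continuous_ball continuous_intros cb)
  also have "(LINT z:ball (0::'a) 1|lborel. e * Q * W) = e * (Q * W * Vol)"
    by (simp add: set_lebesgue_integral_def Vol_def)
  also have "(LINT z:ball 0 1|lborel. h * bubble M e ((z::'a) \<bullet> z)) = h * (LINT z:ball 0 1|lborel. bubble M e ((z::'a) \<bullet> z))"
    by simp
  also have "\<dots> + e * (Q * W * Vol) \<le> h * K + t / 2"
    using K(2)[OF e] h eq by (intro add_mono mult_left_mono) auto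
  also have "\<dots> \<le> t"
  proof -
    have "h * K \<le> h * (K + 1)" using h by simp
    also have "\<dots> = t / 2"
    proof -
      have "K + 1 \<noteq> 0" using K(1) by linarith
      then show ?thesis by (simp add: h_def divide_simps)
    qed
    finally show ?thesis by simp
  qed
  finally show ?thesis using that e by blast
qed

text \<open>B is chosen before \<open>v\<close>, from the dimension and \<open>a\<close> alone,
  which makes the bound usable at every centre and scale. The regularisation disappears because the
  bubble error can be made smaller than any t > 0.\<close>

lemma pointwise_bound:
  assumes dim: "DIM('a::euclidean_space) = 2 * Suc M" and M: "M \<ge> 1" and a: "a > 0"
  obtains B where "B > 0"
    "\<And>v::'a \<Rightarrow> real. smooth v \<Longrightarrow> (\<And>z. norm z < 1 \<Longrightarrow> laplacian v z \<le> 0) \<Longrightarrow>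
      (LINT z:ball 0 1|lborel. exp (a * v z)) \<le> 1 \<Longrightarrow>
      v 0 \<le> B * (1 + (LINT z:ball 0 1|lborel. neg_laplacian v z)
        + (LINT z:ball 0 1|lborel. log_kernel z * \<bar>(neg_laplacian ^^ Suc M) v z\<bar>))"
proof -
  let ?I = "\<lambda>f::'a \<Rightarrow> real. (LINT z:ball 0 1|lborel. f z)"
  obtain b C1 where b: "b > 0" and C1: "C1 \<ge> 0" and
    newton: "\<And>e s. 0 < e \<Longrightarrow> e \<le> 1 \<Longrightarrow> 0 \<le> s \<Longrightarrow> s \<le> 1 \<Longrightarrow>
       newton_test M e 0 s \<le> b * (lap_jet M ^^ M) (log_test M e) 0 s + C1"
    using newton_test_le[OF M] by metis
  obtain C2 where C2: "C2 \<ge> 0" "\<And>e (z::'a). 0 < e \<Longrightarrow> e \<le> 1 \<Longrightarrow> z \<noteq> 0 \<Longrightarrow> norm z < 1 \<Longrightarrow> \<bar>log_test M e 0 (z \<bullet> z)\<bar> \<le> C2 * log_kernel z"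
    using log_test_bound[of M, where 'a='a] by metis
  define C3 where "C3 = 4 * (real M + 1) * real M + 4 * (real M + 2) * real M * (real M + 1)"
  define c3 where "c3 = 4 * (real M + 2) * real M * (real M + 1) * (1/2) ^ (M + 2)"
  have c3: "c3 > 0" using M by (simp add: c3_def)
  have C30: "C3 \<ge> 0" by (simp add: C3_def)
  have mean: "(1 - s) * c3 \<le> bubble_mean M e s" "bubble_mean M e s \<le> C3" "0 \<le> bubble_mean M e s"
    if "0 < e" "e \<le> 1" "0 \<le> s" "s \<le> 1" for e s
  proof -
    show 1: "(1 - s) * c3 \<le> bubble_mean M e s" "bubble_mean M e s \<le> C3"
      unfolding c3_def C3_def using bubble_mean_bounds[OF that] by auto
    have "(1 - s) * c3 \<ge> 0" using that c3 by simp
    then show "0 \<le> bubble_mean M e s" using 1 by linarith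
  qed
  have s01: "0 \<le> z \<bullet> z \<and> z \<bullet> z \<le> 1" if "norm z < 1" for z :: 'a
    using that by (simp add: dot_square_norm abs_square_le_1)
  define Vol where "Vol = measure lborel (ball (0::'a) 1)"
  \<comment> \<open>A lower bound for the mass of the averaging weight, valid for all e: on the half
    ball 1 - s \<ge> 3/4.\<close>
  define k where "k = 3 / 4 * c3 * measure lborel (ball (0::'a) (1/2))"
  have k: "k > 0" unfolding k_def using c3 content_ball_pos[of "1/2" "0::'a"] by simp
  have mean_int: "k \<le> ?I (\<lambda>z. bubble_mean M e (z \<bullet> z))" "?I (\<lambda>z. bubble_mean M e (z \<bullet> z)) \<le> C3 * Vol"
    if e: "0 < e" "e \<le> 1" for e
  proof -
    have S: "set_integrable lborel (ball 0 1) (\<lambda>z::'a. bubble_mean M e (z \<bullet> z))"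
      by (intro set_integrable_continuous_ball continuous_on_bubble_mean)
    show "k \<le> ?I (\<lambda>z. bubble_mean M e (z \<bullet> z))" unfolding k_def
    proof (rule set_integral_pos_const[OF S])
      show "bubble_mean M e (z \<bullet> z) \<ge> 0" if "norm z < 1" for z :: 'a
        using mean(3)[OF e] s01[OF that] by auto
      fix z :: 'a assume z: "norm z < 1/2"
      then have "norm z * norm z \<le> 1/2 * (1/2)" by (intro mult_mono) auto
      then have "z \<bullet> z \<le> 1/4" by (simp add: dot_square_norm power2_eq_square)
      then have "3/4 * c3 \<le> (1 - z \<bullet> z) * c3" using c3 by (intro mult_right_mono) auto
      then show "3/4 * c3 \<le> bubble_mean M e (z \<bullet> z)" using mean(1)[OF e, of "z \<bullet> z"] s01[of z] z by auto
    qed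
    have "?I (\<lambda>z. bubble_mean M e (z \<bullet> z)) \<le> ?I (\<lambda>z. C3)"
      by (rule set_integral_mono_ball[OF S])
         (use mean(2)[OF e] s01 in \<open>auto intro!: set_integrable_continuous_ball\<close>)
    then show "?I (\<lambda>z. bubble_mean M e (z \<bullet> z)) \<le> C3 * Vol"
      by (simp add: set_lebesgue_integral_def Vol_def mult.commute)
  qed
  define B where "B = (C3 / a + C1 + b * C2 + 1) / k"
  have B: "B > 0" using C30 C1 b C2(1) a k unfolding B_def
    by (intro divide_pos_pos add_nonneg_pos add_nonneg_nonneg) auto
  show ?thesis
  proof (rule that[OF B])
    fix v :: "'a \<Rightarrow> real"
    assume v: "smooth v" "\<And>z. norm z < 1 \<Longrightarrow> laplacian v z \<le> 0" and e1: "?I (\<lambda>z. exp (a * v z)) \<le> 1"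
    let ?N = "?I (\<lambda>z. neg_laplacian v z)" and ?P = "?I (\<lambda>z. log_kernel z * \<bar>(neg_laplacian ^^ Suc M) v z\<bar>)"
    have N: "?N \<ge> 0" unfolding set_lebesgue_integral_def
      by (rule Bochner_Integration.integral_nonneg) (use v(2) in \<open>auto simp: neg_laplacian_def indicator_def\<close>)
    have P: "?P \<ge> 0" unfolding set_lebesgue_integral_def
      by (rule Bochner_Integration.integral_nonneg) (auto simp: indicator_def intro!: mult_nonneg_nonneg log_kernel_nonneg)
    \<comment> \<open>Only for positive \<open>v 0\<close> may the mass of the weight be replaced by
      its lower bound k; otherwise the nonnegative right-hand side is enough.\<close>
    show "v 0 \<le> B * (1 + ?N + ?P)"
    proof (cases "v 0 \<le> 0")
      case True
      moreover have "B * (1 + ?N + ?P) \<ge> 0" using B N P by simp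
      ultimately show ?thesis by linarith
    next
      case False
      have "k * v 0 \<le> C3 / a + C1 * ?N + b * C2 * ?P"
      proof (rule field_le_epsilon)
        fix t :: real assume t: "t > 0"
        have ineq: "v 0 * ?I (\<lambda>z. bubble_mean M e (z \<bullet> z)) \<le>
            C3 / a * ?I (\<lambda>z. exp (a * v z)) + C1 * ?N + b * C2 * ?P + ?I (\<lambda>z. bubble M e (z \<bullet> z) * \<bar>v z - v 0\<bar>)"
          "?I (\<lambda>z. bubble M e (z \<bullet> z)) = ?I (\<lambda>z. bubble_mean M e (z \<bullet> z))"
          if e: "0 < e" "e \<le> 1" for e
          by (rule bubble_inequality[OF dim a e v less_imp_le[OF b] newton[OF e] C2(2)[OF e], where ?C3.0=C3],
              (assumption | intro conjI mean[OF e])+)+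
        have GX: "?I (\<lambda>z. bubble M e (z \<bullet> z)) \<le> C3 * Vol" if e: "0 < e" "e \<le> 1" for e
          using ineq(2)[OF e] mean_int(2)[OF e] by (rule ord_eq_le_trans)
        have "C3 * Vol \<ge> 0" using C30 by (simp add: Vol_def)
        then obtain e where e: "0 < e" "e \<le> 1" "?I (\<lambda>z. bubble M e (z \<bullet> z) * \<bar>v z - v 0\<bar>) \<le> t"
          by (rule bubble_concentrates[where M=M, OF smooth_continuous[OF v(1)] _ GX t])
        have "k * v 0 \<le> v 0 * ?I (\<lambda>z. bubble_mean M e (z \<bullet> z))"
          using mean_int(1)[OF e(1,2)] False by (simp add: mult.commute)
        also have "\<dots> \<le> C3 / a * ?I (\<lambda>z. exp (a * v z)) + C1 * ?N + b * C2 * ?P + ?I (\<lambda>z. bubble M e (z \<bullet> z) * \<bar>v z - v 0\<bar>)"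
          by (rule ineq(1)[OF e(1,2)])
        also have "\<dots> \<le> C3 / a + C1 * ?N + b * C2 * ?P + t"
        proof -
          have "C3 / a * ?I (\<lambda>z. exp (a * v z)) \<le> C3 / a * 1"
            using e1 C30 a by (intro mult_left_mono) auto
          then show ?thesis using e(3) by linarith
        qed
        finally show "k * v 0 \<le> C3 / a + C1 * ?N + b * C2 * ?P + t" .
      qed
      also have "\<dots> \<le> (C3 / a + C1 + b * C2 + 1) * (1 + ?N + ?P)"
      proof -
        define X where "X = C3 / a"
        define Y where "Y = b * C2"
        have "X \<ge> 0" "Y \<ge> 0" using C30 a b C2(1) by (auto simp: X_def Y_def)
        then have "X * ?N \<ge> 0" "X * ?P \<ge> 0" "Y * ?N \<ge> 0" "C1 * ?P \<ge> 0" using N P C1 by auto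
        then have "X + C1 * ?N + Y * ?P \<le> (X + C1 + Y + 1) * (1 + ?N + ?P)"
          using N P C1 \<open>Y \<ge> 0\<close> by (simp add: algebra_simps)
        then show ?thesis unfolding X_def Y_def .
      qed
      finally have "v 0 \<le> (C3 / a + C1 + b * C2 + 1) * (1 + ?N + ?P) / k"
        using k by (simp add: pos_le_divide_eq mult.commute)
      then show ?thesis unfolding B_def by simp
    qed
  qed
qed

section \<open>Energy and mean value estimates\<close>

text \<open>The squared positive part is C^1, the regularity that a single integration by parts
  demands of a cutoff.\<close>

lemma DERIV_pos_part_sq: "((\<lambda>x::real. (max 0 x)\<^sup>2) has_real_derivative 2 * max 0 x) (at x)"
proof -
  consider "x < 0" | "x > 0" | "x = 0" by linarith
  then show ?thesis
  proof cases
    case 1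
    then have "eventually (\<lambda>y. y \<in> {..<0}) (nhds x)" by (intro eventually_nhds_in_open) auto
    then have "eventually (\<lambda>y. (max 0 y)\<^sup>2 = 0) (nhds x)" by eventually_elim auto
    then show ?thesis using 1 DERIV_cong_ev[of x x "\<lambda>y. (max 0 y)\<^sup>2" "\<lambda>_. 0" 0] by simp
  next
    case 2
    then have "eventually (\<lambda>y. y \<in> {0<..}) (nhds x)" by (intro eventually_nhds_in_open) auto
    then have "eventually (\<lambda>y. (max 0 y)\<^sup>2 = y\<^sup>2) (nhds x)" by eventually_elim auto
    moreover have "((\<lambda>y. y\<^sup>2) has_real_derivative 2 * x) (at x)" by (auto intro!: derivative_eq_intros)
    ultimately show ?thesis using 2 DERIV_cong_ev[of x x "\<lambda>y. (max 0 y)\<^sup>2" "\<lambda>y. y\<^sup>2" "2 * x"] by simp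
  next
    case 3
    have "((\<lambda>h::real. max 0 h) \<longlongrightarrow> max 0 0) (at 0)" by (intro tendsto_intros)
    moreover have "(max 0 h)\<^sup>2 / h = max 0 h" if "h \<noteq> 0" for h :: real
      using that by (auto simp: max_def power2_eq_square)
    ultimately have "((\<lambda>h::real. (max 0 h)\<^sup>2 / h) \<longlongrightarrow> 0) (at 0)"
      by (subst tendsto_cong[where g="\<lambda>h. max 0 h"]) (auto simp: eventually_at_filter)
    then show ?thesis using 3 by (simp add: DERIV_def)
  qed
qed

lemma DERIV_pos_part_sq_affine:
  "((\<lambda>s::real. (max 0 (a - b * s))\<^sup>2) has_real_derivative - 2 * b * max 0 (a - b * s)) (at s)"
proof -
  have "((\<lambda>s. a - b * s) has_real_derivative - b) (at s)" by (auto intro!: derivative_eq_intros)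
  from DERIV_chain2[OF DERIV_pos_part_sq this] show ?thesis by (simp add: mult_ac)
qed

text \<open>Caccioppoli argument: test with t^2, where t is the positive part of 4 - |z|^2,
  integrate by parts once, and absorb the gradient term into M |grad v|^2 by Young's
  inequality.\<close>

lemma energy_bound:
  assumes M: "M \<ge> 1"
  obtains C where "C > 0"
    "\<And>(v::'a::euclidean_space \<Rightarrow> real) A. C_k 2 v \<Longrightarrow> A \<ge> 0 \<Longrightarrow>
      (\<And>z. norm z < 2 \<Longrightarrow> real M * (norm (gradient v z))\<^sup>2 + A * exp (2 * v z) \<le> neg_laplacian v z) \<Longrightarrow>
      (LINT z:ball 0 1|lborel. neg_laplacian v z) \<le> C \<and> A * (LINT z:ball 0 1|lborel. exp (2 * v z)) \<le> C"
proof -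
  \<comment> \<open>The constant 32 of Young's inequality below, doubled when half of the left-hand
    side is absorbed.\<close>
  define C where "C = 64 * measure lborel (ball (0::'a) 2)"
  have C: "C > 0" unfolding C_def using content_ball_pos[of 2 "0::'a"] by simp
  show ?thesis
  proof (rule that[OF C])
    fix v :: "'a \<Rightarrow> real" and A :: real
    assume v: "C_k 2 v" and A: "A \<ge> 0"
      and ineq: "\<And>z. norm z < 2 \<Longrightarrow> real M * (norm (gradient v z))\<^sup>2 + A * exp (2 * v z) \<le> neg_laplacian v z"
    note v2 = C_k_2D[OF v[unfolded numeral_2_eq_2]]
    define t where "t z = max 0 (4 - z \<bullet> z)" for z :: 'a
    define L where "L = neg_laplacian v"
    have cL: "continuous_on B L" for B
      unfolding L_def neg_laplacian_def[abs_def] using continuous_on_subset[OF v2(6)] by (auto intro: continuous_intros)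
    have cv: "continuous_on B v" for B using v2(3) continuous_on_subset by blast
    have cg: "continuous_on B (gradient v)" for B using v2(7) continuous_on_subset by blast
    have ct: "continuous_on B t" for B unfolding t_def[abs_def] by (intro continuous_intros)
    have D: "((\<lambda>s. (max 0 (4 - s))\<^sup>2) has_real_derivative - 2 * max 0 (4 - s)) (at s)" for s :: real
      using DERIV_pos_part_sq_affine[of 4 1 s] by simp
    have green: "(LINT z|lborel. (t z)\<^sup>2 * laplacian v z) = - (LINT z|lborel. 2 * (- 2 * t z) * (z \<bullet> gradient v z))"
        "integrable lborel (\<lambda>z. (t z)\<^sup>2 * laplacian v z)"
        "integrable lborel (\<lambda>z. 2 * (- 2 * t z) * (z \<bullet> gradient v z))"
      unfolding t_def
      by (rule green_radial_gradient[of "\<lambda>s. (max 0 (4 - s))\<^sup>2" "\<lambda>s. - 2 * max 0 (4 - s)" 4 v, OF D _ _ _ v];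
          auto intro!: continuous_intros)+
    have t0: "t z = 0" if "norm z \<ge> 2" for z
      using inner_self_ge_of_norm[of 2 z] that by (simp add: t_def)
    define J where "J z = (t z)\<^sup>2 * L z + (t z)\<^sup>2 * (A * exp (2 * v z))" for z
    have iJ: "integrable lborel J"
      by (rule integrable_continuous_compact_support[of _ 2])
         (use t0 in \<open>auto simp: J_def[abs_def] intro!: continuous_intros cL cv ct\<close>)
    have iL: "integrable lborel (\<lambda>z. (t z)\<^sup>2 * L z)"
      by (rule integrable_continuous_compact_support[of _ 2])
         (use t0 in \<open>auto intro!: continuous_intros cL ct\<close>)
    have iE: "integrable lborel (\<lambda>z. (t z)\<^sup>2 * (A * exp (2 * v z)))"
      by (rule integrable_continuous_compact_support[of _ 2])
         (use t0 in \<open>auto intro!: continuous_intros cv ct\<close>)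
    have i32: "integrable lborel (\<lambda>z::'a. 32 * indicator (ball 0 2) z :: real)"
      using set_integrable_continuous_ball[OF continuous_on_const, of 0 2 "32::real"]
      unfolding set_integrable_def by (simp add: mult.commute)
    have point: "2 * (- 2 * t z) * (z \<bullet> gradient v z) \<le> (1/2) * ((t z)\<^sup>2 * L z) - (1/2) * ((t z)\<^sup>2 * (A * exp (2 * v z))) + 32 * indicator (ball 0 2) z" for z
    proof (cases "norm z < 2")
      case True
      define g where "g = norm (gradient v z)"
      have t: "t z \<ge> 0" by (simp add: t_def)
      have "\<bar>z \<bullet> gradient v z\<bar> \<le> norm z * g" unfolding g_def by (rule Cauchy_Schwarz_ineq2)
      also have "\<dots> \<le> 2 * g" using True by (intro mult_right_mono) (auto simp: g_def)
      finally have "- (z \<bullet> gradient v z) \<le> 2 * g" by linarith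
      then have "4 * t z * (- (z \<bullet> gradient v z)) \<le> 4 * t z * (2 * g)" using t by (intro mult_left_mono) auto
      \<comment> \<open>Young's inequality in the form (t g - 8)^2 \<ge> 0.\<close>
      also have "\<dots> \<le> (1/2) * (t z * g)\<^sup>2 + 32"
        using zero_le_power2[of "t z * g - 8"] by (simp add: power2_eq_square algebra_simps)
      also have "(1/2) * (t z * g)\<^sup>2 \<le> (1/2) * ((t z)\<^sup>2 * (real M * g\<^sup>2))"
      proof -
        have "1 * g\<^sup>2 \<le> real M * g\<^sup>2" using M by (intro mult_right_mono) auto
        then have "(t z)\<^sup>2 * g\<^sup>2 \<le> (t z)\<^sup>2 * (real M * g\<^sup>2)" by (intro mult_left_mono) auto
        then show ?thesis by (simp add: power_mult_distrib)
      qed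
      also have "(1/2) * ((t z)\<^sup>2 * (real M * g\<^sup>2)) \<le> (1/2) * ((t z)\<^sup>2 * (L z - A * exp (2 * v z)))"
        using ineq[OF True] unfolding g_def L_def by (intro mult_left_mono) auto
      finally show ?thesis using True by (simp add: algebra_simps)
    next
      case False
      then show ?thesis using t0[of z] by simp
    qed
    have "(LINT z|lborel. (t z)\<^sup>2 * L z) = - (LINT z|lborel. (t z)\<^sup>2 * laplacian v z)"
      unfolding L_def neg_laplacian_def by simp
    also have "\<dots> = (LINT z|lborel. 2 * (- 2 * t z) * (z \<bullet> gradient v z))" using green(1) by simp
    also have "\<dots> \<le> (LINT z|lborel. (1/2) * ((t z)\<^sup>2 * L z) - (1/2) * ((t z)\<^sup>2 * (A * exp (2 * v z))) + 32 * indicator (ball 0 2) z)"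
      by (rule integral_mono[OF green(3) _ point])
         (intro Bochner_Integration.integrable_add Bochner_Integration.integrable_diff integrable_mult_right iL iE i32)
    also have "\<dots> = (1/2) * (LINT z|lborel. (t z)\<^sup>2 * L z) - (1/2) * (LINT z|lborel. (t z)\<^sup>2 * (A * exp (2 * v z))) + (LINT z|lborel. 32 * indicator (ball (0::'a) 2) z)"
      using iL iE i32 by simp
    also have "(LINT z|lborel. 32 * indicator (ball (0::'a) 2) z) = C / 2" by (simp add: C_def)
    finally have "(LINT z|lborel. (t z)\<^sup>2 * L z) + (LINT z|lborel. (t z)\<^sup>2 * (A * exp (2 * v z))) \<le> C" by simp
    then have JC: "(LINT z|lborel. J z) \<le> C" unfolding J_def using iL iE by simp
    have J0: "J z \<ge> 0" for z
    proof (cases "norm z < 2")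
      case True
      have "0 \<le> real M * (norm (gradient v z))\<^sup>2 + A * exp (2 * v z)" using A by simp
      then have "L z \<ge> 0" using ineq[OF True] unfolding L_def by linarith
      then show ?thesis using A by (simp add: J_def)
    next
      case False
      then show ?thesis using t0[of z] by (simp add: J_def)
    qed
    have J1: "L z \<le> J z \<and> A * exp (2 * v z) \<le> J z" if z: "norm z < 1" for z
    proof -
      have "z \<bullet> z \<le> 1" using z by (simp add: dot_square_norm abs_square_le_1)
      then have "1\<^sup>2 \<le> (t z)\<^sup>2" by (intro power_mono) (auto simp: t_def)
      then have t1: "1 \<le> (t z)\<^sup>2" by simp
      have E: "A * exp (2 * v z) \<ge> 0" using A by simp
      have "0 \<le> real M * (norm (gradient v z))\<^sup>2" by simp
      then have L: "L z \<ge> 0" using ineq[of z] z E unfolding L_def by linarith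
      have "1 * L z \<le> (t z)\<^sup>2 * L z" "1 * (A * exp (2 * v z)) \<le> (t z)\<^sup>2 * (A * exp (2 * v z))"
        by (rule mult_right_mono[OF t1 L], rule mult_right_mono[OF t1 E])
      then show ?thesis unfolding J_def using L E by auto
    qed
    have restrict: "(LINT z:ball 0 1|lborel. f z) \<le> C" if "continuous_on (cball 0 1) f" "\<And>z. norm z < 1 \<Longrightarrow> f z \<le> J z" for f
    proof -
      have "(LINT z:ball 0 1|lborel. f z) \<le> (LINT z|lborel. J z)"
        unfolding set_lebesgue_integral_def
        by (rule integral_mono[OF set_integrable_continuous_ball[OF that(1), unfolded set_integrable_def] iJ])
           (use that(2) J0 in \<open>auto simp: indicator_def\<close>)
      then show ?thesis using JC by simp
    qed
    have "(LINT z:ball 0 1|lborel. L z) \<le> C"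
      by (rule restrict[OF cL]) (use J1 in blast)
    moreover have "(LINT z:ball 0 1|lborel. A * exp (2 * v z)) \<le> C"
      by (rule restrict) (use J1 in \<open>auto intro!: continuous_intros cv\<close>)
    ultimately show "(LINT z:ball 0 1|lborel. neg_laplacian v z) \<le> C \<and> A * (LINT z:ball 0 1|lborel. exp (2 * v z)) \<le> C"
      unfolding L_def by simp
  qed
qed

section \<open>Means of nonnegative functions that are superharmonic near infinity\<close>

text \<open>
  The profile \<open>F\<close> below is a truncated fundamental solution: \<open>F' = - P \<theta>\<^sup>2\<close>, where \<open>P s = s powr (- m)\<close> for \<open>s \<ge> 1\<close> and
  \<open>\<theta>\<close> cuts off at \<open>|z|\<^sup>2 = S\<close>.  Its Laplacian is of order \<open>S powr (- m)\<close> up to radius \<open>sqrt (S / 2)\<close>.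
\<close>

lemma truncated_newton_profile:
  assumes m: "m \<ge> 2" and S: "S \<ge> 2"
  obtains F F' F'' where
    "\<And>s. s \<ge> 0 \<Longrightarrow> (F has_real_derivative F' s) (at s)"
    "\<And>s. s \<ge> 0 \<Longrightarrow> (F' has_real_derivative F'' s) (at s)"
    "continuous_on {0..} F'" "continuous_on {0..} F''"
    "\<And>s. s \<ge> S \<Longrightarrow> F s = (0::real)"
    "\<And>s. s \<ge> 0 \<Longrightarrow> 0 \<le> F s \<and> F s \<le> 4 * (1 + real m)"
    "\<And>s. 0 \<le> s \<Longrightarrow> s < 1 \<Longrightarrow> - 4 * (real m + (real m)\<^sup>2) \<le> 4 * s * F'' s + 4 * real m * F' s"
    "\<And>s. 1 \<le> s \<Longrightarrow> 0 \<le> 4 * s * F'' s + 4 * real m * F' s"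
    "\<And>s. 1 \<le> s \<Longrightarrow> s \<le> S / 2 \<Longrightarrow> 4 * inverse S ^ m \<le> 4 * s * F'' s + 4 * real m * F' s"
proof -
  \<comment> \<open>Continuing s^(-m) linearly below s = 1, with matching value 1 and slope -m,
    keeps P bounded on [0, 1] and of class C^1.\<close>
  define P where "P s = (if s < 1 then 1 + real m * (1 - s) else inverse s ^ m)" for s :: real
  define P' where "P' s = (if s < 1 then - real m else - real m * inverse s ^ Suc m)" for s :: real
  define \<theta> where "\<theta> s = max 0 (1 - inverse S * s)" for s :: real
  define g where "g s = P s * (\<theta> s)\<^sup>2" for s
  have invd: "((\<lambda>s. inverse s ^ m) has_real_derivative - real m * inverse s ^ Suc m) (at s)" if "s \<ge> 1" for s :: real
  proof -
    obtain m' where m': "m = Suc m'" using m by (cases m) auto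
    have "(inverse has_real_derivative - (inverse s * inverse s)) (at s)"
      using that by (auto intro!: derivative_eq_intros)
    from DERIV_power_Suc[OF this, of m'] show ?thesis unfolding m'
      by (rule DERIV_cong) (simp add: algebra_simps)
  qed
  have dP: "(P has_real_derivative P' s) (at s)" for s
  proof -
    have lin: "((\<lambda>s. 1 + real m * (1 - s)) has_real_derivative - real m) (at s within A)" for A
      by (auto intro!: derivative_eq_intros)
    have inv: "((\<lambda>s. inverse s ^ m) has_real_derivative - real m * inverse s ^ Suc m) (at s within A)" if "s \<ge> 1" for A
      using invd[OF that] by (rule has_field_derivative_at_within)
    have "((\<lambda>s. if s \<in> {..<1} then 1 + real m * (1 - s) else inverse s ^ m) has_vector_derivative
      (if s \<in> {..<1} then - real m else - real m * inverse s ^ Suc m)) (at s within UNIV)"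
      by (rule has_vector_derivative_If_within_closures[where T="{1..}"])
         (use lin inv in \<open>auto simp: has_real_derivative_iff_has_vector_derivative\<close>)
    then show ?thesis unfolding P_def[abs_def] P'_def
      by (simp add: has_real_derivative_iff_has_vector_derivative)
  qed
  have cP: "continuous_on A P" for A
    using dP by (intro continuous_at_imp_continuous_on) (auto intro: DERIV_isCont)
  have cP': "continuous_on UNIV P'"
  proof -
    have "continuous_on UNIV (\<lambda>s::real. - real m * inverse (max 1 s) ^ Suc m)"
      by (intro continuous_intros) auto
    moreover have "(\<lambda>s. - real m * inverse (max 1 s) ^ Suc m) = P'"
      by (auto simp: P'_def fun_eq_iff max_def)
    ultimately show ?thesis by metis
  qed
  have c\<theta>: "continuous_on A \<theta>" for A unfolding \<theta>_def[abs_def] by (intro continuous_intros)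
  have cg: "continuous_on A g" for A unfolding g_def[abs_def] by (intro continuous_intros cP c\<theta>)
  have \<theta>0: "\<theta> s \<ge> 0" for s by (simp add: \<theta>_def)
  have \<theta>1: "\<theta> s \<le> 1" if "s \<ge> 0" for s using that S by (simp add: \<theta>_def)
  have \<theta>S: "\<theta> s = 0" if "s \<ge> S" for s using that S by (simp add: \<theta>_def field_simps)
  have P0: "P s \<ge> 0" for s by (auto simp: P_def)
  have g0: "g s \<ge> 0" for s using P0 by (simp add: g_def)
  define G where "G x = integral {-1..x} g" for x
  have dG: "(G has_real_derivative g s) (at s)" if "s \<ge> 0" for s
  proof -
    have "(G has_real_derivative g s) (at s within {-1..s+1})"
      unfolding G_def by (rule integral_has_real_derivative[OF cg]) (use that in auto)
    moreover have "at s within {-1..s+1} = at s"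
      by (rule at_within_interior) (use that in auto)
    ultimately show ?thesis by simp
  qed
  define F where "F s = G S - G s" for s
  have dF: "(F has_real_derivative - g s) (at s)" if "s \<ge> 0" for s
    unfolding F_def[abs_def] using DERIV_diff[OF DERIV_const dG[OF that]] by simp
  have FS: "F s = 0" if "s \<ge> S" for s
  proof -
    have "g integrable_on {-1..s}" by (intro integrable_continuous_interval cg)
    then have "G S + integral {S..s} g = G s"
      unfolding G_def using that S by (intro Henstock_Kurzweil_Integration.integral_combine) auto
    moreover have "integral {S..s} g = integral {S..s} (\<lambda>_. 0)"
      by (rule integral_cong) (use \<theta>S in \<open>auto simp: g_def\<close>)
    ultimately show ?thesis by (simp add: F_def)
  qed
  have Fnn: "F s \<ge> 0" if "s \<ge> 0" for s
  proof (cases "s \<le> S")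
    case True
    have "F S \<le> F s"
      by (rule DERIV_nonpos_imp_nonincreasing[OF True]) (use dF g0 that in \<open>meson neg_le_0_iff_le order_trans\<close>)
    then show ?thesis using FS by simp
  qed (use FS in auto)
  \<comment> \<open>A majorant with an explicit primitive, which bounds F independently of S. The
    decay s^(-2) is where m \<ge> 2 enters.\<close>
  have Pb: "P s \<le> 4 * (1 + real m) / (1 + s)\<^sup>2" if "s \<ge> 0" for s
  proof (cases "s < 1")
    case True
    have "(1 + s)\<^sup>2 \<le> 2\<^sup>2" using True that by (intro power_mono) auto
    then have a: "(1 + s)\<^sup>2 \<le> 4" by simp
    have b: "P s \<le> 1 + real m" using True that by (simp add: P_def mult_left_le)
    have "P s * (1 + s)\<^sup>2 \<le> (1 + real m) * 4" using a b P0 by (intro mult_mono) auto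
    then show ?thesis using that by (simp add: pos_le_divide_eq)
  next
    case False
    have "inverse s ^ m \<le> inverse s ^ 2" using False m by (intro power_decreasing) (auto simp: field_simps)
    moreover have "(1 + s)\<^sup>2 \<le> (2 * s)\<^sup>2" using False by (intro power_mono) auto
    ultimately have "P s * (1 + s)\<^sup>2 \<le> inverse s ^ 2 * (2 * s)\<^sup>2" using False
      by (intro mult_mono) (auto simp: P_def)
    also have "\<dots> = 4" using False by (simp add: power_mult_distrib field_simps)
    also have "\<dots> \<le> 4 * (1 + real m)" by simp
    finally show ?thesis using that by (simp add: pos_le_divide_eq)
  qed
  have Fb: "F s \<le> 4 * (1 + real m)" if "s \<ge> 0" for s
  proof (cases "s \<le> S")
    case True
    define H where "H s = F s - 4 * (1 + real m) / (1 + s)" for s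
    have "H s \<le> H S"
    proof (rule DERIV_nonneg_imp_nondecreasing[OF True])
      fix x assume x: "s \<le> x" "x \<le> S"
      then have x0: "x \<ge> 0" using that by simp
      have "((\<lambda>s. 4 * (1 + real m) / (1 + s)) has_real_derivative - (4 * (1 + real m) / (1 + x)\<^sup>2)) (at x)"
        using x0 by (auto intro!: derivative_eq_intros simp: power2_eq_square minus_divide_left)
      then have "(H has_real_derivative (- g x - - (4 * (1 + real m) / (1 + x)\<^sup>2))) (at x)"
        unfolding H_def[abs_def] by (rule DERIV_diff[OF dF[OF x0]])
      moreover have "g x \<le> P x" using \<theta>0[of x] \<theta>1[OF x0] P0[of x]
        by (simp add: g_def mult_left_le power_le_one)
      then have "- g x - - (4 * (1 + real m) / (1 + x)\<^sup>2) \<ge> 0" using Pb[OF x0] by simp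
      ultimately show "\<exists>y. (H has_real_derivative y) (at x) \<and> 0 \<le> y" by blast
    qed
    also have "H S \<le> 0" using FS[of S] S by (simp add: H_def)
    finally have "F s \<le> 4 * (1 + real m) / (1 + s)" by (simp add: H_def)
    also have "\<dots> \<le> 4 * (1 + real m)" using that by (simp add: field_simps)
    finally show ?thesis .
  qed (use FS in auto)
  define g' where "g' s = P s * (- 2 * inverse S * \<theta> s) + P' s * (\<theta> s)\<^sup>2" for s
  have dg: "(g has_real_derivative g' s) (at s)" for s
    unfolding g_def[abs_def] g'_def \<theta>_def[abs_def]
    using DERIV_mult'[OF dP DERIV_pos_part_sq_affine[of 1 "inverse S" s]] by simp
  have cg': "continuous_on UNIV g'" unfolding g'_def[abs_def] by (intro continuous_intros cP cP' c\<theta>)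
  \<comment> \<open>The first bracket vanishes for s \<ge> 1 because s^(-m) is homogeneous; what
    remains comes from the cutoff and is nonnegative.\<close>
  have DF: "4 * s * (- g' s) + 4 * real m * (- g s) = - 4 * (\<theta> s)\<^sup>2 * (s * P' s + real m * P s) + 8 * (s * P s) * (inverse S * \<theta> s)" for s
    by (simp add: g'_def g_def algebra_simps)
  have far: "s * P' s + real m * P s = 0" "s * P s = inverse s ^ (m - 1)" if "s \<ge> 1" for s
  proof -
    have "s * inverse s ^ Suc m = inverse s ^ m" using that by simp
    then show "s * P' s + real m * P s = 0" using that by (simp add: P_def P'_def)
    have "m = Suc (m - 1)" using m by simp
    then have "inverse s ^ m = inverse s * inverse s ^ (m - 1)" by (metis power_Suc)
    then show "s * P s = inverse s ^ (m - 1)" using that by (simp add: P_def)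
  qed
  show ?thesis
  proof (rule that[of F "\<lambda>s. - g s" "\<lambda>s. - g' s"])
    show "\<And>s. 0 \<le> s \<Longrightarrow> ((\<lambda>s. - g s) has_real_derivative - g' s) (at s)" using DERIV_minus[OF dg] .
    show "continuous_on {0..} (\<lambda>s. - g s)" by (intro continuous_intros cg)
    show "continuous_on {0..} (\<lambda>s. - g' s)" using cg' continuous_on_subset by (intro continuous_intros) blast
    show "- 4 * (real m + (real m)\<^sup>2) \<le> 4 * s * - g' s + 4 * real m * - g s" if s: "0 \<le> s" "s < 1" for s
    proof -
      have eq: "s * P' s + real m * P s = (real m + (real m)\<^sup>2) * (1 - s)"
        using s by (simp add: P_def P'_def power2_eq_square algebra_simps)
      have "(\<theta> s)\<^sup>2 * ((real m + (real m)\<^sup>2) * (1 - s)) \<le> 1 * ((real m + (real m)\<^sup>2) * 1)"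
        using s \<theta>0[of s] \<theta>1[OF s(1)] by (intro mult_mono) (auto simp: power_le_one)
      moreover have "8 * (s * P s) * (inverse S * \<theta> s) \<ge> 0" using s P0 \<theta>0 S by simp
      ultimately show ?thesis unfolding DF eq by linarith
    qed
    show "0 \<le> 4 * s * - g' s + 4 * real m * - g s" if s: "1 \<le> s" for s
      unfolding DF far(1)[OF s] using s P0 \<theta>0 S by simp
    show "4 * inverse S ^ m \<le> 4 * s * - g' s + 4 * real m * - g s" if s: "1 \<le> s" "s \<le> S / 2" for s
    proof -
      \<comment> \<open>On this range the cutoff is at least 1/2, which lowers the factor 8 to
        4.\<close>
      have th: "\<theta> s \<ge> 1/2" using s S by (simp add: \<theta>_def field_simps)
      have "inverse S \<le> inverse s" using s S by (intro le_imp_inverse_le) auto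
      then have "inverse S ^ (m - 1) \<le> inverse s ^ (m - 1)" using S by (intro power_mono) auto
      then have "8 * inverse S ^ (m - 1) * (inverse S * (1/2)) \<le> 8 * inverse s ^ (m - 1) * (inverse S * \<theta> s)"
        using th S s by (intro mult_mono) auto
      moreover have "inverse S ^ m = inverse S ^ (m - 1) * inverse S"
        using m by (metis Suc_diff_1 less_le_trans pos2 power_Suc2)
      ultimately show ?thesis unfolding DF far[OF s(1)] by simp
    qed
  qed (use dF FS Fnn Fb in auto)
qed

text \<open>The test profile is taken with S = 2 R^2. Since it is nonnegative and w is superharmonic
  outside the ball of radius R0, its integral against \<Delta> w is bounded independently of R. Its
  own Laplacian is at least of order R^(-n) for 1 \<le> |z| < R, and its bounded negative part on
  the unit ball is paid for by the fixed mass of w there.\<close>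

lemma superharmonic_mean_bound:
  fixes w :: "'a::euclidean_space \<Rightarrow> real"
  assumes dim: "DIM('a) = 2 * m" and m: "m \<ge> 2" and w: "C_k 2 w" "\<And>z. w z \<ge> 0"
    and super: "\<And>z. norm z \<ge> R0 \<Longrightarrow> laplacian w z \<le> 0"
  obtains C where "C > 0" "\<And>R. R \<ge> 1 \<Longrightarrow> (LINT z:ball 0 R|lborel. w z) \<le> C * R ^ DIM('a)"
proof -
  note w2 = C_k_2D[OF w(1)[unfolded numeral_2_eq_2]]
  have cw: "continuous_on A w" for A using w2(3) continuous_on_subset by blast
  have cL: "continuous_on A (laplacian w)" for A using w2(6) continuous_on_subset by blast
  define K where "K = 4 * (1 + real m)"
  define D where "D = (LINT z:ball 0 R0|lborel. \<bar>laplacian w z\<bar>)"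
  \<comment> \<open>The first 4 dominates c = 4 S^(-m); the rest offsets the lower bound of the
    profile's Laplacian for s < 1.\<close>
  define c1 where "c1 = 4 + 4 * (real m + (real m)\<^sup>2)"
  define W where "W = (LINT z:ball 0 1|lborel. w z)"
  have W0: "W \<ge> 0" unfolding W_def set_lebesgue_integral_def
    by (rule Bochner_Integration.integral_nonneg) (use w(2) in auto)
  have D0: "D \<ge> 0" unfolding D_def set_lebesgue_integral_def
    by (rule Bochner_Integration.integral_nonneg) auto
  define C where "C = 2 ^ m * (K * D + c1 * W) / 4 + 1"
  have KD: "K * D + c1 * W \<ge> 0" using W0 D0 by (simp add: K_def c1_def)
  have C: "C > 0" unfolding C_def using KD by (intro add_nonneg_pos) auto
  show ?thesis
  proof (rule that[OF C])
    fix R :: real assume R: "R \<ge> 1"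
    define S where "S = 2 * R\<^sup>2"
    have S: "S \<ge> 2" using R by (simp add: S_def)
    obtain F F' F'' where F: 
      "\<And>s. s \<ge> 0 \<Longrightarrow> (F has_real_derivative F' s) (at s)"
      "\<And>s. s \<ge> 0 \<Longrightarrow> (F' has_real_derivative F'' s) (at s)"
      "continuous_on {0..} F'" "continuous_on {0..} F''"
      "\<And>s. s \<ge> S \<Longrightarrow> F s = (0::real)"
      "\<And>s. s \<ge> 0 \<Longrightarrow> 0 \<le> F s \<and> F s \<le> K"
      "\<And>s. 0 \<le> s \<Longrightarrow> s < 1 \<Longrightarrow> - 4 * (real m + (real m)\<^sup>2) \<le> 4 * s * F'' s + 4 * real m * F' s"
      "\<And>s. 1 \<le> s \<Longrightarrow> 0 \<le> 4 * s * F'' s + 4 * real m * F' s"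
      "\<And>s. 1 \<le> s \<Longrightarrow> s \<le> S / 2 \<Longrightarrow> 4 * inverse S ^ m \<le> 4 * s * F'' s + 4 * real m * F' s"
      using truncated_newton_profile[OF m S] unfolding K_def by blast
    define Q where "Q z = 4 * (z \<bullet> z) * F'' (z \<bullet> z) + 2 * real DIM('a) * F' (z \<bullet> z)" for z :: 'a
    have Qeq: "Q z = 4 * (z \<bullet> z) * F'' (z \<bullet> z) + 4 * real m * F' (z \<bullet> z)" for z :: 'a
      by (simp add: Q_def dim)
    have S0: "0 \<le> S" using S by simp
    have green: "(LINT z|lborel. F (z \<bullet> z) * laplacian w z) = (LINT z|lborel. Q z * w z)"
      "integrable lborel (\<lambda>z. Q z * w z)"
      unfolding Q_def by (rule green_radial[OF F(1) F(3) S0 F(5) w(1) F(2) F(4)]; assumption)+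
    have iF: "integrable lborel (\<lambda>z. F (z \<bullet> z) * laplacian w z)"
      by (rule green_radial_gradient(2)[OF F(1) F(3) S0 F(5) w(1)])
    define c where "c = 4 * inverse S ^ m"
    have c: "0 \<le> c" "c \<le> 4" using S power_le_one[of "inverse S" m] by (auto simp: c_def field_simps)
    have iD: "integrable lborel (\<lambda>z. indicator (ball 0 R0) z *\<^sub>R \<bar>laplacian w z\<bar>)"
      using set_integrable_continuous_ball[of 0 R0 "\<lambda>z. \<bar>laplacian w z\<bar>"] cL
      unfolding set_integrable_def by (auto intro: continuous_intros)
    have iw: "integrable lborel (\<lambda>z. indicator (ball 0 r) z *\<^sub>R w z)" for r
      using set_integrable_continuous_ball[OF cw] unfolding set_integrable_def .
    have upper: "(LINT z|lborel. Q z * w z) \<le> K * D"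
    proof -
      have "(LINT z|lborel. F (z \<bullet> z) * laplacian w z) \<le> (LINT z|lborel. K * (indicator (ball 0 R0) z *\<^sub>R \<bar>laplacian w z\<bar>))"
      proof (rule integral_mono[OF iF integrable_mult_right[OF iD]])
        fix z :: 'a
        note Fz = F(6)[of "z \<bullet> z"]
        show "F (z \<bullet> z) * laplacian w z \<le> K * (indicator (ball 0 R0) z *\<^sub>R \<bar>laplacian w z\<bar>)"
        proof (cases "norm z < R0")
          case True
          have "F (z \<bullet> z) * laplacian w z \<le> F (z \<bullet> z) * \<bar>laplacian w z\<bar>" using Fz by (intro mult_left_mono) auto
          also have "\<dots> \<le> K * \<bar>laplacian w z\<bar>" using Fz by (intro mult_right_mono) auto
          finally show ?thesis using True by simp
        next
          case False
          then show ?thesis using super[of z] Fz by (simp add: mult_nonneg_nonpos)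
        qed
      qed
      then show ?thesis unfolding green(1) D_def set_lebesgue_integral_def by simp
    qed
    have "(LINT z|lborel. c * (indicator (ball 0 R) z *\<^sub>R w z)) \<le> (LINT z|lborel. Q z * w z + c1 * (indicator (ball 0 1) z *\<^sub>R w z))"
    proof (rule integral_mono[OF integrable_mult_right[OF iw] Bochner_Integration.integrable_add[OF green(2) integrable_mult_right[OF iw]]])
      fix z :: 'a
      have wz: "w z \<ge> 0" by (rule w(2))
      show "c * (indicator (ball 0 R) z *\<^sub>R w z) \<le> Q z * w z + c1 * (indicator (ball 0 1) z *\<^sub>R w z)"
      proof (cases "norm z < 1")
        case True
        have s: "z \<bullet> z < 1" "0 \<le> z \<bullet> z" using True by (auto simp: dot_square_norm abs_square_less_1)
        have "c \<le> Q z + c1" using F(7)[OF s(2,1)] c unfolding Qeq c1_def by linarith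
        then have "c * w z \<le> (Q z + c1) * w z" using wz by (rule mult_right_mono)
        moreover have "norm z < R" using True R by simp
        ultimately show ?thesis using True by (simp add: algebra_simps)
      next
        case False
        have s: "1 \<le> z \<bullet> z" using inner_self_ge_of_norm[of 1 z] False by simp
        show ?thesis
        proof (cases "norm z < R")
          case True
          have "z \<bullet> z \<le> R\<^sup>2" using True unfolding dot_square_norm by (intro power_mono) auto
          then have "z \<bullet> z \<le> S / 2" by (simp add: S_def)
          then have "c \<le> Q z" using F(9)[OF s] unfolding Qeq c_def by simp
          then show ?thesis using True False wz by (simp add: mult_right_mono)
        next
          case notR: False
          have "Q z \<ge> 0" using F(8)[OF s] unfolding Qeq .
          then show ?thesis using notR False wz by simp
        qed
      qed
    qed
    also have "\<dots> = (LINT z|lborel. Q z * w z) + c1 * W"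
      using green(2) iw unfolding W_def set_lebesgue_integral_def by simp
    also have "\<dots> \<le> K * D + c1 * W" using upper by simp
    finally have "c * (LINT z:ball 0 R|lborel. w z) \<le> K * D + c1 * W"
      unfolding set_lebesgue_integral_def by simp
    then have "(LINT z:ball 0 R|lborel. w z) \<le> (K * D + c1 * W) / c"
      using S by (simp add: c_def pos_le_divide_eq mult.commute)
    also have "\<dots> = 2 ^ m * (K * D + c1 * W) / 4 * R ^ DIM('a)"
      using R by (simp add: c_def S_def dim field_simps power_mult_distrib power_mult[symmetric] flip: power_inverse)
    also have "\<dots> \<le> C * R ^ DIM('a)"
      unfolding C_def using R by (intro mult_right_mono) auto
    finally show "(LINT z:ball 0 R|lborel. w z) \<le> C * R ^ DIM('a)" .
  qed
qed

text \<open>Jensen's inequality through the tangent line exp c (1 + x - c) \<le> exp x at x =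
  \<open>log_kernel z\<close>, integrated against b h. This measure only has mass mu \<le> 1; the
  missing mass 1 - mu acts as an atom at the value 0 and produces the summand 1.\<close>

lemma exp_log_kernel_bound:
  fixes h :: "'a::euclidean_space \<Rightarrow> real"
  assumes dim: "DIM('a) \<ge> 2" and h: "continuous_on UNIV h" "\<And>z. h z \<ge> 0"
    and b: "b \<ge> 0" "b * (LINT z:ball 0 1|lborel. h z) \<le> 1"
  shows "exp (b * (LINT z:ball 0 1|lborel. log_kernel z * h z)) \<le> 1 + b * exp 1 * (LINT z:ball 0 1|lborel. 1 / norm z * h z)"
proof -
  let ?I = "\<lambda>f::'a \<Rightarrow> real. (LINT z:ball 0 1|lborel. f z)"
  define c where "c = b * ?I (\<lambda>z. log_kernel z * h z)"
  define mu where "mu = b * ?I h"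
  have S1: "set_integrable lborel (ball 0 1) (\<lambda>z. log_kernel z * h z)"
    by (rule set_integrable_bound_mult[OF set_integrable_log_kernel[OF dim] h(1)])
  have S2: "set_integrable lborel (ball 0 1) (\<lambda>z. 1 / norm z * h z)"
    by (rule set_integrable_bound_mult[OF set_integrable_inverse_norm[OF dim] h(1)])
  have S3: "set_integrable lborel (ball 0 1) h"
    using h(1) continuous_on_subset by (intro set_integrable_continuous_ball) blast
  have "exp c * ((1 - c) * ?I h + ?I (\<lambda>z. log_kernel z * h z)) = ?I (\<lambda>z. exp c * ((1 - c) * h z + log_kernel z * h z))"
    using S1 S3 by (simp add: set_integral_add)
  also have "\<dots> \<le> ?I (\<lambda>z. exp 1 * (1 / norm z * h z))"
  proof (rule set_integral_mono_ball)
    fix z :: 'a assume z: "z \<noteq> 0" "norm z < 1"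
    have "exp c * (1 + (log_kernel z - c)) \<le> exp c * exp (log_kernel z - c)"
      by (intro mult_left_mono exp_ge_add_one_self) simp
    also have "\<dots> = exp (log_kernel z)" by (simp add: exp_diff)
    also have "\<dots> = exp 1 * (1 / norm z)" using z by (simp add: log_kernel_def exp_add)
    finally have "exp c * (1 + (log_kernel z - c)) * h z \<le> exp 1 * (1 / norm z) * h z"
      using h(2) by (rule mult_right_mono)
    then show "exp c * ((1 - c) * h z + log_kernel z * h z) \<le> exp 1 * (1 / norm z * h z)"
      by (simp add: algebra_simps)
  qed (intro set_integral_add set_integrable_mult_right S1 S2 S3)+
  also have "\<dots> = exp 1 * ?I (\<lambda>z. 1 / norm z * h z)" by (rule set_integral_mult_right)
  finally have "exp c * ((1 - c) * ?I h + ?I (\<lambda>z. log_kernel z * h z)) \<le> exp 1 * ?I (\<lambda>z. 1 / norm z * h z)" .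
  then have "b * (exp c * ((1 - c) * ?I h + ?I (\<lambda>z. log_kernel z * h z))) \<le> b * (exp 1 * ?I (\<lambda>z. 1 / norm z * h z))"
    using b(1) by (rule mult_left_mono)
  then have 1: "exp c * ((1 - c) * mu + c) \<le> b * exp 1 * ?I (\<lambda>z. 1 / norm z * h z)"
    unfolding mu_def c_def by (simp add: algebra_simps)
  have "exp c * (1 - c) \<le> exp c * exp (- c)" using exp_ge_add_one_self[of "- c"] by (intro mult_left_mono) auto
  then have 2: "exp c * (1 - c) \<le> 1" by (simp add: exp_minus)
  have "?I h \<ge> 0" unfolding set_lebesgue_integral_def
    by (rule Bochner_Integration.integral_nonneg) (use h(2) in auto)
  then have mu: "0 \<le> mu" "mu \<le> 1" using b by (auto simp: mu_def)
  have "(1 - mu) * (exp c * (1 - c)) \<le> (1 - mu) * 1" using 2 mu by (intro mult_left_mono) auto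
  then have "exp c - exp c * ((1 - c) * mu + c) \<le> 1" using mu by (simp add: algebra_simps)
  then show ?thesis using 1 unfolding c_def by linarith
qed

section \<open>Rescaling annuli\<close>

lemma nn_integral_translation:
  fixes g :: "'a::euclidean_space \<Rightarrow> ennreal"
  assumes [measurable]: "g \<in> borel_measurable borel"
  shows "(\<integral>\<^sup>+x. g (x + c) \<partial>lborel) = (\<integral>\<^sup>+x. g x \<partial>lborel)"
proof -
  have "(\<integral>\<^sup>+x. g x \<partial>lborel) = (\<integral>\<^sup>+x. g x \<partial>distr lborel borel ((+) c))"
    by (simp add: lborel_distr_plus)
  also have "\<dots> = (\<integral>\<^sup>+x. g (c + x) \<partial>lborel)" by (rule nn_integral_distr) auto
  finally show ?thesis by (simp add: add.commute)
qed

lemma integral_affine: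
  fixes g :: "'a::euclidean_space \<Rightarrow> real"
  assumes [measurable]: "g \<in> borel_measurable borel" and c: "c > 0"
  shows "(LINT x|lborel. g x) = c ^ DIM('a) * (LINT z|lborel. g (t + c *\<^sub>R z))"
proof -
  have "(LINT x|lborel. g x) = (LINT x|density (distr lborel borel (\<lambda>x. t + c *\<^sub>R x)) (\<lambda>_. ennreal (\<bar>c\<bar> ^ DIM('a))). g x)"
    using lborel_affine[of c t] c by simp
  also have "\<dots> = (LINT x|distr lborel borel (\<lambda>x. t + c *\<^sub>R x). \<bar>c\<bar> ^ DIM('a) *\<^sub>R g x)"
    by (rule integral_density) auto
  also have "\<dots> = (LINT z|lborel. \<bar>c\<bar> ^ DIM('a) *\<^sub>R g (t + c *\<^sub>R z))"
    by (rule integral_distr) auto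
  finally show ?thesis using c by simp
qed

lemma set_integral_affine_ball:
  fixes g :: "'a::euclidean_space \<Rightarrow> real"
  assumes g: "g \<in> borel_measurable borel" and c: "c > 0"
  shows "(LINT x:ball t c|lborel. g x) = c ^ DIM('a) * (LINT z:ball 0 1|lborel. g (t + c *\<^sub>R z))"
proof -
  have "(\<lambda>x. indicator (ball t c) x *\<^sub>R g x) \<in> borel_measurable borel"
    using g by (intro borel_measurable_scaleR borel_measurable_indicator) auto
  from integral_affine[OF this c, of t]
  have "(LINT x:ball t c|lborel. g x) = c ^ DIM('a) * (LINT z|lborel. indicator (ball t c) (t + c *\<^sub>R z) *\<^sub>R g (t + c *\<^sub>R z))"
    unfolding set_lebesgue_integral_def .
  also have "(\<lambda>z. indicator (ball t c) (t + c *\<^sub>R z) *\<^sub>R g (t + c *\<^sub>R z)) = (\<lambda>z. indicator (ball 0 1) z *\<^sub>R g (t + c *\<^sub>R z))"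
    using c by (auto simp: indicator_def dist_norm fun_eq_iff)
  finally show ?thesis unfolding set_lebesgue_integral_def .
qed

lemma integrable_tail:
  fixes f :: "'a::euclidean_space \<Rightarrow> real"
  assumes f: "integrable lborel f" and e: "e > 0"
  obtains R where "R > 0" "(LINT y|lborel. indicator {y. norm y \<ge> R} y * \<bar>f y\<bar>) \<le> e"
proof -
  have "(\<lambda>k. LINT y|lborel. indicator {y. norm y \<ge> real k} y * \<bar>f y\<bar>) \<longlonglongrightarrow> (LINT y::'a|lborel. 0)"
  proof (rule integral_dominated_convergence[where w="\<lambda>y. \<bar>f y\<bar>"])
    have [measurable]: "f \<in> borel_measurable lborel" using f by simp
    have m: "{y::'a. norm y \<ge> real k} \<in> sets lborel" for k by simp
    show "(\<lambda>y. indicator {y. norm y \<ge> real k} y * \<bar>f y\<bar>) \<in> borel_measurable lborel" for k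
      using m by measurable
    show "AE y in lborel. (\<lambda>k. indicator {y. norm y \<ge> real k} y * \<bar>f y\<bar>) \<longlonglongrightarrow> 0"
    proof (rule AE_I2)
      fix y :: 'a
      have "eventually (\<lambda>k. real k > norm y) sequentially"
        by (rule eventually_sequentiallyI[of "nat \<lceil>norm y\<rceil> + 1"]) linarith
      then show "(\<lambda>k. indicator {y. norm y \<ge> real k} y * \<bar>f y\<bar>) \<longlonglongrightarrow> 0"
        by (intro tendsto_eventually) (auto elim: eventually_mono)
    qed
  qed (use f in \<open>auto simp: indicator_def\<close>)
  then have "eventually (\<lambda>k. (LINT y|lborel. indicator {y. norm y \<ge> real k} y * \<bar>f y\<bar>) < e) sequentially"
    using e by (intro order_tendstoD(2)) auto
  then obtain k where k: "\<And>j. j \<ge> k \<Longrightarrow> (LINT y|lborel. indicator {y. norm y \<ge> real j} y * \<bar>f y\<bar>) < e"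
    unfolding eventually_sequentially by blast
  show ?thesis by (rule that[of "real (Suc k)"]) (simp, rule less_imp_le, rule k, simp)
qed

text \<open>The constant disappears at the first Laplacian, so at least one is needed. For
  \<open>Suc k\<close> = n/2 the factor is r^n, the Jacobian of the rescaling.\<close>

lemma neg_laplacian_pow_shift:
  fixes u :: "'a::euclidean_space \<Rightarrow> real"
  assumes "smooth u"
  shows "smooth (\<lambda>z. u (x + r *\<^sub>R z) - l)"
    and "(neg_laplacian ^^ Suc k) (\<lambda>z. u (x + r *\<^sub>R z) - l) = (\<lambda>z. r ^ (2 * Suc k) * (neg_laplacian ^^ Suc k) u (x + r *\<^sub>R z))"
proof -
  have s: "smooth (\<lambda>z. u (x + r *\<^sub>R z))" using smooth_affine[OF assms, of 1 x r] by simp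
  then show "smooth (\<lambda>z. u (x + r *\<^sub>R z) - l)"
    using C_k_add[of _ "\<lambda>z. u (x + r *\<^sub>R z)" "\<lambda>_. - l"] C_k_const unfolding smooth_def by force
  have "laplacian (\<lambda>z. u (x + r *\<^sub>R z) + (- l)) = laplacian (\<lambda>z. u (x + r *\<^sub>R z))"
    using s unfolding smooth_def by (intro ext) (simp only: laplacian_add C_k_const laplacian_const add_0_right)
  then have "neg_laplacian (\<lambda>z. u (x + r *\<^sub>R z) - l) = neg_laplacian (\<lambda>z. u (x + r *\<^sub>R z))"
    by (simp add: neg_laplacian_def fun_eq_iff)
  then show "(neg_laplacian ^^ Suc k) (\<lambda>z. u (x + r *\<^sub>R z) - l) = (\<lambda>z. r ^ (2 * Suc k) * (neg_laplacian ^^ Suc k) u (x + r *\<^sub>R z))"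
    using neg_laplacian_pow_affine[OF assms, of "Suc k" 1 x r] unfolding funpow_Suc_right by simp
qed

text \<open>The scale R/4 keeps the ball of rescaled radius 2 about x within R/2 \<le> |y| \<le> 3
  R, where the curvature bound is available and |y|^(-p) is at least (3 R)^(-p).\<close>

lemma scaled_curvature:
  fixes u :: "'a::euclidean_space \<Rightarrow> real"
  assumes u: "smooth u" and p: "p \<ge> 0" and c: "c > 0"
    and curv: "\<And>y. norm y \<ge> R0 \<Longrightarrow> real M * (norm (gradient u y))\<^sup>2 + c * norm y powr (- p) * exp (2 * u y) \<le> neg_laplacian u y"
    and R: "R > 0" "R / 2 \<ge> R0" and x: "R \<le> norm x" "norm x \<le> 2 * R" and z: "norm z < 2"
  defines "v \<equiv> (\<lambda>z. u (x + (R / 4) *\<^sub>R z))"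
  shows "real M * (norm (gradient v z))\<^sup>2 + ((R / 4)\<^sup>2 * c * (3 * R) powr (- p)) * exp (2 * v z) \<le> neg_laplacian v z"
proof -
  let ?y = "x + (R / 4) *\<^sub>R z"
  have n: "norm ((R / 4) *\<^sub>R z) \<le> R / 2" using z R by simp
  have "norm x \<le> norm ?y + norm ((R / 4) *\<^sub>R z)" by (metis add_diff_cancel norm_triangle_ineq4)
  then have lo: "norm ?y \<ge> R / 2" using n x by linarith
  have hi: "norm ?y \<le> 3 * R" using norm_triangle_ineq[of x "(R / 4) *\<^sub>R z"] n x R by linarith
  have u2: "C_k 2 u" using u by (simp add: smooth_def)
  have g: "gradient v z = (R / 4) *\<^sub>R gradient u ?y"
    using gradient_affine[OF u2, of 1 x "R / 4" z] by (simp add: v_def)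
  have l: "neg_laplacian v z = (R / 4)\<^sup>2 * neg_laplacian u ?y"
    using laplacian_affine[OF u2, of 1 x "R / 4" z] by (simp add: v_def neg_laplacian_def)
  have "(3 * R) powr (- p) \<le> norm ?y powr (- p)"
    using lo hi R p by (intro powr_mono2') auto
  then have "c * (3 * R) powr (- p) * exp (2 * u ?y) \<le> c * norm ?y powr (- p) * exp (2 * u ?y)"
    using c by (intro mult_right_mono mult_left_mono) auto
  then have "real M * (norm (gradient u ?y))\<^sup>2 + c * (3 * R) powr (- p) * exp (2 * u ?y) \<le> neg_laplacian u ?y"
    using curv[of ?y] lo R by linarith
  then have "(R / 4)\<^sup>2 * (real M * (norm (gradient u ?y))\<^sup>2 + c * (3 * R) powr (- p) * exp (2 * u ?y)) \<le> (R / 4)\<^sup>2 * neg_laplacian u ?y"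
    by (intro mult_left_mono) auto
  moreover have "(norm (gradient v z))\<^sup>2 = (R / 4)\<^sup>2 * (norm (gradient u ?y))\<^sup>2"
    by (simp only: g norm_scaleR power_mult_distrib power2_abs)
  ultimately show ?thesis unfolding l by (simp add: v_def algebra_simps)
qed

text \<open>The mean hypothesis says that u is, on average and up to a constant, at most (\<sigma> -
  1) ln R, which suggests the volume R^n exp(n (\<sigma> - 1) ln R). The task is to pass from the
  average to points with an error whose exponential is integrable over the annulus.\<close>

lemma annulus_volume_bound:
  fixes u :: "'a::euclidean_space \<Rightarrow> real"
  assumes dim: "DIM('a) = 2 * Suc M" and M: "M \<ge> 1" and u: "smooth u"
    and f: "integrable lborel ((neg_laplacian ^^ Suc M) u)"
    and p: "p \<ge> 0" and c: "c > 0"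
    and curv: "\<And>y. norm y \<ge> R0 \<Longrightarrow> real M * (norm (gradient u y))\<^sup>2 + c * norm y powr (- p) * exp (2 * u y) \<le> neg_laplacian u y"
    and a: "a > 0" and D: "D > 0"
    and mean: "\<And>R x. R \<ge> R1 \<Longrightarrow> R \<le> norm x \<Longrightarrow> norm x \<le> 2 * R \<Longrightarrow>
      (LINT z:ball 0 1|lborel. exp (a * u (x + (R / 4) *\<^sub>R z))) \<le> D * R powr (a * (\<sigma> - 1))"
  obtains C R2 where "C > 0" "R2 \<ge> 1"
    "\<And>R. R \<ge> R2 \<Longrightarrow> conf_volume u (ball 0 (2 * R)) \<le> conf_volume u (ball 0 R) + C * R powr (real DIM('a) * \<sigma>)"
proof -
  let ?n = "real DIM('a)"
  let ?I = "\<lambda>f::'a \<Rightarrow> real. (LINT z:ball 0 1|lborel. f z)"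
  have dim2: "DIM('a) \<ge> 2" using dim by simp
  define F where "F = (neg_laplacian ^^ Suc M) u"
  have F: "integrable lborel F" "continuous_on UNIV F"
    unfolding F_def by (rule f, rule smooth_continuous[OF smooth_neg_laplacian_pow[OF u]])
  have [measurable]: "F \<in> borel_measurable borel" using F(2) by (rule borel_measurable_continuous_onI)
  have cu: "continuous_on UNIV u" using u by (rule smooth_continuous)
  have [measurable]: "u \<in> borel_measurable borel" using cu by (rule borel_measurable_continuous_onI)
  obtain B where B: "B > 0" and point:
    "\<And>v::'a \<Rightarrow> real. smooth v \<Longrightarrow> (\<And>z. norm z < 1 \<Longrightarrow> laplacian v z \<le> 0) \<Longrightarrow> ?I (\<lambda>z. exp (a * v z)) \<le> 1 \<Longrightarrow>
      v 0 \<le> B * (1 + ?I (\<lambda>z. neg_laplacian v z) + ?I (\<lambda>z. log_kernel z * \<bar>(neg_laplacian ^^ Suc M) v z\<bar>))"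
    using pointwise_bound[OF dim M a] by blast
  obtain C0 where C0: "C0 > 0" and energy:
    "\<And>(v::'a \<Rightarrow> real) A. C_k 2 v \<Longrightarrow> A \<ge> 0 \<Longrightarrow>
      (\<And>z. norm z < 2 \<Longrightarrow> real M * (norm (gradient v z))\<^sup>2 + A * exp (2 * v z) \<le> neg_laplacian v z) \<Longrightarrow>
      ?I (\<lambda>z. neg_laplacian v z) \<le> C0 \<and> A * ?I (\<lambda>z. exp (2 * v z)) \<le> C0"
    using energy_bound[OF M] by blast
  \<comment> \<open>The multiple of the logarithmic potential that gets exponentiated: n from e^(n
    u), times the constant of the pointwise bound.\<close>
  define b where "b = ?n * B"
  have b: "b > 0" using B by (simp add: b_def)
  obtain R3 where R3: "R3 > 0" "(LINT y|lborel. indicator {y. norm y \<ge> R3} y * \<bar>F y\<bar>) \<le> 1 / b"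
    using integrable_tail[OF F(1), of "1 / b"] b by auto
  \<comment> \<open>2 R0 places the rescaled balls of radius 2 in the curvature region; 2 R3 keeps
    the unit balls in the tail where F has mass at most 1/b.\<close>
  define R2 where "R2 = max (max 1 R1) (max (2 * R0) (2 * R3))"
  define \<Lambda> where "\<Lambda> = (LINT y|lborel. \<bar>F y\<bar>)"
  have \<Lambda>: "\<Lambda> \<ge> 0" unfolding \<Lambda>_def by (rule Bochner_Integration.integral_nonneg) auto
  define J where "J = ?I (\<lambda>z. 1 / norm z)"
  have J: "J \<ge> 0" unfolding J_def set_lebesgue_integral_def
    by (rule Bochner_Integration.integral_nonneg) auto
  define Vol where "Vol = measure lborel (ball (0::'a) 1)"
  define E where "E = exp (?n * (ln D / a) + ?n * B * (1 + C0))"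
  define C where "C = E * (2 ^ DIM('a) * Vol + b * exp 1 * J * \<Lambda>) + 1"
  have C: "C > 0" using b J \<Lambda> by (auto simp: C_def E_def Vol_def intro!: add_nonneg_pos mult_nonneg_nonneg add_nonneg_nonneg)
  show ?thesis
  proof (rule that[OF C])
    show "R2 \<ge> 1" by (simp add: R2_def)
    fix R assume "R \<ge> R2"
    then have R: "R \<ge> 1" "R \<ge> R1" "R / 2 \<ge> R0" "R / 2 \<ge> R3" by (auto simp: R2_def)
    define r where "r = R / 4"
    have r: "r > 0" using R by (simp add: r_def)
    \<comment> \<open>Chosen so that e^(a l) is the assumed mean bound.\<close>
    define l where "l = ln D / a + (\<sigma> - 1) * ln R"
    \<comment> \<open>Taking values in \<open>ennreal\<close> lets Tonelli exchange the integrals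
      without prior integrability in x.\<close>
    define k where "k x = (\<integral>\<^sup>+z. ennreal (indicator (ball 0 1) z * (1 / norm z) * \<bar>F (x + r *\<^sub>R z)\<bar>) \<partial>lborel)" for x
    have point_x: "ennreal (exp (?n * u x)) \<le> ennreal (exp (?n * l + ?n * B * (1 + C0))) * (1 + ennreal (b * exp 1 * r ^ DIM('a)) * k x)"
      if x: "R \<le> norm x" "norm x \<le> 2 * R" for x
    proof -
      define v0 where "v0 = (\<lambda>z. u (x + r *\<^sub>R z))"
      define v where "v = (\<lambda>z. u (x + r *\<^sub>R z) - l)"
      have sv0: "smooth v0" using smooth_affine[OF u, of 1 x r] by (simp add: v0_def)
      have sv: "smooth v" unfolding v_def by (rule neg_laplacian_pow_shift[OF u])
      have lapv: "neg_laplacian v = neg_laplacian v0"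
        using neg_laplacian_pow_shift(2)[OF u, of 0 x r l] neg_laplacian_pow_shift(2)[OF u, of 0 x r 0]
        by (simp add: v_def v0_def)
      define A where "A = (R / 4)\<^sup>2 * c * (3 * R) powr (- p)"
      have A: "A \<ge> 0" using c by (simp add: A_def)
      have ineq: "real M * (norm (gradient v0 z))\<^sup>2 + A * exp (2 * v0 z) \<le> neg_laplacian v0 z" if "norm z < 2" for z
        unfolding v0_def A_def r_def
        by (rule scaled_curvature[OF u p c curv _ R(3) x that]) (use R in auto)
      have en: "?I (\<lambda>z. neg_laplacian v z) \<le> C0"
        using energy[OF _ A ineq] sv0 unfolding lapv smooth_def by blast
      have lap0: "laplacian v z \<le> 0" if "norm z < 1" for z
      proof -
        have "0 \<le> real M * (norm (gradient v0 z))\<^sup>2 + A * exp (2 * v0 z)" using A by simp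
        also have "\<dots> \<le> neg_laplacian v z" unfolding lapv by (rule ineq) (use that in simp)
        finally show ?thesis by (simp add: neg_laplacian_def)
      qed
      have expl: "exp (a * l) = D * R powr (a * (\<sigma> - 1))"
        using a D R by (simp add: l_def algebra_simps exp_add exp_diff powr_def)
      have e1: "?I (\<lambda>z. exp (a * v z)) \<le> 1"
      proof -
        have "?I (\<lambda>z. exp (a * v z)) = ?I (\<lambda>z. exp (a * u (x + (R / 4) *\<^sub>R z)) / exp (a * l))"
          by (simp add: v_def r_def right_diff_distrib exp_diff)
        also have "\<dots> = ?I (\<lambda>z. exp (a * u (x + (R / 4) *\<^sub>R z))) / exp (a * l)" by simp
        also have "\<dots> \<le> 1" using mean[OF R(2) x] unfolding expl[symmetric] by simp
        finally show ?thesis .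
      qed
      define h where "h z = r ^ DIM('a) * \<bar>F (x + r *\<^sub>R z)\<bar>" for z
      have ch: "continuous_on UNIV h" unfolding h_def[abs_def]
        by (intro continuous_intros continuous_on_compose2[OF F(2)]) auto
      have h0: "h z \<ge> 0" for z using r by (simp add: h_def)
      have hF: "\<bar>(neg_laplacian ^^ Suc M) v z\<bar> = h z" for z
        unfolding v_def neg_laplacian_pow_shift(2)[OF u] h_def F_def dim using r by (simp add: abs_mult)
      have Ih: "b * ?I h \<le> 1"
      proof -
        have "?I h = r ^ DIM('a) * ?I (\<lambda>z. \<bar>F (x + r *\<^sub>R z)\<bar>)" unfolding h_def[abs_def] by simp
        also have "\<dots> = (LINT y:ball x r|lborel. \<bar>F y\<bar>)"
          by (rule set_integral_affine_ball[symmetric]) (use r in auto)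
        also have "\<dots> \<le> (LINT y|lborel. indicator {y. norm y \<ge> R3} y * \<bar>F y\<bar>)"
          unfolding set_lebesgue_integral_def
        proof (rule integral_mono)
          show "integrable lborel (\<lambda>y. indicator (ball x r) y *\<^sub>R \<bar>F y\<bar>)"
            by (rule integrable_mult_indicator) (use F in auto)
          have "integrable lborel (\<lambda>y. indicator {y. norm y \<ge> R3} y *\<^sub>R \<bar>F y\<bar>)"
            by (rule integrable_mult_indicator) (use F in auto)
          then show "integrable lborel (\<lambda>y. indicator {y. norm y \<ge> R3} y * \<bar>F y\<bar>)" by simp
          fix y
          show "indicator (ball x r) y *\<^sub>R \<bar>F y\<bar> \<le> indicator {y. norm y \<ge> R3} y * \<bar>F y\<bar>"
          proof (cases "y \<in> ball x r")
            case True
            then have "norm (x - y) < R / 4" by (simp add: dist_norm r_def)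
            then have "norm y \<ge> R3" using norm_triangle_ineq2[of x y] x R by linarith
            then show ?thesis by (simp add: indicator_def)
          qed (simp add: indicator_def)
        qed
        finally have "?I h \<le> 1 / b" using R3 by linarith
        then show ?thesis using b by (simp add: field_simps)
      qed
      have "v 0 \<le> B * (1 + ?I (\<lambda>z. neg_laplacian v z) + ?I (\<lambda>z. log_kernel z * h z))"
        using point[OF sv lap0 e1] unfolding hF by simp
      also have "\<dots> \<le> B * (1 + C0 + ?I (\<lambda>z. log_kernel z * h z))"
        using en B by (intro mult_left_mono) auto
      finally have "u x \<le> l + B * (1 + C0 + ?I (\<lambda>z. log_kernel z * h z))" by (simp add: v_def)
      then have "?n * u x \<le> ?n * (l + B * (1 + C0 + ?I (\<lambda>z. log_kernel z * h z)))" by (intro mult_left_mono) auto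
      also have "\<dots> = (?n * l + ?n * B * (1 + C0)) + b * ?I (\<lambda>z. log_kernel z * h z)" by (simp add: b_def algebra_simps)
      finally have "exp (?n * u x) \<le> exp (?n * l + ?n * B * (1 + C0)) * exp (b * ?I (\<lambda>z. log_kernel z * h z))"
        by (simp add: exp_add[symmetric])
      also have "\<dots> \<le> exp (?n * l + ?n * B * (1 + C0)) * (1 + b * exp 1 * ?I (\<lambda>z. 1 / norm z * h z))"
        by (intro mult_left_mono exp_log_kernel_bound[OF dim2 ch h0 less_imp_le[OF b] Ih]) simp
      also have "?I (\<lambda>z. 1 / norm z * h z) = r ^ DIM('a) * ?I (\<lambda>z. 1 / norm z * \<bar>F (x + r *\<^sub>R z)\<bar>)"
      proof -
        have "(\<lambda>z. 1 / norm z * h z) = (\<lambda>z. r ^ DIM('a) * (1 / norm z * \<bar>F (x + r *\<^sub>R z)\<bar>))"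
          by (simp add: h_def fun_eq_iff mult_ac)
        then show ?thesis by (simp only: set_integral_mult_right)
      qed
      finally have le: "exp (?n * u x) \<le> exp (?n * l + ?n * B * (1 + C0)) * (1 + b * exp 1 * (r ^ DIM('a) * ?I (\<lambda>z. 1 / norm z * \<bar>F (x + r *\<^sub>R z)\<bar>)))" .
      have kx: "ennreal (?I (\<lambda>z. 1 / norm z * \<bar>F (x + r *\<^sub>R z)\<bar>)) = k x"
      proof -
        have cF: "continuous_on UNIV (\<lambda>z. \<bar>F (x + r *\<^sub>R z)\<bar>)"
          by (intro continuous_intros continuous_on_compose2[OF F(2)]) auto
        have "integrable lborel (\<lambda>z. indicator (ball 0 1) z *\<^sub>R (1 / norm z * \<bar>F (x + r *\<^sub>R z)\<bar>))"
          using set_integrable_bound_mult[OF set_integrable_inverse_norm[OF dim2] cF] unfolding set_integrable_def .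
        from nn_integral_eq_integral[OF this]
        show ?thesis unfolding k_def set_lebesgue_integral_def by (simp add: mult.assoc)
      qed
      define Y where "Y = ?I (\<lambda>z. 1 / norm z * \<bar>F (x + r *\<^sub>R z)\<bar>)"
      have Y: "Y \<ge> 0" unfolding Y_def
        unfolding set_lebesgue_integral_def by (rule Bochner_Integration.integral_nonneg) auto
      have "b * exp 1 * r ^ DIM('a) \<ge> 0" using b r by simp
      then have "ennreal (exp (?n * l + ?n * B * (1 + C0)) * (1 + b * exp 1 * r ^ DIM('a) * Y))
          = ennreal (exp (?n * l + ?n * B * (1 + C0))) * (1 + ennreal (b * exp 1 * r ^ DIM('a)) * ennreal Y)"
        using Y by (simp only: ennreal_mult ennreal_plus ennreal_1 exp_ge_zero add_nonneg_nonneg mult_nonneg_nonneg zero_le_one)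
      moreover have "ennreal (exp (?n * u x)) \<le> ennreal (exp (?n * l + ?n * B * (1 + C0)) * (1 + b * exp 1 * r ^ DIM('a) * Y))"
        using le unfolding Y_def mult.assoc by (rule ennreal_leI)
      ultimately show ?thesis unfolding kx[symmetric] Y_def by simp
    qed
    have mk: "(\<lambda>(x, z). ennreal (indicator (ball 0 1) z * (1 / norm z) * \<bar>F (x + r *\<^sub>R z)\<bar>)) \<in> borel_measurable (lborel \<Otimes>\<^sub>M lborel)"
    proof -
      have [measurable]: "(\<lambda>z::'a. indicator (ball 0 1) z :: real) \<in> borel_measurable borel"
        by (rule borel_measurable_indicator) simp
      show ?thesis by measurable
    qed
    have [measurable]: "k \<in> borel_measurable lborel"
      unfolding k_def using mk by (intro lborel.borel_measurable_nn_integral) auto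
    \<comment> \<open>By Tonelli and translation invariance the whole-space integral of the
      potential is a product that does not involve r.\<close>
    have kint: "(\<integral>\<^sup>+x. k x \<partial>lborel) = ennreal (J * \<Lambda>)"
    proof -
      have "(\<integral>\<^sup>+x. k x \<partial>lborel) = (\<integral>\<^sup>+z. (\<integral>\<^sup>+x. ennreal (indicator (ball 0 1) z * (1 / norm z) * \<bar>F (x + r *\<^sub>R z)\<bar>) \<partial>lborel) \<partial>lborel)"
        unfolding k_def using lborel_pair.Fubini'[OF mk] by simp
      also have "\<dots> = (\<integral>\<^sup>+z. ennreal (indicator (ball (0::'a) 1) z * (1 / norm z)) * ennreal \<Lambda> \<partial>lborel)"
      proof (rule nn_integral_cong)
        fix z :: 'a
        have "(\<integral>\<^sup>+x. ennreal (indicator (ball 0 1) z * (1 / norm z) * \<bar>F (x + r *\<^sub>R z)\<bar>) \<partial>lborel)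
            = (\<integral>\<^sup>+x. ennreal (indicator (ball 0 1) z * (1 / norm z)) * ennreal \<bar>F (x + r *\<^sub>R z)\<bar> \<partial>lborel)"
          by (intro nn_integral_cong ennreal_mult) (auto simp: indicator_def)
        also have "\<dots> = ennreal (indicator (ball 0 1) z * (1 / norm z)) * (\<integral>\<^sup>+x. ennreal \<bar>F (x + r *\<^sub>R z)\<bar> \<partial>lborel)"
          by (rule nn_integral_cmult) measurable
        also have "(\<integral>\<^sup>+x. ennreal \<bar>F (x + r *\<^sub>R z)\<bar> \<partial>lborel) = (\<integral>\<^sup>+x. ennreal \<bar>F x\<bar> \<partial>lborel)"
          by (rule nn_integral_translation) measurable
        also have "\<dots> = ennreal \<Lambda>" unfolding \<Lambda>_def by (rule nn_integral_eq_integral) (use F in auto)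
        finally show "(\<integral>\<^sup>+x. ennreal (indicator (ball 0 1) z * (1 / norm z) * \<bar>F (x + r *\<^sub>R z)\<bar>) \<partial>lborel)
          = ennreal (indicator (ball 0 1) z * (1 / norm z)) * ennreal \<Lambda>" .
      qed
      also have "\<dots> = (\<integral>\<^sup>+z. ennreal (indicator (ball (0::'a) 1) z * (1 / norm z)) \<partial>lborel) * ennreal \<Lambda>"
      proof (rule nn_integral_multc)
        have [measurable]: "(\<lambda>z::'a. indicator (ball 0 1) z :: real) \<in> borel_measurable borel"
          by (rule borel_measurable_indicator) simp
        show "(\<lambda>z::'a. ennreal (indicator (ball 0 1) z * (1 / norm z))) \<in> borel_measurable lborel" by measurable
      qed
      also have "(\<integral>\<^sup>+z. ennreal (indicator (ball (0::'a) 1) z * (1 / norm z)) \<partial>lborel) = ennreal J"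
        using nn_integral_eq_integral[OF set_integrable_inverse_norm[OF dim2, unfolded set_integrable_def]]
        unfolding J_def set_lebesgue_integral_def by simp
      finally show ?thesis using J \<Lambda> by (simp add: ennreal_mult)
    qed
    define An where "An = ball (0::'a) (2 * R) - ball 0 R"
    have An: "An \<in> sets lborel" "An \<subseteq> ball 0 (2 * R)" by (auto simp: An_def)
    have ce: "continuous_on A (\<lambda>x. exp (?n * u x))" for A
      by (intro continuous_intros continuous_on_subset[OF cu]) auto
    have S2R: "set_integrable lborel (ball 0 (2 * R)) (\<lambda>x. exp (?n * u x))"
      by (rule set_integrable_continuous_ball[OF ce])
    have SAn: "set_integrable lborel An (\<lambda>x. exp (?n * u x))" by (rule set_integrable_subset[OF S2R An])
    have SR: "set_integrable lborel (ball 0 R) (\<lambda>x. exp (?n * u x))"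
      by (rule set_integrable_continuous_ball[OF ce])
    have split: "conf_volume u (ball 0 (2 * R)) = conf_volume u (ball 0 R) + (LINT x:An|lborel. exp (?n * u x))"
    proof -
      have "ball (0::'a) (2 * R) = ball 0 R \<union> An" "ball 0 R \<inter> An = {}" using R by (auto simp: An_def)
      then show ?thesis unfolding conf_volume_def using set_integral_Un[OF _ SR SAn] by simp
    qed
    define E' where "E' = exp (?n * l + ?n * B * (1 + C0))"
    have vol: "emeasure lborel An \<le> ennreal ((2 * R) ^ DIM('a) * Vol)"
    proof -
      have "emeasure lborel An \<le> emeasure lborel (ball (0::'a) (2 * R))" by (rule emeasure_mono[OF An(2)]) simp
      also have "\<dots> = ennreal ((2 * R) ^ DIM('a) * Vol)"
        using content_ball_conv_unit_ball[of "2 * R" "0::'a"] emeasure_lborel_ball_finite[of "0::'a" "2 * R"] R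
        by (subst emeasure_eq_ennreal_measure) (auto simp: Vol_def)
      finally show ?thesis .
    qed
    have "ennreal (LINT x:An|lborel. exp (?n * u x)) = (\<integral>\<^sup>+x. ennreal (indicator An x *\<^sub>R exp (?n * u x)) \<partial>lborel)"
      unfolding set_lebesgue_integral_def
      by (rule nn_integral_eq_integral[symmetric]) (use SAn in \<open>auto simp: set_integrable_def\<close>)
    \<comment> \<open>The indicator of the annulus is kept only on the constant 1; the potential
      term is enlarged to the whole space.\<close>
    also have "\<dots> \<le> (\<integral>\<^sup>+x. ennreal E' * (indicator An x + ennreal (b * exp 1 * r ^ DIM('a)) * k x) \<partial>lborel)"
    proof (rule nn_integral_mono)
      fix x
      show "ennreal (indicator An x *\<^sub>R exp (?n * u x)) \<le> ennreal E' * (indicator An x + ennreal (b * exp 1 * r ^ DIM('a)) * k x)"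
      proof (cases "x \<in> An")
        case True
        then have "R \<le> norm x" "norm x \<le> 2 * R" by (auto simp: An_def)
        from point_x[OF this] show ?thesis using True unfolding E'_def by simp
      qed simp
    qed
    also have "\<dots> = ennreal E' * (emeasure lborel An + ennreal (b * exp 1 * r ^ DIM('a)) * (\<integral>\<^sup>+x. k x \<partial>lborel))"
      using An(1) by (simp add: nn_integral_cmult nn_integral_add)
    also have "\<dots> \<le> ennreal E' * (ennreal ((2 * R) ^ DIM('a) * Vol) + ennreal (b * exp 1 * r ^ DIM('a)) * ennreal (J * \<Lambda>))"
      unfolding kint by (intro mult_left_mono add_mono vol) auto
    also have "\<dots> = ennreal (E' * ((2 * R) ^ DIM('a) * Vol + b * exp 1 * r ^ DIM('a) * (J * \<Lambda>)))"
      using b r J \<Lambda> R by (simp add: E'_def Vol_def ennreal_mult[symmetric] ennreal_plus[symmetric] del: ennreal_plus)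
    finally have "(LINT x:An|lborel. exp (?n * u x)) \<le> E' * ((2 * R) ^ DIM('a) * Vol + b * exp 1 * r ^ DIM('a) * (J * \<Lambda>))"
      using b r J \<Lambda> R by (subst (asm) ennreal_le_iff) (auto simp: E'_def Vol_def)
    also have "\<dots> \<le> E' * (R ^ DIM('a) * (2 ^ DIM('a) * Vol + b * exp 1 * J * \<Lambda>))"
    proof -
      have "r ^ DIM('a) \<le> R ^ DIM('a)" using R by (intro power_mono) (auto simp: r_def)
      then have "(b * exp 1 * (J * \<Lambda>)) * r ^ DIM('a) \<le> (b * exp 1 * (J * \<Lambda>)) * R ^ DIM('a)"
        using b J \<Lambda> by (intro mult_left_mono) auto
      then show ?thesis unfolding E'_def by (intro mult_left_mono) (auto simp: power_mult_distrib algebra_simps)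
    qed
    \<comment> \<open>The volume factor R^n times e^(n l), a constant times R^(n (\<sigma> - 1)),
      gives the exponent n \<sigma>.\<close>
    also have "\<dots> = E * (2 ^ DIM('a) * Vol + b * exp 1 * J * \<Lambda>) * R powr (?n * \<sigma>)"
    proof -
      have "R ^ DIM('a) = R powr ?n" using R by (simp add: powr_realpow)
      then have "E' * R ^ DIM('a) = E * R powr (?n * \<sigma>)"
        using R by (simp add: E'_def E_def l_def powr_def exp_add[symmetric] algebra_simps)
      then show ?thesis by (simp add: mult_ac)
    qed
    also have "\<dots> \<le> C * R powr (?n * \<sigma>)" unfolding C_def by (intro mult_right_mono) auto
    finally show "conf_volume u (ball 0 (2 * R)) \<le> conf_volume u (ball 0 R) + C * R powr (?n * \<sigma>)"
      unfolding split by simp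
  qed
qed

section \<open>From dyadic annuli to the volume entropy\<close>

lemma dyadic_growth:
  fixes V :: "real \<Rightarrow> real"
  assumes mono: "\<And>r s. r \<le> s \<Longrightarrow> V r \<le> V s" and R: "R \<ge> 1" and C: "C > 0" and d: "d \<ge> 0"
    and step: "\<And>r. r \<ge> R \<Longrightarrow> V (2 * r) \<le> V r + C * r powr d"
  shows "r \<ge> R \<Longrightarrow> r \<le> 2 ^ k * (2 * R) \<Longrightarrow> V r \<le> V (2 * R) + C * real k * r powr d"
proof (induction k arbitrary: r)
  case 0
  then show ?case using mono by simp
next
  case (Suc k)
  have pos: "C * r powr d \<ge> 0" using C by simp
  show ?case
  proof (cases "r \<le> 2 ^ k * (2 * R)")
    case True
    then show ?thesis using Suc.IH[OF Suc.prems(1) True] pos by (simp add: algebra_simps)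
  next
    case False
    have "1 * (2 * R) \<le> 2 ^ k * (2 * R)" using R by (intro mult_right_mono) auto
    then have r2: "r / 2 \<ge> R" using False by simp
    have "V r \<le> V (r / 2) + C * (r / 2) powr d" using step[OF r2] by simp
    also have "V (r / 2) \<le> V (2 * R) + C * real k * (r / 2) powr d"
      using Suc.prems by (intro Suc.IH r2) simp
    finally have "V r \<le> V (2 * R) + C * real (Suc k) * (r / 2) powr d" by (simp add: algebra_simps)
    \<comment> \<open>Every annulus is charged r^d instead of its own smaller power. The resulting
      factor k is logarithmic in r, hence invisible to the entropy, and d = 0 needs no separate
      treatment.\<close>
    also have "(r / 2) powr d \<le> r powr d" using r2 R d by (intro powr_mono2) auto
    then have "V (2 * R) + C * real (Suc k) * (r / 2) powr d \<le> V (2 * R) + C * real (Suc k) * r powr d"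
      using C by (intro add_left_mono mult_left_mono) auto
    finally show ?thesis .
  qed
qed

text \<open>The volume grows at most like (1 + ln r) r^(n \<sigma>). After taking logarithms the
  first factor contributes ln(1 + ln r), which is negligible against n ln r.\<close>

lemma volume_entropy_le:
  fixes u :: "'a::euclidean_space \<Rightarrow> real"
  assumes u: "continuous_on UNIV u" and R: "R \<ge> 1" and C: "C > 0" and \<sigma>: "\<sigma> \<ge> 0"
    and step: "\<And>r. r \<ge> R \<Longrightarrow> conf_volume u (ball 0 (2 * r)) \<le> conf_volume u (ball 0 r) + C * r powr (real DIM('a) * \<sigma>)"
  shows "volume_entropy u \<le> ereal \<sigma>"
proof -
  let ?n = "real DIM('a)"
  define V where "V r = conf_volume u (ball 0 r)" for r
  have S: "set_integrable lborel (ball (0::'a) r) (\<lambda>x. exp (?n * u x))" for r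
    by (intro set_integrable_continuous_ball continuous_intros continuous_on_subset[OF u]) auto
  have mono: "V r \<le> V s" if "r \<le> s" for r s
    unfolding V_def conf_volume_def set_lebesgue_integral_def
    by (rule integral_mono[OF S[unfolded set_integrable_def] S[unfolded set_integrable_def]])
       (use that in \<open>auto simp: indicator_def\<close>)
  have pos: "V r > 0" if "r > 0" for r
  proof -
    have "compact (u ` cball (0::'a) r)" by (intro compact_continuous_image continuous_on_subset[OF u]) auto
    then obtain b where b: "\<And>x. x \<in> cball (0::'a) r \<Longrightarrow> \<bar>u x\<bar> \<le> b"
      using compact_imp_bounded bounded_real by (metis image_eqI)
    have i: "integrable lborel (\<lambda>x. indicator (ball (0::'a) r) x *\<^sub>R exp (?n * (- b)))"
      using set_integrable_continuous_ball[OF continuous_on_const] unfolding set_integrable_def .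
    have "(LINT x|lborel. indicator (ball (0::'a) r) x *\<^sub>R exp (?n * (- b))) \<le> V r"
      unfolding V_def conf_volume_def set_lebesgue_integral_def
    proof (rule integral_mono[OF i S[of r, unfolded set_integrable_def]])
      fix x :: 'a
      show "indicator (ball 0 r) x *\<^sub>R exp (?n * (- b)) \<le> indicator (ball 0 r) x *\<^sub>R exp (?n * u x)"
      proof (cases "x \<in> ball 0 r")
        case True
        then have "\<bar>u x\<bar> \<le> b" by (intro b) auto
        then have "?n * (- b) \<le> ?n * u x" by (intro mult_left_mono) auto
        then show ?thesis using True by simp
      qed simp
    qed
    moreover have "(LINT x|lborel. indicator (ball (0::'a) r) x *\<^sub>R exp (?n * (- b))) > 0"
      using content_ball_pos[OF that, of "0::'a"] by simp
    ultimately show ?thesis by linarith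
  qed
  define D where "D = V (2 * R) + C * (1 / ln 2 + 1)"
  have D: "D > 0" unfolding D_def using pos[of "2 * R"] R C by (intro add_pos_pos mult_pos_pos) auto
  define c where "c = measure lborel (ball (0::'a) 1)"
  have c: "c > 0" unfolding c_def using content_ball_pos[of 1 "0::'a"] by simp
  have growth: "V r \<le> D * (1 + ln r) * r powr (?n * \<sigma>)" if r: "r \<ge> R" for r
  proof -
    \<comment> \<open>About log 2 r halvings bring r down to the base interval, at most 2 R.\<close>
    define k where "k = nat \<lceil>log 2 r\<rceil>"
    have r1: "r \<ge> 1" using r R by simp
    have l0: "ln r \<ge> 0" using r1 by simp
    have lg: "log 2 r \<ge> 0" using r1 by simp
    have k1: "log 2 r \<le> real k" "real k \<le> log 2 r + 1" using lg by (auto simp: k_def)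
    have "r = 2 powr log 2 r" using r1 by simp
    also have "\<dots> \<le> 2 powr real k" using k1 by (intro powr_mono) auto
    also have "\<dots> = 2 ^ k" by (simp add: powr_realpow)
    also have "\<dots> \<le> 2 ^ k * (2 * R)" using R by simp
    finally have "r \<le> 2 ^ k * (2 * R)" .
    then have "V r \<le> V (2 * R) + C * real k * r powr (?n * \<sigma>)"
      using dyadic_growth[of V R C "?n * \<sigma>" r k] mono R C \<sigma> step r unfolding V_def by simp
    also have "\<dots> \<le> V (2 * R) * (1 + ln r) * r powr (?n * \<sigma>) + C * (1 / ln 2 + 1) * (1 + ln r) * r powr (?n * \<sigma>)"
    proof (rule add_mono)
      have p1: "1 \<le> r powr (?n * \<sigma>)" using r1 \<sigma> by (intro ge_one_powr_ge_zero) auto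
      have "V (2 * R) * 1 * 1 \<le> V (2 * R) * (1 + ln r) * r powr (?n * \<sigma>)"
        using pos[of "2 * R"] R l0 p1 by (intro mult_mono) auto
      then show "V (2 * R) \<le> V (2 * R) * (1 + ln r) * r powr (?n * \<sigma>)" by simp
      have "real k \<le> ln r / ln 2 + 1" using k1 by (simp add: log_def)
      also have "\<dots> \<le> (1 / ln 2 + 1) * (1 + ln r)" using l0 by (simp add: algebra_simps add_divide_distrib)
      finally have "C * real k \<le> C * ((1 / ln 2 + 1) * (1 + ln r))" using C by (intro mult_left_mono) auto
      then show "C * real k * r powr (?n * \<sigma>) \<le> C * (1 / ln 2 + 1) * (1 + ln r) * r powr (?n * \<sigma>)"
        by (intro mult_right_mono) (auto simp: mult.assoc)
    qed
    also have "\<dots> = D * (1 + ln r) * r powr (?n * \<sigma>)" by (simp add: D_def algebra_simps)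
    finally show ?thesis .
  qed
  have vol: "ln (measure lborel (ball (0::'a) r)) = ln c + ?n * ln r" if "r > 0" for r
    using content_ball_conv_unit_ball[of r "0::'a"] that c by (simp add: c_def[symmetric] ln_mult ln_realpow)
  define q where "q r = (ln D + ln (1 + ln r) + ?n * \<sigma> * ln r) / (ln c + ?n * ln r)" for r
  have npos: "?n > 0" by simp
  have lim: "(q \<longlongrightarrow> \<sigma>) at_top"
  proof -
    define N where "N = ?n"
    have N: "N > 0" by (simp add: N_def)
    have "((\<lambda>r. (ln D + ln (1 + ln r) + N * \<sigma> * ln r) / (ln c + N * ln r)) \<longlongrightarrow> (N * \<sigma>) / N) at_top"
      using N by real_asymp
    then show ?thesis using N unfolding q_def N_def by simp
  qed
  have "eventually (\<lambda>r. ln c + ?n * ln r > 0) at_top"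
  proof -
    define N where "N = ?n"
    have N: "N > 0" by (simp add: N_def)
    have "eventually (\<lambda>r. ln c + N * ln r > 0) at_top" using N by real_asymp
    then show ?thesis unfolding N_def .
  qed
  moreover have "eventually (\<lambda>r. r \<ge> R) at_top" by (rule eventually_ge_at_top)
  ultimately have "eventually (\<lambda>r. ereal (ln (conf_volume u (ball 0 r)) / ln (measure lborel (ball (0::'a) r))) \<le> ereal (q r)) at_top"
  proof eventually_elim
    case (elim r)
    have r: "r > 0" "r \<ge> 1" using elim R by auto
    have l0: "ln r \<ge> 0" using r by simp
    have "ln (V r) \<le> ln (D * (1 + ln r) * r powr (?n * \<sigma>))"
      using growth[OF elim(2)] pos[OF r(1)] by (intro ln_mono) auto
    also have "\<dots> = ln D + ln (1 + ln r) + ?n * \<sigma> * ln r"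
    proof -
      have "1 + ln r > 0" using l0 by linarith
      then show ?thesis using D r by (simp add: ln_mult ln_powr)
    qed
    finally show ?case unfolding V_def[symmetric] vol[OF r(1)] q_def
      using elim(1) by (simp add: divide_right_mono)
  qed
  then have "volume_entropy u \<le> Limsup at_top (\<lambda>r. ereal (q r))"
    unfolding volume_entropy_def by (rule Limsup_mono)
  also have "\<dots> = ereal \<sigma>"
    by (rule lim_imp_Limsup) (use lim in auto)
  finally show ?thesis .
qed

theorem theorem1p10:
  fixes u :: "real ^ 'n \<Rightarrow> real" and C p :: real
  assumes "CARD('n) \<ge> 4" and "even CARD('n)"
    and "smooth u"
    and "conf_complete u"
    and "finite_total_Q_curvature u"
    and "C > 0" and "p \<ge> 0"
    and "\<exists>K. compact K \<and> (\<forall>x\<in>-K. scalar_curvature u x \<ge> C * norm x powr (-p))"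
  shows "volume_entropy u \<le> ereal (min 1 (p / 2))"
proof -
  note u = assms(3)
  let ?d = "DIM(real ^ 'n)"
  obtain M where M: "?d = 2 * Suc M" "M \<ge> 1"
  proof -
    obtain j where "CARD('n) = 2 * j" using assms(2) by blast
    then show ?thesis using that[of "j - 1"] assms(1) by simp
  qed
  have d2: "?d div 2 = Suc M" using M by simp
  have nl: "(\<lambda>(f :: real ^ 'n \<Rightarrow> real) y. - laplacian f y) = neg_laplacian"
    by (simp add: neg_laplacian_def fun_eq_iff)
  have f: "integrable lborel ((neg_laplacian ^^ Suc M) u)"
    using assms(5) unfolding finite_total_Q_curvature_def Q_curvature_def d2 nl by simp
  obtain K where K: "compact K" "\<And>x. x \<notin> K \<Longrightarrow> scalar_curvature u x \<ge> C * norm x powr (-p)"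
    using assms(8) by auto
  obtain R0 where R0: "\<And>x. x \<in> K \<Longrightarrow> norm x < R0"
    using compact_imp_bounded[OF K(1)] bounded_pos_less by metis
  \<comment> \<open>Dividing the scalar curvature by 2 (n - 1) leaves M = (n - 2)/2 as the
    coefficient of the gradient term.\<close>
  define c where "c = C / (2 * (real ?d - 1))"
  have dn: "real ?d - 1 > 0" using M by simp
  have c: "c > 0" using assms(6) dn by (simp add: c_def)
  have curv: "real M * (norm (gradient u y))\<^sup>2 + c * norm y powr (- p) * exp (2 * u y) \<le> neg_laplacian u y"
    if "norm y \<ge> R0" for y
  proof -
    have "y \<notin> K" using R0[of y] that by auto
    define X where "X = neg_laplacian u y - real M * (norm (gradient u y))\<^sup>2"
    have "(real ?d - 2) / 2 = real M" using M by simp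
    then have "scalar_curvature u y = 2 * (real ?d - 1) * exp (- 2 * u y) * X"
      unfolding scalar_curvature_def X_def neg_laplacian_def by simp
    then have "C * norm y powr (- p) \<le> 2 * (real ?d - 1) * exp (- 2 * u y) * X"
      using K(2)[OF \<open>y \<notin> K\<close>] by simp
    then have "C * norm y powr (- p) * exp (2 * u y) \<le> 2 * (real ?d - 1) * exp (- 2 * u y) * X * exp (2 * u y)"
      by (intro mult_right_mono) auto
    also have "\<dots> = 2 * (real ?d - 1) * X" by (simp add: exp_minus)
    finally have "c * norm y powr (- p) * exp (2 * u y) \<le> X"
      using dn by (simp add: c_def field_simps)
    then show ?thesis by (simp add: X_def)
  qed
  have u2: "C_k 2 u" using u by (simp add: smooth_def)
  have cu: "continuous_on UNIV u" using u by (rule smooth_continuous)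
  have [measurable]: "u \<in> borel_measurable borel" using cu by (rule borel_measurable_continuous_onI)
  \<comment> \<open>The case a = M, \<sigma> = 1: superharmonicity of e^(M u) near infinity bounds
    its means.\<close>
  have one: "volume_entropy u \<le> ereal 1"
  proof -
    let ?w = "\<lambda>x. exp (real M * u x)"
    have "laplacian ?w y \<le> 0" if "norm y \<ge> R0" for y
    proof -
      have "0 \<le> c * norm y powr (- p) * exp (2 * u y)" using c by simp
      then have "laplacian u y + real M * (norm (gradient u y))\<^sup>2 \<le> 0"
        using curv[OF that] by (simp add: neg_laplacian_def)
      then show ?thesis unfolding exp_scaled_C_k_2(2)[OF u2] by (intro mult_nonneg_nonpos) auto
    qed
    then obtain C' where C': "C' > 0" "\<And>R. R \<ge> 1 \<Longrightarrow> (LINT z:ball 0 R|lborel. ?w z) \<le> C' * R ^ ?d"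
      using superharmonic_mean_bound[OF M(1) _ exp_scaled_C_k_2(1)[OF u2], of "real M" R0] M(2) by auto
    \<comment> \<open>12 is the ratio of 3 R to R/4: the ball about x is enlarged to one about the
      origin.\<close>
    define D where "D = C' * 12 ^ ?d"
    have D: "D > 0" using C' by (simp add: D_def)
    have mean: "(LINT z:ball 0 1|lborel. exp (real M * u (x + (R / 4) *\<^sub>R z))) \<le> D * R powr (real M * (1 - 1))"
      if R: "R \<ge> 1" and x: "R \<le> norm x" "norm x \<le> 2 * R" for R x
    proof -
      have Sw: "set_integrable lborel (ball (0::real^'n) (3 * R)) ?w"
        by (intro set_integrable_continuous_ball continuous_intros continuous_on_subset[OF cu]) auto
      have Sw': "set_integrable lborel (ball x (R / 4)) ?w"
        by (intro set_integrable_continuous_ball continuous_intros continuous_on_subset[OF cu]) auto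
      have "(R / 4) ^ ?d * (LINT z:ball 0 1|lborel. ?w (x + (R / 4) *\<^sub>R z)) = (LINT y:ball x (R / 4)|lborel. ?w y)"
        by (rule set_integral_affine_ball[symmetric]) (use R in auto)
      also have "\<dots> \<le> (LINT y:ball 0 (3 * R)|lborel. ?w y)"
        unfolding set_lebesgue_integral_def
      proof (rule integral_mono[OF Sw'[unfolded set_integrable_def] Sw[unfolded set_integrable_def]])
        fix y
        have "y \<in> ball 0 (3 * R)" if "y \<in> ball x (R / 4)"
        proof -
          have "norm (y - x) < R / 4" using that by (simp add: dist_norm norm_minus_commute)
          then show ?thesis using norm_triangle_ineq[of x "y - x"] x R by simp
        qed
        then show "indicator (ball x (R / 4)) y *\<^sub>R ?w y \<le> indicator (ball 0 (3 * R)) y *\<^sub>R ?w y"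
          by (cases "y \<in> ball x (R / 4)") (auto simp del: mem_ball)
      qed
      also have "\<dots> \<le> C' * (3 * R) ^ ?d" by (rule C'(2)) (use R in simp)
      also have "\<dots> = (R / 4) ^ ?d * D"
      proof -
        have "(3 * R) ^ ?d = (12 * (R / 4)) ^ ?d" by simp
        also have "\<dots> = 12 ^ ?d * (R / 4) ^ ?d" by (rule power_mult_distrib)
        finally show ?thesis by (simp add: D_def)
      qed
      finally have "(LINT z:ball 0 1|lborel. ?w (x + (R / 4) *\<^sub>R z)) \<le> D"
        by (rule mult_left_le_imp_le) (use R in simp)
      then show ?thesis using R by simp
    qed
    obtain C1 R1 where "C1 > 0" "R1 \<ge> 1"
      "\<And>R. R \<ge> R1 \<Longrightarrow> conf_volume u (ball 0 (2 * R)) \<le> conf_volume u (ball 0 R) + C1 * R powr (real ?d * 1)"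
      by (rule annulus_volume_bound[where ?R1.0 = 1, OF M u f assms(7) c curv _ D mean]) (use M in auto)
    then show ?thesis by (intro volume_entropy_le[OF cu]) auto
  qed
  \<comment> \<open>The case a = 2, \<sigma> = p/2: the zero-order term of the curvature inequality
    lets the energy estimate bound the means of e^(2 u).\<close>
  have two: "volume_entropy u \<le> ereal (p / 2)"
  proof -
    obtain C0 where C0: "C0 > 0" and energy:
      "\<And>(v::real^'n \<Rightarrow> real) A. C_k 2 v \<Longrightarrow> A \<ge> 0 \<Longrightarrow>
      (\<And>z. norm z < 2 \<Longrightarrow> real M * (norm (gradient v z))\<^sup>2 + A * exp (2 * v z) \<le> neg_laplacian v z) \<Longrightarrow>
      (LINT z:ball 0 1|lborel. neg_laplacian v z) \<le> C0 \<and> A * (LINT z:ball 0 1|lborel. exp (2 * v z)) \<le> C0"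
      using energy_bound[OF M(2)] by blast
    \<comment> \<open>Solves D R^(p - 2) = C0 / A for the coefficient A of the rescaled curvature
      inequality.\<close>
    define D where "D = C0 * 16 * 3 powr p / c"
    have D: "D > 0" using C0 c by (simp add: D_def)
    have mean: "(LINT z:ball 0 1|lborel. exp (2 * u (x + (R / 4) *\<^sub>R z))) \<le> D * R powr (2 * (p / 2 - 1))"
      if R: "R \<ge> max 1 (2 * R0)" and x: "R \<le> norm x" "norm x \<le> 2 * R" for R x
    proof -
      define A where "A = (R / 4)\<^sup>2 * c * (3 * R) powr (- p)"
      have R1: "R > 0" "R / 2 \<ge> R0" using R by auto
      have A: "A > 0" using c R1 by (simp add: A_def)
      have "C_k 2 (\<lambda>z. u (x + (R / 4) *\<^sub>R z))" using C_k_affine[OF u2, of 1] by simp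
      from energy[OF this less_imp_le[OF A]]
      have "A * (LINT z:ball 0 1|lborel. exp (2 * u (x + (R / 4) *\<^sub>R z))) \<le> C0"
        using scaled_curvature[OF u assms(7) c curv R1 x] unfolding A_def by blast
      then have "(LINT z:ball 0 1|lborel. exp (2 * u (x + (R / 4) *\<^sub>R z))) \<le> C0 / A"
        using A by (simp add: pos_le_divide_eq mult.commute)
      also have "C0 / A = D * R powr (2 * (p / 2 - 1))"
      proof -
        have e: "2 * (p / 2 - 1) = p - 2" by simp
        have q: "(3 * R) powr (- p) = inverse (3 powr p * R powr p)"
          using R1 by (simp add: powr_minus powr_mult)
        have s: "R powr (p - 2) = R powr p / R\<^sup>2" using R1 by (simp add: powr_diff)
        show ?thesis unfolding A_def D_def e q s using R1 c by (simp add: field_simps)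
      qed
      finally show ?thesis .
    qed
    obtain C1 R1 where "C1 > 0" "R1 \<ge> 1"
      "\<And>R. R \<ge> R1 \<Longrightarrow> conf_volume u (ball 0 (2 * R)) \<le> conf_volume u (ball 0 R) + C1 * R powr (real ?d * (p / 2))"
      by (rule annulus_volume_bound[where ?R1.0 = "max 1 (2 * R0)", OF M u f assms(7) c curv _ D mean]) auto
    then show ?thesis by (intro volume_entropy_le[OF cu]) (use assms(7) in auto)
  qed
  show ?thesis using one two by (simp add: min_def)
qed

end
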